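(* Let $S_1\colon H_1\to\mathcal{G}_1$ be a compact linear operator between real Hilbert spaces, let $\lambda=(\lambda_m)_{m\in\mathbb{N}}$ be the non-increasing sequence of eigenvalues of $S_1^\dagger S_1$ (extended by zeros), and assume $\lambda_2>0$. Let $(s_d)_{d\in\mathbb{N}}$ be a sequence of positive reals and let $S_{(s)}=(S_{d,s_d}\colon\mathcal{F}_d\to\mathcal{G}_d)_{d\in\mathbb{N}}$ be the associated scaled tensor product problem, with initial error $\varepsilon_d^{\mathrm{init}}=\sqrt{s_d\lambda_1^d}$. Consider the worst case setting with respect to the absolute error criterion. (1) If $\limsup_{d\to\infty}\frac1d\ln(\varepsilon_d^{\mathrm{init}})>0$, then $S_{(s)}$ suffers from the curse of dimensionality. (2) Let $\varepsilon_d^{\mathrm{init}}\in\Theta(d^\alpha)$, as $d\to\infty$, for some $\alpha\ge0$. If $\lambda_1=\lambda_2$, then $S_{(s)}$ suffers from the curse of dimensionality. If $\lambda_1>\lambda_2$, then $S_{(s)}$ is weakly tractable if and only if $\lambda_n\in o\big((\ln n)^{-2(1+\alpha)}\big)$, as $n\to\infty$. (3) Let $\varepsilon_d^{\mathrm{init}}\to0$, as $d\to\infty$. Then $S_{(s)}$ does not suffer from the curse of dimensionality. Furthermore, $S_{(s)}$ is weakly tractable if and only if (i) $\lambda_1=\lambda_2$ and $\lambda_n\in o((\ln n)^{-2})$, as $n\to\infty$, and $\varepsilon_d^{\mathrm{init}}\in o(1/d)$, as $d\to\infty$, or (ii) $\lambda_1>\lambda_2$ and $\lambda_n\in o((\ln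 n)^{-2})$, as $n\to\infty$.
   Context: Tensor product problem: for $d\in\mathbb{N}$ let $H_d=H_1\otimes\cdots\otimes H_1$ and $\mathcal{G}_d=\mathcal{G}_1\otimes\cdots\otimes\mathcal{G}_1$ be the $d$-fold Hilbert space tensor products and $S_d=S_1\otimes\cdots\otimes S_1\colon H_d\to\mathcal{G}_d$. Scaled problem: $\mathcal{F}_d$ is the vector space $H_d$ equipped with the inner product $\langle\cdot,\cdot\rangle_{\mathcal{F}_d}=\frac1{s_d}\langle\cdot,\cdot\rangle_{H_d}$, and $S_{d,s_d}\colon\mathcal{F}_d\to\mathcal{G}_d$ is $S_d$ regarded as an operator on $\mathcal{F}_d$. Eigenvalues of $S_1^\dagger S_1$ are counted with multiplicity and listed non-increasingly; if there are only finitely many positive ones, the sequence is extended by zeros. Worst case setting: the $n$th minimal error is $e(n,d)=\inf_A\sup_{\|f\mid\mathcal{F}_d\|\le1}\|S_{d,s_d}f-Af\mid\mathcal{G}_d\|$, the infimum being over linear algorithms $Af=\sum_{j=1}^nL_j(f)g_j$ with continuous linear functionals $L_j$ on $\mathcal{F}_d$ and $g_j\in\mathcal{G}_d$ ($A=0$ if $n=0$). The initial error is $\varepsilon_d^{\mathrm{init}}=e(0,d)$. The information complexity for the absolute error criterion is $n(\varepsilon,d)=\min\{n\in\mathbb{N}_0\mid e(n,d)\le\varepsilon\}$. Curse of dimensionality: there are $\varepsilon>0$ and constants $C,\gamma>0$ with $n(\varepsilon,d)\ge C(1+\gamma)^d$ for infinitely many $d\in\mathbb{N}$. Weak tractability: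 $\ln n(\varepsilon_k,d_k)/(\varepsilon_k^{-1}+d_k)\to0$ for every sequence $((\varepsilon_k,d_k))_{k}\subset(0,1]\times\mathbb{N}$ with $\varepsilon_k<\varepsilon_{d_k}^{\mathrm{init}}$ for all $k$ and $\varepsilon_k^{-1}+d_k\to\infty$. $f_d\in\Theta(g_d)$ means $f_d\in\mathcal{O}(g_d)$ and $g_d\in\mathcal{O}(f_d)$. *)

theory Defs
  imports "HOL-Analysis.Analysis" "HOL-Library.Landau_Symbols"
begin

text \<open>
  A real Hilbert space is a type of sort \<open>{real_inner, complete_space}\<close>, or a closed linear
  subspace of such a type. All sequences indexed by the positive integers are functions on
  \<open>nat\<close> whose value at 0 is irrelevant.
\<close>

subsection \<open>Compact operators and eigenvalues\<close>

definition compact_operator :: "('a::real_normed_vector \<Rightarrow> 'b::real_normed_vector) \<Rightarrow> bool" where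
  "compact_operator f \<longleftrightarrow> linear f \<and> (\<forall>B. bounded B \<longrightarrow> compact (closure (f ` B)))"

text \<open>
  The non-increasing sequence of eigenvalues of \<open>T\<close>, for \<open>T\<close> compact, self-adjoint and positive
  semidefinite. Every positive real \<open>\<mu>\<close> occurs as often as the dimension of its eigenspace
  (which is finite, and 0 if \<open>\<mu>\<close> is not an eigenvalue). The remaining entries are 0; by
  monotonicity, there are none if infinitely many entries are positive.
\<close>

definition eigenvalue_sequence :: "('a::real_vector \<Rightarrow> 'a) \<Rightarrow> (nat \<Rightarrow> real) \<Rightarrow> bool" where
  "eigenvalue_sequence T lam \<longleftrightarrow>
     (\<forall>m\<ge>1. 0 \<le> lam m) \<and>
     (\<forall>m n. 1 \<le> m \<and> m \<le> n \<longrightarrow> lam n \<le> lam m) \<and>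
     (\<forall>\<mu>>0. finite {m. 1 \<le> m \<and> lam m = \<mu>} \<and>
            card {m. 1 \<le> m \<and> lam m = \<mu>} = dim {x. T x = \<mu> *\<^sub>R x})"

subsection \<open>Hilbert space tensor powers\<close>

text \<open>
  The \<open>d\<close>-fold Hilbert space tensor power of a Hilbert space is determined, up to a unique
  isometric isomorphism, as a Hilbert space that is the closed linear span of elementary
  tensors \<open>x\<^sub>1 \<otimes> \<dots> \<otimes> x\<^sub>d\<close> with
  \<open>\<langle>x\<^sub>1 \<otimes> \<dots> \<otimes> x\<^sub>d, y\<^sub>1 \<otimes> \<dots> \<otimes> y\<^sub>d\<rangle> = \<Prod>i. \<langle>x\<^sub>i, y\<^sub>i\<rangle>\<close>.
  The powers for different \<open>d\<close> are realised as closed subspaces of one Hilbert space type, e.g.\ of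
  the Hilbert space direct sum of all of them; no relation between different \<open>d\<close> is imposed. The
  function \<open>\<tau>\<close> sends the list \<open>[x\<^sub>1, \<dots>, x\<^sub>d]\<close> to \<open>x\<^sub>1 \<otimes> \<dots> \<otimes> x\<^sub>d\<close>. Multilinearity of \<open>\<tau>\<close>
  follows from the inner product formula, see below.
\<close>

definition elementary_tensors ::
    "('a::real_inner list \<Rightarrow> 'b::{real_inner, complete_space}) \<Rightarrow> bool" where
  "elementary_tensors \<tau> \<longleftrightarrow>
     (\<forall>xs ys. xs \<noteq> [] \<and> length xs = length ys \<longrightarrow>
        \<tau> xs \<bullet> \<tau> ys = (\<Prod>i<length xs. (xs ! i) \<bullet> (ys ! i)))"

definition tensor_power :: "('a list \<Rightarrow> 'b::real_normed_vector) \<Rightarrow> nat \<Rightarrow> 'b set" where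
  "tensor_power \<tau> d = closure (span (\<tau> ` {xs. length xs = d}))"

lemma elementary_tensors_update:
  assumes "elementary_tensors \<tau>" "length ys = length xs" "i < length xs"
  shows "\<tau> (xs[i := x]) \<bullet> \<tau> ys
           = (x \<bullet> (ys ! i)) * (\<Prod>j\<in>{..<length xs} - {i}. (xs ! j) \<bullet> (ys ! j))"
proof -
  have "\<tau> (xs[i := x]) \<bullet> \<tau> ys = (\<Prod>j<length xs. (xs[i := x] ! j) \<bullet> (ys ! j))"
    using assms unfolding elementary_tensors_def
    by (metis length_list_update list.size(3) not_less_zero)
  also have "\<dots> = (x \<bullet> (ys ! i)) *
      (\<Prod>j\<in>{..<length xs} - {i}. (xs[i := x] ! j) \<bullet> (ys ! j))"
    using assms(3) by (subst prod.remove[of _ i]) auto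
  also have "(\<Prod>j\<in>{..<length xs} - {i}. (xs[i := x] ! j) \<bullet> (ys ! j))
      = (\<Prod>j\<in>{..<length xs} - {i}. (xs ! j) \<bullet> (ys ! j))"
    by (intro prod.cong) auto
  finally show ?thesis .
qed

lemma elementary_tensors_multilinear:
  assumes "elementary_tensors \<tau>" "i < length xs"
  shows "linear (\<lambda>x. \<tau> (xs[i := x]))"
proof (rule linearI)
  fix x y :: 'a and c :: real
  let ?t = "\<lambda>x. \<tau> (xs[i := x])"
  let ?u = "?t (x + y) - (?t x + ?t y)" and ?v = "?t (c *\<^sub>R x) - c *\<^sub>R ?t x"
  have "?u \<bullet> ?t z = 0" "?v \<bullet> ?t z = 0" for z
    using assms by (simp_all add: inner_diff_left inner_add_left elementary_tensors_update
        algebra_simps)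
  then have "?u \<bullet> ?u = 0" "?v \<bullet> ?v = 0"
    by (simp_all only: inner_diff_right[of ?u] inner_diff_right[of ?v] inner_add_right
        inner_scaleR_right)
  then show "?t (x + y) = ?t x + ?t y" "?t (c *\<^sub>R x) = c *\<^sub>R ?t x"
    by simp_all
qed

definition bounded_linear_on ::
    "'a::real_vector set \<Rightarrow> ('a \<Rightarrow> real) \<Rightarrow> ('a \<Rightarrow> 'b::real_normed_vector) \<Rightarrow> bool" where
  "bounded_linear_on V N f \<longleftrightarrow>
     (\<forall>x\<in>V. \<forall>y\<in>V. f (x + y) = f x + f y) \<and>
     (\<forall>c. \<forall>x\<in>V. f (c *\<^sub>R x) = c *\<^sub>R f x) \<and>
     (\<exists>K. \<forall>x\<in>V. norm (f x) \<le> K * N x)"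

text \<open>
  \<open>T\<close> restricts to the operator \<open>S\<^sub>1 \<otimes> \<dots> \<otimes> S\<^sub>1\<close> on the \<open>d\<close>-fold tensor power; this determines \<open>T\<close>
  there, and its values elsewhere are never used.
\<close>

definition tensor_power_operator ::
    "('h list \<Rightarrow> 'a::real_normed_vector) \<Rightarrow> ('g list \<Rightarrow> 'b::real_normed_vector) \<Rightarrow>
     ('h \<Rightarrow> 'g) \<Rightarrow> nat \<Rightarrow> ('a \<Rightarrow> 'b) \<Rightarrow> bool" where
  "tensor_power_operator \<tau>H \<tau>G S1 d T \<longleftrightarrow>
     T ` tensor_power \<tau>H d \<subseteq> tensor_power \<tau>G d \<and>
     bounded_linear_on (tensor_power \<tau>H d) norm T \<and>
     (\<forall>xs. length xs = d \<longrightarrow> T (\<tau>H xs) = \<tau>G (map S1 xs))"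

subsection \<open>Worst case errors\<close>

definition scaled_inner :: "real \<Rightarrow> 'a::real_inner \<Rightarrow> 'a \<Rightarrow> real" where
  "scaled_inner c f g = (1 / c) * (f \<bullet> g)"

definition scaled_norm :: "real \<Rightarrow> 'a::real_inner \<Rightarrow> real" where
  "scaled_norm c f = sqrt (scaled_inner c f f)"

text \<open>
  In the following, the source space is the subspace \<open>V\<close> with the norm \<open>N\<close>, and the target
  space is the subspace \<open>W\<close> with the norm of its type.
\<close>

definition linear_algorithms ::
    "'a::real_vector set \<Rightarrow> ('a \<Rightarrow> real) \<Rightarrow> 'b::real_normed_vector set \<Rightarrow> nat \<Rightarrow> ('a \<Rightarrow> 'b) set" where
  "linear_algorithms V N W n =
     {A. \<exists>L g. (\<forall>j\<in>{1..n}. bounded_linear_on V N (L j :: 'a \<Rightarrow> real) \<and> g j \<in> W) \<and>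
               A = (\<lambda>f. \<Sum>j=1..n. L j f *\<^sub>R g j)}"

definition worst_case_error ::
    "'a set \<Rightarrow> ('a \<Rightarrow> real) \<Rightarrow> ('a \<Rightarrow> 'b::real_normed_vector) \<Rightarrow> ('a \<Rightarrow> 'b) \<Rightarrow> real" where
  "worst_case_error V N T A = (SUP f\<in>{f\<in>V. N f \<le> 1}. norm (T f - A f))"

definition minimal_error ::
    "'a::real_vector set \<Rightarrow> ('a \<Rightarrow> real) \<Rightarrow> 'b::real_normed_vector set \<Rightarrow> ('a \<Rightarrow> 'b) \<Rightarrow> nat \<Rightarrow> real" where
  "minimal_error V N W T n = (INF A\<in>linear_algorithms V N W n. worst_case_error V N T A)"

text \<open>The \<open>n\<close>th minimal error \<open>e(n,d)\<close> of the scaled tensor product problem.\<close>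

definition scaled_problem_error ::
    "('h list \<Rightarrow> 'a::real_inner) \<Rightarrow> ('g list \<Rightarrow> 'b::real_normed_vector) \<Rightarrow>
     (nat \<Rightarrow> 'a \<Rightarrow> 'b) \<Rightarrow> (nat \<Rightarrow> real) \<Rightarrow> nat \<Rightarrow> nat \<Rightarrow> real" where
  "scaled_problem_error \<tau>H \<tau>G S s n d =
     minimal_error (tensor_power \<tau>H d) (scaled_norm (s d)) (tensor_power \<tau>G d) (S d) n"

subsection \<open>Tractability for the absolute error criterion\<close>

text \<open>
  Here \<open>e n d\<close> is the \<open>n\<close>th minimal error of the \<open>d\<close>-variate problem. For compact operators and
  \<open>\<epsilon> > 0\<close> the minimum below exists.
\<close>

definition info_complexity :: "(nat \<Rightarrow> nat \<Rightarrow> real) \<Rightarrow> real \<Rightarrow> nat \<Rightarrow> nat" where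
  "info_complexity e \<epsilon> d = (LEAST n. e n d \<le> \<epsilon>)"

definition curse_of_dimensionality :: "(nat \<Rightarrow> nat \<Rightarrow> real) \<Rightarrow> bool" where
  "curse_of_dimensionality e \<longleftrightarrow>
     (\<exists>\<epsilon>>0. \<exists>C>0. \<exists>\<gamma>>0.
        infinite {d. 1 \<le> d \<and> real (info_complexity e \<epsilon> d) \<ge> C * (1 + \<gamma>) ^ d})"

definition weakly_tractable :: "(nat \<Rightarrow> nat \<Rightarrow> real) \<Rightarrow> bool" where
  "weakly_tractable e \<longleftrightarrow>
     (\<forall>(\<epsilon> :: nat \<Rightarrow> real) (d :: nat \<Rightarrow> nat).
        (\<forall>k. 0 < \<epsilon> k \<and> \<epsilon> k \<le> 1 \<and> 1 \<le> d k \<and> \<epsilon> k < e 0 (d k)) \<and>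
        filterlim (\<lambda>k. 1 / \<epsilon> k + real (d k)) at_top sequentially \<longrightarrow>
        (\<lambda>k. ln (real (info_complexity e (\<epsilon> k) (d k))) / (1 / \<epsilon> k + real (d k)))
          \<longlonglongrightarrow> 0)"

end

theory Submission
  imports Defs "HOL-Real_Asymp.Real_Asymp"
begin

text \<open>
  The compact operator \<open>S1\<close> has a singular value decomposition, so the squared singular values of
  its \<open>d\<close>-th tensor power are the products \<open>lam i\<^sub>1 * \<dots> * lam i\<^sub>d\<close>, and the information complexity
  at \<open>\<epsilon>\<close> is the number of multi-indices with \<open>s d * (lam i\<^sub>1 * \<dots> * lam i\<^sub>d) > \<epsilon>\<^sup>2\<close>. Dividing by
  \<open>lam 1\<close>, this is the number \<open>N d t\<close> of products of the weights \<open>w m = lam m / lam 1\<close> exceeding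
  \<open>t = (\<epsilon> / init d)\<^sup>2\<close>.

  Lower bounds on \<open>N d t\<close> come from the multi-indices with entries in \<open>{1, 2}\<close> (curse of
  dimensionality) and from those with a single nontrivial entry (decay of \<open>lam\<close>). For the upper
  bound, let \<open>r\<close> be the multiplicity of the weight 1, \<open>\<beta> < 1\<close> a bound for the remaining weights,
  and \<open>n u\<close> the number of weights above \<open>u\<close>. At most \<open>a = ln (1 / t) / ln (1 / \<beta>)\<close> entries exceed
  \<open>r\<close>, and all of them but one have weight above \<open>sqrt t\<close>, whence
  \<open>ln (N d t) \<le> d * ln r + ln d + ln (n t) + a * (ln d + ln (n (sqrt t)))\<close>.
\<close>

subsection \<open>Singular value decomposition of a compact operator\<close>

text \<open>The exponent \<open>2 * (1 + \<alpha>)\<close> comes from a balance. An index n is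
  counted once \<epsilon> is below \<open>init d * sqrt (w n)\<close>. If \<open>init d\<close>
  grows like \<open>d powr \<alpha>\<close>, the cost \<open>1 / \<epsilon> + d\<close> of seeing n
  is smallest when both terms are comparable, that is for d about X with
  \<open>w n = X powr (- 2 * (1 + \<alpha>))\<close>; weak tractability then demands that
  \<open>ln n\<close> be small compared with X. Conversely, the obstacle is the factor a of the
  upper bound, which grows like \<open>ln (1 / t)\<close>: multiplied by the bound for
  \<open>ln (n t)\<close> it would exceed what the decay permits. It only meets
  \<open>ln (n (sqrt t))\<close>, whose bound is of the order of the square root of the permitted
  amount, so the logarithm is absorbed. The term \<open>d * ln r\<close> vanishes for r = 1 and is
  otherwise controlled by \<open>1 / \<epsilon>\<close> through \<open>init d\<close> being o(1/d).
  A vanishing initial error is bounded and falls under \<alpha> = 0. On the operator side the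
  eigenvectors need not span the space, as S1 may have a large kernel; completeness is replaced by a
  norm bound for S1 on the orthogonal complement of the first k eigenvectors.\<close>

lemma quadratic_nonneg_imp_linear_zero:
  fixes a b :: real
  assumes "\<And>t. 0 \<le> 2 * t * a + t\<^sup>2 * b"
  shows "a = 0"
proof (rule ccontr)
  assume "a \<noteq> 0"
  \<comment> \<open>\<open>c\<close> is positive and dominates \<open>b\<close>, so the parabola
    with \<open>c\<close> in place of \<open>b\<close> lies above the given one, and it is negative
    at its vertex \<open>- a / c\<close>.\<close>
  define c where "c = \<bar>b\<bar> + 1"
  have "c > 0" "b < c" unfolding c_def by linarith+
  have "0 \<le> 2 * (- a / c) * a + (- a / c)\<^sup>2 * b" by (rule assms)
  also have "\<dots> \<le> 2 * (- a / c) * a + (- a / c)\<^sup>2 * c"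
    using \<open>b < c\<close> by (intro add_left_mono mult_left_mono) auto
  also have "\<dots> = - a\<^sup>2 / c"
    using \<open>c > 0\<close> by (simp add: power2_eq_square field_simps)
  also have "\<dots> < 0" using \<open>a \<noteq> 0\<close> \<open>c > 0\<close> by simp
  finally show False by simp
qed

text \<open>An element x of least norm on the hyperplane where f is 1 exists by completeness and is
  orthogonal to the kernel of f; hence f is the inner product with a multiple of x.\<close>

theorem riesz_representation:
  fixes f :: "'a::{real_inner, complete_space} \<Rightarrow> real"
  assumes "bounded_linear f"
  shows "\<exists>z. \<forall>x. f x = x \<bullet> z"
proof (cases "\<forall>x. f x = 0")
  case True
  then show ?thesis by (intro exI[of _ 0]) simp
next
  case False
  interpret f: bounded_linear f by fact
  obtain u where "f u \<noteq> 0" using False by blast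
  then have u1: "f (u /\<^sub>R f u) = 1" by (simp add: f.scaleR)
  define Q where "Q = (\<lambda>x. (norm x)\<^sup>2) ` {x. f x = 1}"
  define q where "q = Inf Q"
  have Qne: "Q \<noteq> {}" unfolding Q_def using u1 by blast
  have Qbdd: "bdd_below Q" unfolding Q_def by (intro bdd_belowI[of _ 0]) auto
  have qle: "q \<le> (norm x)\<^sup>2" if "f x = 1" for x
    unfolding q_def using that by (intro cInf_lower Qbdd) (auto simp: Q_def)
  have "\<exists>x. f x = 1 \<and> (norm x)\<^sup>2 < q + 1 / real (Suc n)" for n
  proof -
    have "Inf Q < q + 1 / real (Suc n)" by (simp add: q_def)
    from cInf_lessD[OF Qne this] show ?thesis unfolding Q_def by auto
  qed
  then obtain X where X: "\<And>n. f (X n) = 1" "\<And>n. (norm (X n))\<^sup>2 < q + 1 / real (Suc n)"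
    by metis
  \<comment> \<open>The midpoint lies on the hyperplane again, so its squared norm is at least q;
    the parallelogram law turns this into the Cauchy estimate.\<close>
  have par: "(norm (X m - X n))\<^sup>2 \<le> 2 / real (Suc m) + 2 / real (Suc n)" for m n
  proof -
    have "f ((1/2) *\<^sub>R (X m + X n)) = 1" by (simp add: f.add f.scaleR X)
    from qle[OF this] have "4 * q \<le> (norm (X m + X n))\<^sup>2"
      by (simp add: power_divide)
    moreover have "(norm (X m - X n))\<^sup>2 + (norm (X m + X n))\<^sup>2
        = 2 * (norm (X m))\<^sup>2 + 2 * (norm (X n))\<^sup>2"
      by (simp add: power2_norm_eq_inner algebra_simps inner_commute)
    ultimately show ?thesis using X(2)[of m] X(2)[of n] by simp
  qed
  have "Cauchy X"
  proof (rule metric_CauchyI)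
    fix r :: real assume "r > 0"
    obtain N where N: "4 / r\<^sup>2 < real N" using reals_Archimedean2 by blast
    show "\<exists>M. \<forall>m\<ge>M. \<forall>n\<ge>M. dist (X m) (X n) < r"
    proof (intro exI allI impI)
      fix m n assume "m \<ge> N" "n \<ge> N"
      have "N > 0" using N \<open>r > 0\<close> by (metis divide_pos_pos gr0I less_le_trans not_less_iff_gr_or_eq
            of_nat_0 zero_less_numeral zero_less_power less_trans)
      have "(norm (X m - X n))\<^sup>2 \<le> 2 / real (Suc m) + 2 / real (Suc n)" by (rule par)
      also have "\<dots> \<le> 2 / real N + 2 / real N"
        using \<open>m \<ge> N\<close> \<open>n \<ge> N\<close> \<open>N > 0\<close> by (intro add_mono divide_left_mono) auto
      also have "\<dots> < r\<^sup>2" using N \<open>N > 0\<close> \<open>r > 0\<close> by (simp add: field_simps)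
      finally have "norm (X m - X n) < r" using \<open>r > 0\<close> by (simp add: power_less_imp_less_base)
      then show "dist (X m) (X n) < r" by (simp add: dist_norm)
    qed
  qed
  then obtain x where x: "X \<longlonglongrightarrow> x" using Cauchy_convergent convergent_def by blast
  have "(\<lambda>n. f (X n)) \<longlonglongrightarrow> f x" by (rule f.tendsto[OF x])
  then have fx: "f x = 1" by (simp add: X LIMSEQ_const_iff)
  have "(norm x)\<^sup>2 \<le> q"
  proof (rule LIMSEQ_le)
    show "(\<lambda>n. (norm (X n))\<^sup>2) \<longlonglongrightarrow> (norm x)\<^sup>2" by (intro tendsto_intros x)
    show "(\<lambda>n. q + 1 / real (Suc n)) \<longlonglongrightarrow> q"
      using tendsto_add[OF tendsto_const LIMSEQ_inverse_real_of_nat, of q]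
      by (simp add: inverse_eq_divide)
    show "\<exists>N. \<forall>n\<ge>N. (norm (X n))\<^sup>2 \<le> q + 1 / real (Suc n)" using X(2) less_imp_le by blast
  qed
  with qle[OF fx] have xq: "(norm x)\<^sup>2 = q" by simp
  \<comment> \<open>Moving from x in a direction of the kernel stays on the hyperplane, so
    minimality gives a nonnegative quadratic in t without constant term.\<close>
  have orth: "x \<bullet> y = 0" if "f y = 0" for y
  proof (rule quadratic_nonneg_imp_linear_zero)
    fix t :: real
    have "f (x + t *\<^sub>R y) = 1" by (simp add: f.add f.scaleR fx that)
    from qle[OF this] have "x \<bullet> x \<le> (x + t *\<^sub>R y) \<bullet> (x + t *\<^sub>R y)"
      by (simp add: xq[symmetric] power2_norm_eq_inner)
    then show "0 \<le> 2 * t * (x \<bullet> y) + t\<^sup>2 * (y \<bullet> y)"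
      by (simp add: inner_simps power2_eq_square inner_commute algebra_simps)
  qed
  have "x \<noteq> 0" using fx f.zero by auto
  show ?thesis
  proof (intro exI allI)
    fix v
    have "f (v - f v *\<^sub>R x) = 0" by (simp add: f.diff f.scaleR fx)
    from orth[OF this] have "v \<bullet> x = f v * (x \<bullet> x)"
      by (simp add: inner_diff_right inner_commute)
    with \<open>x \<noteq> 0\<close> show "f v = v \<bullet> (x /\<^sub>R (x \<bullet> x))" by (simp add: field_simps)
  qed
qed

text \<open>\<open>adjoint\<close> is a Hilbert choice among the maps with this identity, so the
  identity holds once some such map exists; Riesz representation supplies its values one by
  one.\<close>

lemma inner_adjoint:
  fixes S :: "'h::{real_inner, complete_space} \<Rightarrow> 'g::real_inner"
  assumes "bounded_linear S"
  shows "S x \<bullet> y = x \<bullet> adjoint S y"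
proof -
  have "\<exists>z. \<forall>x. S x \<bullet> y = x \<bullet> z" for y
    by (intro riesz_representation bounded_linear_compose[OF bounded_linear_inner_left assms])
  then obtain g where "\<forall>y x. S x \<bullet> y = x \<bullet> g y" by metis
  then have "\<exists>f'. \<forall>x y. S x \<bullet> y = x \<bullet> f' y" by blast
  from someI_ex[OF this] show ?thesis unfolding adjoint_def by blast
qed

text \<open>Linearity follows by testing against all vectors. The bound K of S is inherited via
  \<open>(norm (adjoint S x))\<^sup>2 = S (adjoint S x) \<bullet> x\<close> after cancelling one
  factor.\<close>

lemma bounded_linear_adjoint:
  fixes S :: "'h::{real_inner, complete_space} \<Rightarrow> 'g::real_inner"
  assumes "bounded_linear S"
  shows "bounded_linear (adjoint S)"
proof -
  interpret S: bounded_linear S by fact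
  note adj = inner_adjoint[OF assms]
  obtain K where K: "K \<ge> 0" "\<And>x. norm (S x) \<le> norm x * K" using S.nonneg_bounded by blast
  show ?thesis
  proof (rule bounded_linear_intro[where K = K])
    show "adjoint S (x + y) = adjoint S x + adjoint S y" for x y
      by (rule vector_eq_ldot[THEN iffD1]) (simp add: inner_add_right adj[symmetric])
    show "adjoint S (r *\<^sub>R x) = r *\<^sub>R adjoint S x" for r x
      by (rule vector_eq_ldot[THEN iffD1]) (simp add: adj[symmetric])
    fix x
    have "(norm (adjoint S x))\<^sup>2 = S (adjoint S x) \<bullet> x"
      by (simp add: adj power2_norm_eq_inner)
    also have "\<dots> \<le> norm (S (adjoint S x)) * norm x" by (rule norm_cauchy_schwarz)
    also have "\<dots> \<le> (norm (adjoint S x) * K) * norm x" by (intro mult_right_mono K) auto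
    finally have "norm (adjoint S x) * norm (adjoint S x) \<le> norm (adjoint S x) * (norm x * K)"
      by (simp add: power2_eq_square algebra_simps)
    then show "norm (adjoint S x) \<le> norm x * K"
      using K(1) by (cases "adjoint S x = 0") auto
  qed
qed

section \<open>Compact operators and convergent subsequences\<close>

lemma compact_operator_bounded_linear:
  assumes "compact_operator S"
  shows "bounded_linear S"
proof -
  have lin: "linear S" and "compact (closure (S ` cball 0 1))"
    using assms unfolding compact_operator_def by auto
  then have "bounded (S ` cball 0 1)"
    using bounded_closure_image compact_imp_bounded by (metis bounded_subset closure_subset)
  then obtain K where "\<forall>y\<in>S ` cball 0 1. norm y \<le> K"
    unfolding bounded_iff by blast
  then have K: "\<And>x. norm x \<le> 1 \<Longrightarrow> norm (S x) \<le> K" by simp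
  show ?thesis
  proof (rule bounded_linear_intro[where K = K])
    show "S (x + y) = S x + S y" "S (r *\<^sub>R x) = r *\<^sub>R S x" for x y r
      using lin by (simp_all add: linear_add linear_scale)
    show "norm (S x) \<le> norm x * K" for x
    proof (cases "x = 0")
      case True then show ?thesis using linear_0[OF lin] by simp
    next
      case False
      have "norm (S (x /\<^sub>R norm x)) \<le> K" by (rule K) (use False in simp)
      then show ?thesis using False by (simp add: linear_scale[OF lin] field_simps)
    qed
  qed
qed

lemma compact_operator_convergent_subseq:
  fixes X :: "nat \<Rightarrow> 'a::real_normed_vector"
  assumes "compact_operator S" "\<And>n. norm (X n) \<le> 1"
  obtains r l where "strict_mono r" "(\<lambda>n. S (X (r n))) \<longlonglongrightarrow> l"
proof -
  have "compact (closure (S ` cball 0 1))"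
    using assms unfolding compact_operator_def by auto
  moreover have "\<forall>n. S (X n) \<in> closure (S ` cball 0 1)"
    using assms(2) closure_subset by (fastforce simp: image_iff)
  ultimately show ?thesis
    using that unfolding compact_eq_seq_compact_metric seq_compact_def o_def by meson
qed

definition orthonormal :: "'a::real_inner set \<Rightarrow> bool" where
  "orthonormal B \<longleftrightarrow> (\<forall>x\<in>B. \<forall>y\<in>B. x \<bullet> y = (if x = y then 1 else 0))"

lemma orthonormal_norm: "orthonormal B \<Longrightarrow> x \<in> B \<Longrightarrow> norm x = 1"
  by (auto simp: orthonormal_def norm_eq_sqrt_inner)

lemma orthonormal_independent:
  assumes "orthonormal B"
  shows "independent B"
proof (rule pairwise_orthogonal_independent)
  show "pairwise orthogonal B" using assms by (auto simp: orthonormal_def pairwise_def orthogonal_def)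
  show "0 \<notin> B" using orthonormal_norm[OF assms, of 0] by auto
qed

section \<open>Eigenvectors of a compact operator\<close>

locale compact_op =
  fixes S :: "'h::{real_inner, complete_space} \<Rightarrow> 'g::real_inner"
  assumes compact_S: "compact_operator S"
begin

abbreviation "T \<equiv> adjoint S \<circ> S"

sublocale S: bounded_linear S
  by (rule compact_operator_bounded_linear[OF compact_S])

sublocale adj: bounded_linear "adjoint S"
  by (rule bounded_linear_adjoint[OF S.bounded_linear_axioms])

lemma inner_T: "x \<bullet> T y = S x \<bullet> S y"
  by (simp add: inner_adjoint[OF S.bounded_linear_axioms])

lemma T_inner: "T x \<bullet> y = S x \<bullet> S y"
  by (metis inner_T inner_commute)

text \<open>The images of two members are at squared distance at least \<open>2 * \<delta>\<close>,
  so no sequence of distinct members has a subsequence with convergent images.\<close>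

lemma finite_orthonormal:
  assumes B: "orthonormal B" and orth: "\<And>x y. x \<in> B \<Longrightarrow> y \<in> B \<Longrightarrow> x \<noteq> y \<Longrightarrow> S x \<bullet> S y = 0"
    and low: "\<And>x. x \<in> B \<Longrightarrow> \<delta> \<le> S x \<bullet> S x" and "\<delta> > 0"
  shows "finite B"
proof (rule ccontr)
  assume "infinite B"
  then obtain b :: "nat \<Rightarrow> 'h" where b: "inj b" "range b \<subseteq> B"
    using infinite_countable_subset by blast
  obtain r l where r: "strict_mono r" "(\<lambda>n. S (b (r n))) \<longlonglongrightarrow> l"
    using compact_operator_convergent_subseq[OF compact_S, of b] orthonormal_norm[OF B] b
    by (metis order_refl range_subsetD)
  from r(2) have "Cauchy (\<lambda>n. S (b (r n)))" by (rule LIMSEQ_imp_Cauchy)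
  then obtain M where M: "\<And>m n. m \<ge> M \<Longrightarrow> n \<ge> M \<Longrightarrow> dist (S (b (r m))) (S (b (r n))) < sqrt \<delta>"
    using \<open>\<delta> > 0\<close> unfolding Cauchy_def by (meson real_sqrt_gt_zero)
  let ?x = "b (r M)" and ?y = "b (r (Suc M))"
  have "?x \<noteq> ?y" using b(1) r(1) by (metis injD lessI less_irrefl strict_mono_less)
  have in_B: "?x \<in> B" "?y \<in> B" using b by auto
  have "norm (S ?x - S ?y) < sqrt \<delta>" using M[of M "Suc M"] by (simp add: dist_norm)
  then have "(norm (S ?x - S ?y))\<^sup>2 < \<delta>"
    using \<open>\<delta> > 0\<close> by (metis norm_ge_zero real_less_rsqrt real_sqrt_less_iff real_sqrt_unique
        real_sqrt_power not_less sqrt_le_D)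
  moreover have "(norm (S ?x - S ?y))\<^sup>2 = S ?x \<bullet> S ?x + S ?y \<bullet> S ?y"
    using orth[OF in_B \<open>?x \<noteq> ?y\<close>] by (simp add: power2_norm_eq_inner inner_simps inner_commute)
  ultimately show False using low[OF in_B(1)] low[OF in_B(2)] \<open>\<delta> > 0\<close> by simp
qed

text \<open>Compactness makes every orthonormal set in the eigenspace finite, so a maximal one from
  Zorn's lemma is finite and, by subtracting projections, spans. The last conjunct is the form of
  completeness used later.\<close>

lemma eigenspace_basis:
  assumes "\<mu> > 0"
  shows "\<exists>B. finite B \<and> orthonormal B \<and> B \<subseteq> {x. T x = \<mu> *\<^sub>R x} \<and>
    card B = dim {x. T x = \<mu> *\<^sub>R x} \<and> (\<forall>x. T x = \<mu> *\<^sub>R x \<and> (\<forall>b\<in>B. x \<bullet> b = 0) \<longrightarrow> x = 0)"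
proof -
  let ?E = "{x. T x = \<mu> *\<^sub>R x}"
  have fin: "finite B" if "orthonormal B" "B \<subseteq> ?E" for B
  proof (rule finite_orthonormal[of B \<mu>])
    fix x y assume "x \<in> B" "y \<in> B"
    have "S x \<bullet> S y = \<mu> * (x \<bullet> y)"
      using that \<open>y \<in> B\<close> inner_T[of x y] by auto
    then show "S x \<bullet> S y = 0" if "x \<noteq> y"
      using that \<open>orthonormal B\<close> \<open>x \<in> B\<close> \<open>y \<in> B\<close> by (simp add: orthonormal_def)
  next
    fix x assume "x \<in> B"
    then show "\<mu> \<le> S x \<bullet> S x"
      using that inner_T[of x x] by (auto simp: orthonormal_def)
  qed (use that assms in auto)
  let ?A = "{B. orthonormal B \<and> B \<subseteq> ?E}"
  have "\<exists>M\<in>?A. \<forall>X\<in>?A. M \<subseteq> X \<longrightarrow> X = M"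
  proof (rule subset_Zorn_nonempty)
    show "?A \<noteq> {}" by (auto simp: orthonormal_def intro: exI[of _ "{}"])
    fix C assume C: "C \<noteq> {}" "subset.chain ?A C"
    then have "orthonormal (\<Union>C)"
      unfolding orthonormal_def subset_chain_def by (smt (verit) UnionE mem_Collect_eq subsetD)
    then show "\<Union>C \<in> ?A" using C by (auto simp: subset_chain_def)
  qed
  then obtain B where B: "orthonormal B" "B \<subseteq> ?E"
    and max: "\<And>X. orthonormal X \<Longrightarrow> X \<subseteq> ?E \<Longrightarrow> B \<subseteq> X \<Longrightarrow> X = B" by auto
  have finB: "finite B" by (rule fin[OF B])
  have zero: "x = 0" if x: "T x = \<mu> *\<^sub>R x" "\<forall>b\<in>B. x \<bullet> b = 0" for x
  proof (rule ccontr)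
    assume "x \<noteq> 0"
    let ?u = "x /\<^sub>R norm x"
    have "?u \<bullet> ?u = 1" using \<open>x \<noteq> 0\<close> by (simp add: power2_norm_eq_inner[symmetric] power2_eq_square)
    then have "orthonormal (insert ?u B)"
      using B(1) x(2) by (auto simp: orthonormal_def inner_commute)
    moreover have "T ?u = \<mu> *\<^sub>R ?u" using x(1) by (simp add: S.scaleR adj.scaleR)
    ultimately have "insert ?u B = B" using B(2) by (intro max) auto
    then have "?u \<in> B" by blast
    with x(2) have "x \<bullet> ?u = 0" by blast
    then show False using \<open>x \<noteq> 0\<close> by simp
  qed
  have "?E \<subseteq> span B"
  proof
    fix x assume "x \<in> ?E"
    let ?p = "\<Sum>b\<in>B. (x \<bullet> b) *\<^sub>R b"
    have "T ?p = \<mu> *\<^sub>R ?p"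
    proof -
      have "T ?p = (\<Sum>b\<in>B. (x \<bullet> b) *\<^sub>R T b)"
        by (simp add: S.sum adj.sum S.scaleR adj.scaleR)
      also have "\<dots> = (\<Sum>b\<in>B. \<mu> *\<^sub>R (x \<bullet> b) *\<^sub>R b)"
        using B(2) by (intro sum.cong refl) auto
      finally show ?thesis by (simp only: scaleR_sum_right)
    qed
    then have "T (x - ?p) = \<mu> *\<^sub>R (x - ?p)"
      using \<open>x \<in> ?E\<close> by (simp add: S.diff adj.diff scaleR_diff_right)
    moreover have "(x - ?p) \<bullet> c = 0" if "c \<in> B" for c
    proof -
      have "?p \<bullet> c = (\<Sum>b\<in>B. if b = c then x \<bullet> b else 0)"
        unfolding inner_sum_left using B(1) that
        by (intro sum.cong refl) (auto simp: orthonormal_def)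
      then show ?thesis using that finB by (simp add: inner_diff_left)
    qed
    ultimately have "x - ?p = 0" by (intro zero) auto
    moreover have "?p \<in> span B" by (intro span_sum span_scale span_base)
    ultimately show "x \<in> span B" by simp
  qed
  then have "card B = dim ?E"
    by (intro basis_card_eq_dim B orthonormal_independent)
  with finB B zero show ?thesis by blast
qed

text \<open>Here c is the supremum of \<open>(norm (S y))\<^sup>2\<close> over the unit ball of W. A
  maximizing sequence satisfies the eigenvalue equation asymptotically, and compactness of S makes a
  subsequence converge to an exact solution.\<close>

lemma exists_maximal_eigenvector:
  assumes sub: "\<And>x y. x \<in> W \<Longrightarrow> y \<in> W \<Longrightarrow> x + y \<in> W" "\<And>c x. x \<in> W \<Longrightarrow> c *\<^sub>R x \<in> W"
    and "closed W" and inv: "\<And>x. x \<in> W \<Longrightarrow> T x \<in> W"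
    and "c > 0" and up: "\<And>y. y \<in> W \<Longrightarrow> (norm (S y))\<^sup>2 \<le> c * (norm y)\<^sup>2"
    and low: "\<And>c'. c' < c \<Longrightarrow> \<exists>y\<in>W. norm y \<le> 1 \<and> c' < (norm (S y))\<^sup>2"
  shows "\<exists>y\<in>W. y \<noteq> 0 \<and> T y = c *\<^sub>R y"
proof -
  have "\<exists>y\<in>W. norm y \<le> 1 \<and> c - 1 / real (Suc n) < (norm (S y))\<^sup>2" for n
    by (rule low) simp
  then obtain Y where Y: "\<And>n. Y n \<in> W" "\<And>n. norm (Y n) \<le> 1"
      "\<And>n. c - 1 / real (Suc n) < (norm (S (Y n)))\<^sup>2"
    by metis
  obtain r l where r: "strict_mono r" "(\<lambda>n. S (Y (r n))) \<longlonglongrightarrow> l"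
    using compact_operator_convergent_subseq[OF compact_S] Y(2) by metis
  \<comment> \<open>The bound for S on W is applied both to y and to \<open>T y\<close>, which lies
    in W by invariance; together they bound T on W by c.\<close>
  have TY: "norm (T y) \<le> c * norm y" if "y \<in> W" for y
  proof -
    have "(norm (T y))\<^sup>2 = S (T y) \<bullet> S y"
      by (simp only: power2_norm_eq_inner inner_T)
    also have "\<dots> \<le> norm (S (T y)) * norm (S y)" by (rule norm_cauchy_schwarz)
    finally have "((norm (T y))\<^sup>2)\<^sup>2 \<le> (norm (S (T y)))\<^sup>2 * (norm (S y))\<^sup>2"
      by (metis power_mono power_mult_distrib zero_le_power2)
    also have "\<dots> \<le> (c * (norm (T y))\<^sup>2) * (c * (norm y)\<^sup>2)"
      using \<open>c > 0\<close> by (intro mult_mono up inv that) auto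
    finally have *: "(norm (T y))\<^sup>2 * (norm (T y))\<^sup>2 \<le> (norm (T y))\<^sup>2 * (c * norm y)\<^sup>2"
      by (simp add: power2_eq_square algebra_simps)
    have "(norm (T y))\<^sup>2 \<le> (c * norm y)\<^sup>2"
    proof (cases "norm (T y) = 0")
      case False
      then have "0 < (norm (T y))\<^sup>2" by (simp only: zero_less_power2) simp
      then show ?thesis using * by (simp only: mult_le_cancel_left_pos)
    qed (simp only: power_zero_numeral zero_le_power2)
    then show ?thesis using \<open>c > 0\<close> by (intro power2_le_imp_le[of "norm (T y)"]) simp_all
  qed
  have est: "(norm (T (Y n) - c *\<^sub>R Y n))\<^sup>2 \<le> 2 * c * (1 / real (Suc n))" for n
  proof -
    have "(norm (T (Y n) - c *\<^sub>R Y n))\<^sup>2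
        = (norm (T (Y n)))\<^sup>2 - 2 * c * (T (Y n) \<bullet> Y n) + c\<^sup>2 * (norm (Y n))\<^sup>2"
    proof -
      have "(norm (a - c *\<^sub>R b))\<^sup>2 = (norm a)\<^sup>2 - 2 * c * (a \<bullet> b) + c\<^sup>2 * (norm b)\<^sup>2" for a b :: 'h
        unfolding power2_norm_eq_inner
        by (simp add: inner_simps inner_commute power2_eq_square algebra_simps)
      then show ?thesis .
    qed
    also have "T (Y n) \<bullet> Y n = (norm (S (Y n)))\<^sup>2"
      by (simp only: T_inner power2_norm_eq_inner)
    also have "(norm (T (Y n)))\<^sup>2 \<le> c\<^sup>2"
    proof -
      have "norm (T (Y n)) \<le> c * 1"
        using TY[OF Y(1)[of n]] mult_left_mono[OF Y(2), of c n] \<open>c > 0\<close> by linarith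
      then show ?thesis by (intro power_mono) auto
    qed
    also have "c\<^sup>2 * (norm (Y n))\<^sup>2 \<le> c\<^sup>2 * 1"
      using Y(2) by (intro mult_left_mono power_le_one) auto
    also have "c\<^sup>2 - 2 * c * (norm (S (Y n)))\<^sup>2 + c\<^sup>2 * 1 = 2 * c * (c - (norm (S (Y n)))\<^sup>2)"
      by (simp add: power2_eq_square algebra_simps)
    also have "\<dots> \<le> 2 * c * (1 / real (Suc n))"
      using Y(3)[of n] \<open>c > 0\<close> by (intro mult_left_mono) auto
    finally show ?thesis by simp
  qed
  have "(\<lambda>n. T (Y n) - c *\<^sub>R Y n) \<longlonglongrightarrow> 0"
  proof -
    have "(\<lambda>n. 2 * c * (1 / real (Suc n))) \<longlonglongrightarrow> 0"
      using tendsto_mult[OF tendsto_const LIMSEQ_inverse_real_of_nat, of "2 * c"]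
      by (simp add: inverse_eq_divide)
    then have "(\<lambda>n. (norm (T (Y n) - c *\<^sub>R Y n))\<^sup>2) \<longlonglongrightarrow> 0"
      by (rule tendsto_sandwich[OF _ _ tendsto_const, rotated 2])
        (intro always_eventually allI est zero_le_power2)+
    from tendsto_real_sqrt[OF this] have "(\<lambda>n. norm (T (Y n) - c *\<^sub>R Y n)) \<longlonglongrightarrow> 0" by simp
    then show ?thesis by (rule tendsto_norm_zero_cancel)
  qed
  then have d0: "(\<lambda>n. T (Y (r n)) - c *\<^sub>R Y (r n)) \<longlonglongrightarrow> 0"
    by (rule LIMSEQ_subseq_LIMSEQ[OF _ r(1), unfolded o_def])
  have TYr: "(\<lambda>n. T (Y (r n))) \<longlonglongrightarrow> adjoint S l" using adj.tendsto[OF r(2)] by simp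
  \<comment> \<open>A priori only the images under S converge. The sequence itself is recovered from
    \<open>c *\<^sub>R Y n = T (Y n) - (T (Y n) - c *\<^sub>R Y n)\<close>, where both parts
    converge along r.\<close>
  define y where "y = adjoint S l /\<^sub>R c"
  have "(\<lambda>n. (T (Y (r n)) - (T (Y (r n)) - c *\<^sub>R Y (r n))) /\<^sub>R c) \<longlonglongrightarrow> (adjoint S l - 0) /\<^sub>R c"
    by (intro tendsto_intros TYr d0)
  then have Yr: "(\<lambda>n. Y (r n)) \<longlonglongrightarrow> y" using \<open>c > 0\<close> by (simp add: y_def)
  have "y \<in> W" by (rule closed_sequentially[OF \<open>closed W\<close> _ Yr]) (simp add: Y)
  moreover have Sy: "S y = l" using LIMSEQ_unique[OF S.tendsto[OF Yr] r(2)] .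
  then have "T y = c *\<^sub>R y" using \<open>c > 0\<close> by (simp add: y_def)
  \<comment> \<open>The image l of y has squared norm at least c, because Y is maximizing.\<close>
  moreover have "y \<noteq> 0"
  proof
    assume "y = 0"
    then have "l = 0" using Sy S.zero by simp
    have "c \<le> (norm l)\<^sup>2"
    proof (rule LIMSEQ_le)
      show "(\<lambda>n. (norm (S (Y (r n))))\<^sup>2) \<longlonglongrightarrow> (norm l)\<^sup>2" by (intro tendsto_intros r)
      show "(\<lambda>n. c - 1 / real (Suc (r n))) \<longlonglongrightarrow> c"
        using LIMSEQ_subseq_LIMSEQ[OF tendsto_diff[OF tendsto_const LIMSEQ_inverse_real_of_nat] r(1), of c]
        by (simp add: inverse_eq_divide o_def)
      show "\<exists>N. \<forall>n\<ge>N. c - 1 / real (Suc (r n)) \<le> (norm (S (Y (r n))))\<^sup>2" using Y(3) less_imp_le by blast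
    qed
    with \<open>l = 0\<close> \<open>c > 0\<close> show False by simp
  qed
  ultimately show ?thesis by blast
qed

text \<open>If positive, the supremum of \<open>(norm (S y))\<^sup>2\<close> over the unit ball of W
  is an eigenvalue of T on W, so it cannot exceed \<delta>.\<close>

lemma norm_bound_of_no_eigenvector:
  assumes sub: "\<And>x y. x \<in> W \<Longrightarrow> y \<in> W \<Longrightarrow> x + y \<in> W" "\<And>c x. x \<in> W \<Longrightarrow> c *\<^sub>R x \<in> W"
    and "closed W" and inv: "\<And>x. x \<in> W \<Longrightarrow> T x \<in> W" and "\<delta> \<ge> 0"
    and none: "\<And>c x. c > \<delta> \<Longrightarrow> x \<in> W \<Longrightarrow> T x = c *\<^sub>R x \<Longrightarrow> x = 0"
    and "x \<in> W"
  shows "(norm (S x))\<^sup>2 \<le> \<delta> * (norm x)\<^sup>2"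
proof -
  define A where "A = (\<lambda>y. (norm (S y))\<^sup>2) ` {y \<in> W. norm y \<le> 1}"
  obtain K where K: "K \<ge> 0" "\<And>x. norm (S x) \<le> norm x * K" using S.nonneg_bounded by blast
  have "0 \<in> W" using sub(2)[OF \<open>x \<in> W\<close>, of 0] by simp
  then have ne: "A \<noteq> {}" unfolding A_def by (auto intro!: exI[of _ 0])
  have bdd: "bdd_above A"
  proof (rule bdd_aboveI)
    fix a assume "a \<in> A"
    then obtain y where y: "a = (norm (S y))\<^sup>2" "norm y \<le> 1" unfolding A_def by blast
    have "norm (S y) \<le> 1 * K" using K(2)[of y] mult_right_mono[OF y(2) K(1)] by linarith
    then show "a \<le> K\<^sup>2" using y by (simp add: power_mono)
  qed
  define c where "c = Sup A"
  have up: "(norm (S y))\<^sup>2 \<le> c * (norm y)\<^sup>2" if "y \<in> W" for y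
  proof (cases "y = 0")
    case False
    let ?u = "y /\<^sub>R norm y"
    have "?u \<in> W" "norm ?u \<le> 1" using sub that False by auto
    then have "(norm (S ?u))\<^sup>2 \<le> c"
      unfolding c_def by (intro cSup_upper bdd) (auto simp: A_def simp del: norm_scaleR)
    then show ?thesis using False by (simp add: S.scaleR power_mult_distrib field_simps)
  qed (simp add: S.zero)
  have low: "\<exists>y\<in>W. norm y \<le> 1 \<and> c' < (norm (S y))\<^sup>2" if "c' < c" for c'
    using less_cSupD[OF ne that[unfolded c_def]] unfolding A_def by auto
  have "c \<le> \<delta>"
  proof (rule ccontr)
    assume "\<not> c \<le> \<delta>"
    then have "c > \<delta>" "c > 0" using \<open>\<delta> \<ge> 0\<close> by auto
    from exists_maximal_eigenvector[OF sub \<open>closed W\<close> inv \<open>c > 0\<close> up low] none[OF \<open>c > \<delta>\<close>]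
    show False by blast
  qed
  then have "c * (norm x)\<^sup>2 \<le> \<delta> * (norm x)\<^sup>2" by (intro mult_right_mono) auto
  with up[OF \<open>x \<in> W\<close>] show ?thesis by linarith
qed

text \<open>The third conjunct replaces an expansion of x in eigenvectors: without mentioning the
  kernel of S it says that the first k eigenvectors determine S up to an error governed by
  \<open>lam (Suc k)\<close>.\<close>

theorem singular_value_decomposition:
  assumes lam: "eigenvalue_sequence T lam"
  defines "M \<equiv> {m. 1 \<le> m \<and> 0 < lam m}"
  shows "\<exists>e. (\<forall>m\<in>M. \<forall>n\<in>M. e m \<bullet> e n = (if m = n then 1 else 0)) \<and>
      (\<forall>m\<in>M. \<forall>x. S x \<bullet> S (e m) = lam m * (x \<bullet> e m)) \<and>
      (\<forall>k x. (\<forall>m\<in>M. m \<le> k \<longrightarrow> x \<bullet> e m = 0) \<longrightarrow> (norm (S x))\<^sup>2 \<le> lam (Suc k) * (norm x)\<^sup>2)"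
    and "lam \<longlonglongrightarrow> 0"
proof -
  have nonneg: "0 \<le> lam m" if "m \<ge> 1" for m
    using lam that unfolding eigenvalue_sequence_def by blast
  have mono: "lam n \<le> lam m" if "1 \<le> m" "m \<le> n" for m n
    using lam that unfolding eigenvalue_sequence_def by blast
  have mult: "finite {m. 1 \<le> m \<and> lam m = \<mu>}"
      "card {m. 1 \<le> m \<and> lam m = \<mu>} = dim {x. T x = \<mu> *\<^sub>R x}" if "\<mu> > 0" for \<mu>
    using lam that unfolding eigenvalue_sequence_def by blast+
  have "\<forall>\<mu>\<in>{0<..}. \<exists>B. finite B \<and> orthonormal B \<and> B \<subseteq> {x. T x = \<mu> *\<^sub>R x} \<and>
    card B = dim {x. T x = \<mu> *\<^sub>R x} \<and> (\<forall>x. T x = \<mu> *\<^sub>R x \<and> (\<forall>b\<in>B. x \<bullet> b = 0) \<longrightarrow> x = 0)"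
    using eigenspace_basis by simp
  from bchoice[OF this] obtain B where B0: "\<forall>\<mu>\<in>{0<..}. finite (B \<mu>) \<and> orthonormal (B \<mu>) \<and>
    B \<mu> \<subseteq> {x. T x = \<mu> *\<^sub>R x} \<and> card (B \<mu>) = dim {x. T x = \<mu> *\<^sub>R x} \<and>
    (\<forall>x. T x = \<mu> *\<^sub>R x \<and> (\<forall>b\<in>B \<mu>. x \<bullet> b = 0) \<longrightarrow> x = 0)"
    by (elim exE)
  have B: "\<And>\<mu>. \<mu> > 0 \<Longrightarrow> finite (B \<mu>)" "\<And>\<mu>. \<mu> > 0 \<Longrightarrow> orthonormal (B \<mu>)"
    "\<And>\<mu> x. \<mu> > 0 \<Longrightarrow> x \<in> B \<mu> \<Longrightarrow> T x = \<mu> *\<^sub>R x"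
    "\<And>\<mu>. \<mu> > 0 \<Longrightarrow> card (B \<mu>) = dim {x. T x = \<mu> *\<^sub>R x}"
    "\<And>\<mu> x. \<mu> > 0 \<Longrightarrow> T x = \<mu> *\<^sub>R x \<Longrightarrow> (\<And>b. b \<in> B \<mu> \<Longrightarrow> x \<bullet> b = 0) \<Longrightarrow> x = 0"
    using B0 unfolding greaterThan_iff by blast+
  have "\<forall>\<mu>\<in>{0<..}. \<exists>h. bij_betw h {m. 1 \<le> m \<and> lam m = \<mu>} (B \<mu>)"
    using B(1,4) mult by (auto intro!: finite_same_card_bij)
  from bchoice[OF this] obtain h
    where "\<forall>\<mu>\<in>{0<..}. bij_betw (h \<mu>) {m. 1 \<le> m \<and> lam m = \<mu>} (B \<mu>)" by (elim exE)
  then have h: "\<And>\<mu>. \<mu> > 0 \<Longrightarrow> bij_betw (h \<mu>) {m. 1 \<le> m \<and> lam m = \<mu>} (B \<mu>)"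
    by simp
  \<comment> \<open>Multiplicities agree, so the indices carrying a common value are matched
    bijectively with a basis of its eigenspace. This enumerates the eigenvectors along
    \<open>lam\<close>.\<close>
  define e where "e m = h (lam m) m" for m
  have eB: "e m \<in> B (lam m)" if "m \<in> M" for m
    using h[of "lam m"] that unfolding e_def M_def by (auto dest: bij_betwE)
  have Te: "T (e m) = lam m *\<^sub>R e m" if "m \<in> M" for m
    using B(3)[OF _ eB[OF that]] that by (simp add: M_def)
  have on: "e m \<bullet> e n = (if m = n then 1 else 0)" if "m \<in> M" "n \<in> M" for m n
  proof (cases "lam m = lam n")
    case True
    have "e m = e n \<longleftrightarrow> m = n"
      using h[of "lam n"] that True unfolding e_def M_def bij_betw_def inj_on_def by auto
    then show ?thesis using B(2)[of "lam n"] eB that True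
      unfolding orthonormal_def M_def by (metis (mono_tags, lifting) mem_Collect_eq)
  next
    case False
    have "T (e m) \<bullet> e n = e m \<bullet> T (e n)" by (simp only: inner_T T_inner)
    then have "lam m * (e m \<bullet> e n) = lam n * (e m \<bullet> e n)" by (simp only: Te that) simp
    then show ?thesis using False by auto
  qed
  have Se: "S x \<bullet> S (e m) = lam m * (x \<bullet> e m)" if "m \<in> M" for m x
    using inner_T[of x "e m"] by (simp only: Te[OF that] inner_scaleR_right)
  have Son: "S (e m) \<bullet> S (e n) = (if m = n then lam m else 0)" if "m \<in> M" "n \<in> M" for m n
    using Se[OF that(2), of "e m"] on[OF that] by (auto split: if_splits)
  have bound: "(norm (S x))\<^sup>2 \<le> lam (Suc k) * (norm x)\<^sup>2"
    if perp: "\<And>m. m \<in> M \<Longrightarrow> m \<le> k \<Longrightarrow> x \<bullet> e m = 0" for k x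
  proof (rule norm_bound_of_no_eigenvector[where W = "{x. \<forall>m\<in>M. m \<le> k \<longrightarrow> x \<bullet> e m = 0}"])
    have "{x. \<forall>m\<in>M. m \<le> k \<longrightarrow> x \<bullet> e m = 0} = (\<Inter>m\<in>{m\<in>M. m \<le> k}. {x. x \<bullet> e m = 0})"
      by auto
    also have "closed \<dots>"
      by (intro closed_INT ballI closed_Collect_eq continuous_intros)
    finally show "closed {x. \<forall>m\<in>M. m \<le> k \<longrightarrow> x \<bullet> e m = 0}" .
    fix x assume x: "x \<in> {x. \<forall>m\<in>M. m \<le> k \<longrightarrow> x \<bullet> e m = 0}"
    have "T x \<bullet> e m = lam m * (x \<bullet> e m)" if "m \<in> M" for m
    proof -
      have "T x \<bullet> e m = x \<bullet> T (e m)" by (simp only: inner_T T_inner)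
      then show ?thesis by (simp only: Te[OF that] inner_scaleR_right)
    qed
    then show "T x \<in> {x. \<forall>m\<in>M. m \<le> k \<longrightarrow> x \<bullet> e m = 0}" using x by simp
  next
    \<comment> \<open>All indices of an eigenvalue above \<open>lam (Suc k)\<close> are at most k,
      so x is orthogonal to the full basis of its own eigenspace and vanishes.\<close>
    fix c x assume c: "c > lam (Suc k)" "T x = c *\<^sub>R x"
      and x: "x \<in> {x. \<forall>m\<in>M. m \<le> k \<longrightarrow> x \<bullet> e m = 0}"
    have "c > 0" using c(1) nonneg[of "Suc k"] by simp
    show "x = 0"
    proof (rule B(5)[OF \<open>c > 0\<close> c(2)])
      fix b assume "b \<in> B c"
      then obtain m where m: "1 \<le> m" "lam m = c" "b = e m"
        using h[OF \<open>c > 0\<close>] unfolding bij_betw_def e_def by auto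
      have "m \<le> k" using mono[of "Suc k" m] c(1) m by (cases "m \<le> k") auto
      then show "x \<bullet> b = 0" using x m \<open>c > 0\<close> by (auto simp: M_def)
    qed
  qed (use perp nonneg in \<open>auto simp: inner_add_left\<close>)
  \<comment> \<open>Infinitely many values at or above r would give an infinite orthonormal set with
    orthogonal images of squared norm at least r.\<close>
  show "lam \<longlonglongrightarrow> 0"
  proof (rule LIMSEQ_I)
    fix r :: real assume "r > 0"
    let ?A = "{m. 1 \<le> m \<and> r \<le> lam m}"
    have AM: "?A \<subseteq> M" using \<open>r > 0\<close> by (auto simp: M_def)
    have "finite (e ` ?A)"
    proof (rule finite_orthonormal[OF _ _ _ \<open>r > 0\<close>])
      show "orthonormal (e ` ?A)" unfolding orthonormal_def
      proof (intro ballI)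
        fix x y assume "x \<in> e ` ?A" "y \<in> e ` ?A"
        then obtain m n where mn: "m \<in> M" "n \<in> M" "x = e m" "y = e n" using AM by auto
        show "x \<bullet> y = (if x = y then 1 else 0)"
          using on[OF mn(1,2)] on[OF mn(1,1)] mn by auto
      qed
    next
      fix x y assume "x \<in> e ` ?A" "y \<in> e ` ?A" "x \<noteq> y"
      then obtain m n where mn: "m \<in> M" "n \<in> M" "x = e m" "y = e n" using AM by auto
      then show "S x \<bullet> S y = 0" using Son[OF mn(1,2)] \<open>x \<noteq> y\<close> by auto
    next
      fix x assume "x \<in> e ` ?A"
      then show "r \<le> S x \<bullet> S x" using Son AM by auto
    qed
    moreover have "inj_on e ?A"
    proof (rule inj_onI)
      fix m n assume "m \<in> ?A" "n \<in> ?A" "e m = e n"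
      moreover from this AM have "m \<in> M" "n \<in> M" by auto
      ultimately show "m = n" using on[of m n] on[of m m] by (auto split: if_splits)
    qed
    ultimately have "finite ?A" by (rule finite_imageD)
    then obtain N where N: "\<forall>m\<in>?A. m < N" using finite_nat_set_iff_bounded by blast
    show "\<exists>no. \<forall>n\<ge>no. norm (lam n - 0) < r"
    proof (intro exI allI impI)
      fix n assume "n \<ge> Suc N"
      then have "n \<notin> ?A" "1 \<le> n" using N by (meson Suc_leD leD, simp)
      then show "norm (lam n - 0) < r" using nonneg[of n] by auto
    qed
  qed
  show "\<exists>e. (\<forall>m\<in>M. \<forall>n\<in>M. e m \<bullet> e n = (if m = n then 1 else 0)) \<and>
      (\<forall>m\<in>M. \<forall>x. S x \<bullet> S (e m) = lam m * (x \<bullet> e m)) \<and>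
      (\<forall>k x. (\<forall>m\<in>M. m \<le> k \<longrightarrow> x \<bullet> e m = 0) \<longrightarrow> (norm (S x))\<^sup>2 \<le> lam (Suc k) * (norm x)\<^sup>2)"
    by (intro exI[of _ e] conjI ballI allI impI on Se bound) auto
qed

end

subsection \<open>Counting products above a threshold\<close>

text \<open>The strict inequality is dual to the criterion \<open>e n d \<le> \<epsilon>\<close>: a
  singular value equal to the threshold need not be captured.\<close>

definition large_products :: "(nat \<Rightarrow> real) \<Rightarrow> nat \<Rightarrow> real \<Rightarrow> nat list set" where
  "large_products w d t = {I. length I = d \<and> (\<forall>m\<in>set I. 1 \<le> m) \<and> t < prod_list (map w I)}"

lemma prod_list_le_power:
  fixes f :: "'a \<Rightarrow> real"
  assumes "\<And>x. x \<in> set xs \<Longrightarrow> 0 \<le> f x \<and> f x \<le> b"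
  shows "prod_list (map f xs) \<le> b ^ length xs"
  using assms
proof (induction xs)
  case (Cons a xs)
  have "0 \<le> prod_list (map f xs)" by (rule prod_list_nonneg) (use Cons.prems in auto)
  then show ?case using Cons by (auto intro!: mult_mono order_trans[of 0 "f a" b])
qed simp

lemma large_products_normalize:
  assumes "0 < w (1::nat)"
  shows "large_products (\<lambda>m. w m / w 1) d t = large_products w d (w 1 ^ d * t)"
proof -
  have "prod_list (map (\<lambda>m. w m / w 1) I) = prod_list (map w I) / w 1 ^ length I" for I
    by (induction I) simp_all
  then show ?thesis using assms by (auto simp: large_products_def pos_less_divide_eq mult.commute)
qed

text \<open>Only finitely many indices precede the asymptotic range, and the sum of their quotients
  \<open>\<bar>f d\<bar> / g d\<close> is added to the constant. Index 0 is left out because it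
  carries no information.\<close>

lemma bigo_imp_uniform_bound:
  fixes f g :: "nat \<Rightarrow> real"
  assumes "f \<in> O(g)" "\<And>d. d \<ge> 1 \<Longrightarrow> 0 < g d"
  shows "\<exists>C\<ge>1. \<forall>d\<ge>1. f d \<le> C * g d"
proof -
  obtain c where "eventually (\<lambda>d. norm (f d) \<le> c * norm (g d)) sequentially"
    using assms(1) by (elim landau_o.bigE)
  then obtain N where N: "\<And>d. d \<ge> N \<Longrightarrow> \<bar>f d\<bar> \<le> c * \<bar>g d\<bar>"
    by (auto simp: eventually_sequentially)
  define C where "C = 1 + \<bar>c\<bar> + (\<Sum>d\<in>{1..N}. \<bar>f d\<bar> / g d)"
  have nn: "0 \<le> (\<Sum>d\<in>{1..N}. \<bar>f d\<bar> / g d)"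
    using assms(2) by (intro sum_nonneg divide_nonneg_pos) auto
  have "f d \<le> C * g d" if "d \<ge> 1" for d
  proof (cases "d \<ge> N")
    case True
    have "f d \<le> c * g d" using N[OF True] assms(2)[OF that] by simp
    also have "\<dots> \<le> C * g d"
      using assms(2)[OF that] nn by (intro mult_right_mono) (auto simp: C_def)
    finally show ?thesis .
  next
    case False
    have "\<bar>f d\<bar> / g d \<le> (\<Sum>d\<in>{1..N}. \<bar>f d\<bar> / g d)"
      using that False assms(2) by (intro member_le_sum divide_nonneg_pos) auto
    then have "\<bar>f d\<bar> / g d \<le> C" unfolding C_def by linarith
    then show ?thesis using assms(2)[OF that] by (simp add: pos_divide_le_eq)
  qed
  moreover have "C \<ge> 1" using nn by (simp add: C_def)
  ultimately show ?thesis by blast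
qed

lemma sublinear_bound:
  fixes k0 k1 k2 \<eta> :: real
  assumes "\<eta> > 0"
  shows "eventually (\<lambda>Y. k0 + k1 * ln Y + k2 * (ln Y)\<^sup>2 \<le> \<eta> * Y) at_top"
proof -
  have lims: "((\<lambda>Y::real. 1 / Y) \<longlongrightarrow> 0) at_top" "((\<lambda>Y::real. ln Y / Y) \<longlongrightarrow> 0) at_top"
    "((\<lambda>Y::real. (ln Y)\<^sup>2 / Y) \<longlongrightarrow> 0) at_top"
    by real_asymp+
  have "((\<lambda>Y. k0 * (1 / Y) + k1 * (ln Y / Y) + k2 * ((ln Y)\<^sup>2 / Y)) \<longlongrightarrow>
      k0 * 0 + k1 * 0 + k2 * 0) at_top"
    by (intro tendsto_intros lims)
  then have "eventually (\<lambda>Y. k0 * (1 / Y) + k1 * (ln Y / Y) + k2 * ((ln Y)\<^sup>2 / Y) < \<eta>) at_top"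
    by (rule order_tendstoD(2)) (use assms in simp)
  with eventually_gt_at_top[of "0::real"] show ?thesis
  proof eventually_elim
    case (elim Y)
    have "k0 + k1 * ln Y + k2 * (ln Y)\<^sup>2
        = (k0 * (1 / Y) + k1 * (ln Y / Y) + k2 * ((ln Y)\<^sup>2 / Y)) * Y"
      using elim(1) by (simp add: field_simps)
    also have "\<dots> \<le> \<eta> * Y" using elim by (intro mult_right_mono) auto
    finally show ?case .
  qed
qed

section \<open>Nonincreasing weights with leading weight 1\<close>

locale weights =
  fixes w :: "nat \<Rightarrow> real"
  assumes w1: "w 1 = 1"
    and w_nonneg: "\<And>m. 1 \<le> m \<Longrightarrow> 0 \<le> w m"
    and w_mono: "\<And>m n. 1 \<le> m \<Longrightarrow> m \<le> n \<Longrightarrow> w n \<le> w m"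
    and w_lim: "w \<longlonglongrightarrow> 0"
begin

lemma w_le_1: "1 \<le> m \<Longrightarrow> w m \<le> 1"
  using w_mono[of 1 m] w1 by simp

text \<open>The weights are nonincreasing, so the positions of those above t form an initial
  segment; its length is found as a least index, without the cardinality of a set.\<close>

definition count_above :: "real \<Rightarrow> nat" where "count_above t = (LEAST n. w (Suc n) \<le> t)"

lemma count_above_iff:
  assumes "t > 0" "m \<ge> 1"
  shows "t < w m \<longleftrightarrow> m \<le> count_above t"
proof -
  have "eventually (\<lambda>n. w n < t) sequentially" using order_tendstoD(2)[OF w_lim \<open>t > 0\<close>] .
  then have "\<exists>n. w (Suc n) \<le> t" unfolding eventually_sequentially by (meson less_imp_le lessI)
  then have r: "w (Suc (count_above t)) \<le> t" unfolding count_above_def by (rule LeastI_ex)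
  have lt: "t < w (Suc n)" if "n < count_above t" for n
    using not_less_Least[OF that[unfolded count_above_def]] by simp
  show ?thesis
  proof
    assume "t < w m"
    show "m \<le> count_above t"
    proof (rule ccontr)
      assume "\<not> m \<le> count_above t"
      then have "w m \<le> w (Suc (count_above t))" by (intro w_mono) auto
      with r \<open>t < w m\<close> show False by simp
    qed
  next
    assume "m \<le> count_above t"
    then show "t < w m" using lt[of "m - 1"] \<open>m \<ge> 1\<close> by simp
  qed
qed

lemma count_above_ge:
  assumes "0 < t" "t < 1" "1 \<le> r" "w r = 1"
  shows "r \<le> count_above t"
  using count_above_iff[of t r] assms by simp

text \<open>All factors are at most 1, so each factor of a product above t is itself above t and has
  index at most \<open>count_above t\<close>.\<close>

lemma finite_large_products:
  assumes "t > 0"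
  shows "finite (large_products w d t)"
proof -
  have "large_products w d t \<subseteq> {I. set I \<subseteq> {..count_above t} \<and> length I = d}"
  proof (intro subsetI CollectI conjI)
    fix I assume "I \<in> large_products w d t"
    then show "length I = d" by (simp add: large_products_def)
  next
    fix I m assume I: "I \<in> large_products w d t" and m: "m \<in> set I"
    then have pos: "\<forall>m\<in>set I. 1 \<le> m" and prod: "t < prod_list (map w I)"
      by (auto simp: large_products_def)
    obtain xs ys where xs: "I = xs @ m # ys" using split_list[OF m] by blast
    have "0 \<le> prod_list (map w xs)" "prod_list (map w xs) \<le> 1"
         "0 \<le> prod_list (map w ys)" "prod_list (map w ys) \<le> 1"
      using pos prod_list_le_power[of xs w 1] prod_list_le_power[of ys w 1] w_nonneg w_le_1 xs
      by (auto intro!: prod_list_nonneg)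
    then have "prod_list (map w xs) * prod_list (map w ys) \<le> 1" by (simp add: mult_le_one)
    then have "w m * (prod_list (map w xs) * prod_list (map w ys)) \<le> w m * 1"
      using w_nonneg pos m by (intro mult_left_mono) auto
    then have "t < w m" using prod xs by (simp add: mult_ac)
    then show "m \<in> {..count_above t}" using count_above_iff[OF assms] pos m by simp
  qed
  then show ?thesis using finite_lists_length_eq[of "{..count_above t}" d] finite_subset by blast
qed

lemma large_products_empty:
  assumes "1 \<le> t"
  shows "large_products w d t = {}"
proof -
  have "prod_list (map w I) \<le> 1" if "\<forall>m\<in>set I. 1 \<le> m" for I
    using prod_list_le_power[of I w 1] that w_nonneg w_le_1 by simp
  then show ?thesis using assms by (force simp: large_products_def)
qed

lemma card_large_products_pos:
  assumes "0 < t" "t < 1"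
  shows "1 \<le> card (large_products w d t)"
proof -
  have "replicate d 1 \<in> large_products w d t"
    using assms w1 by (simp add: large_products_def)
  then show ?thesis using finite_large_products[OF assms(1)] by (simp add: Suc_le_eq card_gt_0_iff) blast
qed

lemma card_large_products_ge_index:
  assumes "1 \<le> n" "1 \<le> d" "0 < t" "t < w n"
  shows "n \<le> card (large_products w d t)"
proof -
  let ?f = "\<lambda>m. m # replicate (d - 1) 1"
  have "?f ` {1..n} \<subseteq> large_products w d t"
  proof
    fix I assume "I \<in> ?f ` {1..n}"
    then obtain m where m: "1 \<le> m" "m \<le> n" "I = ?f m" by auto
    with w_mono[of m n] assms w1 show "I \<in> large_products w d t"
      by (auto simp: large_products_def)
  qed
  then have "card (?f ` {1..n}) \<le> card (large_products w d t)"
    by (intro card_mono finite_large_products assms)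
  moreover have "inj_on ?f {1..n}" by (auto intro: inj_onI)
  ultimately show ?thesis by (simp add: card_image)
qed

text \<open>Only the first k coordinates range over 1 and 2. Leaving k free matters for
  \<open>w 2 < 1\<close>, where the threshold may afford entries 2 in a fraction of the coordinates
  only.\<close>

lemma card_large_products_ge_power:
  assumes "k \<le> d" "0 < t" "t < w 2 ^ k"
  shows "2 ^ k \<le> card (large_products w d t)"
proof -
  let ?A = "{I. set I \<subseteq> {1, 2::nat} \<and> length I = k}" and ?f = "\<lambda>I. I @ replicate (d - k) (1::nat)"
  have "?f ` ?A \<subseteq> large_products w d t"
  proof
    fix J assume "J \<in> ?f ` ?A"
    then obtain I where I: "set I \<subseteq> {1, 2}" "length I = k" "J = ?f I" by auto
    have "w 2 ^ length I \<le> prod_list (map w I)" if "set I \<subseteq> {1, 2}" for I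
      using that
    proof (induction I)
      case (Cons m I)
      have "w 2 \<le> w m" using Cons.prems w_mono[of 1 2] by auto
      moreover have "0 \<le> w 2" by (rule w_nonneg) simp
      ultimately show ?case using Cons by (auto intro!: mult_mono)
    qed simp
    from this[OF I(1)] have "t < prod_list (map w I)" using assms(3) I(2) by simp
    then show "J \<in> large_products w d t" using I assms(1) w1 by (auto simp: large_products_def)
  qed
  then have "card (?f ` ?A) \<le> card (large_products w d t)"
    by (intro card_mono finite_large_products assms)
  moreover have "card ?A = 2 ^ k" by (subst card_lists_length_eq) (auto simp: numeral_2_eq_2)
  ultimately show ?thesis by (simp add: card_image inj_on_def)
qed

section \<open>Upper bound by lists with few large entries\<close>

definition sparse :: "nat \<Rightarrow> nat \<Rightarrow> nat \<Rightarrow> nat \<Rightarrow> nat list set" where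
  "sparse r d n K = {I. length I = d \<and> (\<forall>i<d. 1 \<le> I ! i \<and> (r < I ! i \<longrightarrow> I ! i \<le> n)) \<and>
     card {i. i < d \<and> r < I ! i} \<le> K}"

text \<open>Overwriting one entry of a list with at most K large entries reaches every list with at
  most K + 1 of them, so each large entry costs a factor \<open>d * n\<close> for its position and
  its value.\<close>

lemma card_sparse:
  assumes "1 \<le> r" "r \<le> n" "1 \<le> d"
  shows "finite (sparse r d n K) \<and> card (sparse r d n K) \<le> r ^ d * (d * n) ^ K"
proof (induction K)
  case 0
  have eq: "sparse r d n 0 = {I. set I \<subseteq> {1..r} \<and> length I = d}"
  proof (intro equalityI subsetI)
    fix I assume "I \<in> sparse r d n 0"
    then have I: "length I = d" "\<forall>i<d. 1 \<le> I ! i" "{i. i < d \<and> r < I ! i} = {}"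
      by (auto simp: sparse_def)
    then have "1 \<le> I ! i \<and> I ! i \<le> r" if "i < d" for i
      using that by (metis (mono_tags, lifting) empty_iff mem_Collect_eq not_le)
    then show "I \<in> {I. set I \<subseteq> {1..r} \<and> length I = d}" using I(1) by (auto simp: in_set_conv_nth)
  next
    fix I assume "I \<in> {I. set I \<subseteq> {1..r} \<and> length I = d}"
    then have I: "length I = d" "\<And>i. i < d \<Longrightarrow> 1 \<le> I ! i \<and> I ! i \<le> r"
      by (auto simp: subset_iff)
    then have "\<not> (i < d \<and> r < I ! i)" for i by (meson not_le)
    then have "{i. i < d \<and> r < I ! i} = {}" by blast
    with I show "I \<in> sparse r d n 0" by (auto simp: sparse_def)
  qed
  show ?case unfolding eq by (simp add: card_lists_length_eq finite_lists_length_eq)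
next
  case (Suc K)
  let ?f = "\<lambda>(j, v, I). I[j := v]" and ?D = "{..<d} \<times> {1..n} \<times> sparse r d n K"
  have "sparse r d n (Suc K) \<subseteq> ?f ` ?D"
  proof
    fix I assume "I \<in> sparse r d n (Suc K)"
    then have I: "length I = d" "\<And>i. i < d \<Longrightarrow> 1 \<le> I ! i" "\<And>i. i < d \<Longrightarrow> r < I ! i \<Longrightarrow> I ! i \<le> n"
      and cI: "card {i. i < d \<and> r < I ! i} \<le> Suc K" by (auto simp: sparse_def)
    \<comment> \<open>A list without large entries must be covered too: then position 0 serves, and
      \<open>r \<le> n\<close> keeps the entry there in range.\<close>
    obtain j where j: "j < d" "{i. i < d \<and> r < I ! i} \<noteq> {} \<Longrightarrow> r < I ! j"
    proof (cases "{i. i < d \<and> r < I ! i} = {}")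
      case True
      then show ?thesis using that[of 0] assms(3) by simp
    qed (use that in blast)
    let ?I = "I[j := Suc 0]"
    have nth: "?I ! i = (if i = j then Suc 0 else I ! i)" if "i < d" for i
      using that I(1) by (auto simp: nth_list_update)
    have "{i. i < d \<and> r < ?I ! i} = {i. i < d \<and> r < I ! i} - {j}"
      using assms(1) by (auto simp: nth split: if_splits)
    moreover have "card ({i. i < d \<and> r < I ! i} - {j}) \<le> K"
    proof (cases "{i. i < d \<and> r < I ! i} = {}")
      case True
      show ?thesis unfolding True by simp
    next
      case False
      then have "j \<in> {i. i < d \<and> r < I ! i}" using j by simp
      then show ?thesis using cI by (simp add: card_Diff_singleton)
    qed
    ultimately have "?I \<in> sparse r d n K"
      using I assms(1) by (auto simp: sparse_def nth)
    moreover have "I ! j \<in> {1..n}" using I(2,3)[OF j(1)] assms(2) by fastforce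
    ultimately have "(j, I ! j, ?I) \<in> ?D" using j(1) by simp
    moreover have "I = ?f (j, I ! j, ?I)" by simp
    ultimately show "I \<in> ?f ` ?D" by (rule rev_image_eqI)
  qed
  moreover have fin: "finite ?D" using Suc by simp
  ultimately have "finite (sparse r d n (Suc K))" "card (sparse r d n (Suc K)) \<le> card ?D"
    using finite_subset surj_card_le[OF fin] by (blast, blast)
  moreover have "card ?D \<le> r ^ d * (d * n) ^ Suc K"
  proof -
    have "card ?D = d * n * card (sparse r d n K)" by (simp add: card_cartesian_product)
    also have "\<dots> \<le> d * n * (r ^ d * (d * n) ^ K)" using Suc by (intro mult_left_mono) auto
    finally show ?thesis by (simp add: mult_ac)
  qed
  ultimately show ?case by linarith
qed

text \<open>
  At most one factor of a product exceeding \<open>t\<close> can be as small as \<open>sqrt t\<close>. Treating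
  that coordinate separately avoids a logarithmic loss in the resulting bound.
\<close>

lemma large_products_subset_image_sparse:
  assumes t: "0 < t" "t < 1" and r: "1 \<le> r" and \<beta>: "0 < \<beta>" "\<And>m. r < m \<Longrightarrow> w m \<le> \<beta>"
    and K: "\<beta> ^ Suc K \<le> t" and "\<beta> < 1" and d: "1 \<le> d"
  shows "large_products w d t \<subseteq>
    (\<lambda>(j, v, I). I[j := v]) ` ({..<d} \<times> {1..count_above t} \<times> sparse r d (count_above (sqrt t)) K)"
proof
  fix I assume "I \<in> large_products w d t"
  then have I: "length I = d" "\<And>m. m \<in> set I \<Longrightarrow> 1 \<le> m" "t < prod_list (map w I)"
    by (auto simp: large_products_def)
  have I1: "1 \<le> I ! i" if "i < d" for i using I(1,2) that by simp
  have eq: "prod_list (map w I) = (\<Prod>i<d. w (I ! i))"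
    by (simp add: prod.list_conv_set_nth atLeast0LessThan I(1))
  \<comment> \<open>The discarded factors are at most 1, so every partial product still exceeds
    t.\<close>
  have sub: "t < (\<Prod>i\<in>X. w (I ! i))" if "X \<subseteq> {..<d}" for X
  proof -
    have "(\<Prod>i<d. w (I ! i)) = (\<Prod>i\<in>{..<d} - X. w (I ! i)) * (\<Prod>i\<in>X. w (I ! i))"
      using that by (intro prod.subset_diff) auto
    also have "\<dots> \<le> 1 * (\<Prod>i\<in>X. w (I ! i))"
      using that by (intro mult_right_mono prod_le_1 prod_nonneg conjI w_nonneg w_le_1 I1) auto
    finally show ?thesis using I(3) eq by simp
  qed
  have le_rank: "I ! i \<le> count_above t" if "i < d" for i
    using sub[of "{i}"] that count_above_iff[OF t(1) I1[OF that]] by simp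
  let ?X = "{i. i < d \<and> r < I ! i}"
  have cX: "card ?X \<le> K"
  proof (rule ccontr)
    assume "\<not> card ?X \<le> K"
    have "t < (\<Prod>i\<in>?X. w (I ! i))" by (rule sub) auto
    also have "\<dots> \<le> (\<Prod>i\<in>?X. \<beta>)" using \<beta>(2) w_nonneg I1 by (intro prod_mono) auto
    also have "\<dots> = \<beta> ^ card ?X" by simp
    also have "\<dots> \<le> \<beta> ^ Suc K"
      using \<open>\<not> card ?X \<le> K\<close> \<beta>(1) \<open>\<beta> < 1\<close> by (intro power_decreasing) auto
    finally show False using K by simp
  qed
  \<comment> \<open>The largest entry has the smallest weight. Any other weight is at least as
    large, and the product of the two exceeds t, so the square of the other one does.\<close>
  obtain j where j: "j < d" "\<And>i. i < d \<Longrightarrow> I ! i \<le> I ! j"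
  proof -
    have "Max ((!) I ` {..<d}) \<in> (!) I ` {..<d}" using d by (intro Max_in) (auto simp: lessThan_empty_iff)
    then obtain j where "j < d" "I ! j = Max ((!) I ` {..<d})" by auto
    then show ?thesis using that[of j] by simp
  qed
  have other: "I ! i \<le> count_above (sqrt t)" if "i < d" "i \<noteq> j" for i
  proof -
    have "t < w (I ! i) * w (I ! j)" using sub[of "{i, j}"] that j(1) by simp
    also have "\<dots> \<le> w (I ! i) * w (I ! i)"
      using that I1 w_nonneg j(2) by (intro mult_left_mono w_mono) auto
    finally have "sqrt t < w (I ! i)"
      using I1 w_nonneg that(1) by (intro real_less_lsqrt) (auto simp: power2_eq_square t less_imp_le)
    then show ?thesis using count_above_iff[of "sqrt t" "I ! i"] t I1[OF that(1)] by simp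
  qed
  let ?I = "I[j := Suc 0]"
  have nth: "?I ! i = (if i = j then Suc 0 else I ! i)" if "i < d" for i
    using that I(1) by (auto simp: nth_list_update)
  have "card {i. i < d \<and> r < ?I ! i} \<le> card ?X"
    using r by (intro card_mono) (auto simp: nth split: if_splits)
  then have "?I \<in> sparse r d (count_above (sqrt t)) K"
    using I(1) I1 other cX r by (auto simp: sparse_def nth)
  then have "(j, I ! j, ?I) \<in> {..<d} \<times> {1..count_above t} \<times> sparse r d (count_above (sqrt t)) K"
    using j(1) I1 le_rank by simp
  moreover have "I = (\<lambda>(j, v, I). I[j := v]) (j, I ! j, ?I)" by simp
  ultimately show "I \<in> (\<lambda>(j, v, I). I[j := v]) ` ({..<d} \<times> {1..count_above t} \<times> sparse r d (count_above (sqrt t)) K)"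
    by (rule rev_image_eqI)
qed

lemma ln_card_large_products_le:
  assumes t: "0 < t" "t < 1" and r: "1 \<le> r" "w r = 1"
    and \<beta>: "0 < \<beta>" "\<beta> < 1" "\<And>m. r < m \<Longrightarrow> w m \<le> \<beta>" and d: "1 \<le> d"
  shows "ln (real (card (large_products w d t))) \<le> real d * ln (real r) + ln (real d)
    + ln (real (count_above t)) + ln (1 / t) / ln (1 / \<beta>) * (ln (real d) + ln (real (count_above (sqrt t))))"
proof -
  define a where "a = ln (1 / t) / ln (1 / \<beta>)"
  have lb: "0 < ln (1 / \<beta>)" using \<beta> by simp
  have "0 \<le> a" using t lb by (simp add: a_def)
  \<comment> \<open>\<open>K\<close> bounds the number of entries above r: as
    \<open>\<beta> powr a = t\<close>, a product with K + 1 factors \<beta> is already at most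
    t.\<close>
  define K where "K = nat \<lfloor>a\<rfloor>"
  have K: "real K \<le> a" "a < real (Suc K)" using \<open>0 \<le> a\<close> by (simp_all add: K_def) linarith+
  have "ln (1 / t) \<le> real (Suc K) * ln (1 / \<beta>)"
    using K(2) lb unfolding a_def by (simp only: pos_divide_less_eq less_imp_le)
  then have "real (Suc K) * ln \<beta> \<le> ln t" using t \<beta> by (simp add: ln_div)
  then have "ln (\<beta> ^ Suc K) \<le> ln t" by (simp only: ln_realpow)
  then have \<beta>K: "\<beta> ^ Suc K \<le> t" 
    using t \<beta>(1) ln_le_cancel_iff[of "\<beta> ^ Suc K" t] zero_less_power[OF \<beta>(1), of "Suc K"] by blast
  let ?n = "count_above t" and ?n' = "count_above (sqrt t)"
  have rn: "r \<le> ?n" "r \<le> ?n'" using t r by (auto intro!: count_above_ge)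
  let ?D = "{..<d} \<times> {1..?n} \<times> sparse r d ?n' K"
  note sp = card_sparse[OF r(1) rn(2) d, of K]
  have fin: "finite ?D" using sp by simp
  have "card (large_products w d t) \<le> card ?D"
    by (rule surj_card_le[OF fin large_products_subset_image_sparse[OF t r(1) \<beta>(1,3) \<beta>K \<beta>(2) d]])
  also have "\<dots> = d * ?n * card (sparse r d ?n' K)" by (simp add: card_cartesian_product)
  also have "\<dots> \<le> d * ?n * (r ^ d * (d * ?n') ^ K)" using sp by (intro mult_left_mono) auto
  finally have "real (card (large_products w d t)) \<le> real (d * ?n * (r ^ d * (d * ?n') ^ K))"
    by (simp only: of_nat_le_iff)
  then have "ln (real (card (large_products w d t))) \<le> ln (real (d * ?n * (r ^ d * (d * ?n') ^ K)))"
    using card_large_products_pos[OF t, of d] by (intro ln_mono) auto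
  also have "\<dots> = ln (real d) + ln (real ?n) + (real d * ln (real r) + real K * (ln (real d) + ln (real ?n')))"
    using d r rn by (simp add: ln_mult ln_realpow)
  also have "real K * (ln (real d) + ln (real ?n')) \<le> a * (ln (real d) + ln (real ?n'))"
    using d r rn K by (intro mult_right_mono add_nonneg_nonneg) auto
  finally show ?thesis by (simp add: a_def algebra_simps)
qed

text \<open>The decay is evaluated at the last index whose weight exceeds u, and the resulting
  inequality is solved for the logarithm of that index. Indices up to \<open>n0\<close> go into the
  constant.\<close>

lemma ln_count_above_bound:
  assumes q: "0 < q" and small: "w \<in> o(\<lambda>n. ln (real n) powr (- q))" and "\<eta> > 0"
  shows "\<exists>c\<ge>0. \<forall>u. 0 < u \<and> u < 1 \<longrightarrow> ln (real (count_above u)) \<le> c + \<eta> * u powr (- 1 / q)"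
proof -
  have "eventually (\<lambda>n. norm (w n) \<le> \<eta> powr q * norm (ln (real n) powr (- q))) sequentially"
    using landau_o.smallD[OF small, of "\<eta> powr q"] \<open>\<eta> > 0\<close> by simp
  then obtain N where N: "\<And>n. n \<ge> N \<Longrightarrow> \<bar>w n\<bar> \<le> \<eta> powr q * ln (real n) powr (- q)"
    unfolding eventually_sequentially by auto
  define n0 where "n0 = max N 3"
  have "ln (real (count_above u)) \<le> ln (real n0) + \<eta> * u powr (- 1 / q)" if u: "0 < u" "u < 1" for u
  proof -
    have r1: "1 \<le> count_above u" using count_above_ge[OF u order_refl w1] .
    show ?thesis
    proof (cases "count_above u \<le> n0")
      case True
      then have "ln (real (count_above u)) \<le> ln (real n0)" using r1 by simp
      then show ?thesis using \<open>\<eta> > 0\<close> by (simp add: add_increasing2)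
    next
      case False
      define l where "l = ln (real (count_above u))"
      have "l > 0" using False by (simp add: l_def n0_def)
      have "u < w (count_above u)" using count_above_iff[OF u(1) r1] by simp
      also have "\<dots> \<le> \<eta> powr q * l powr (- q)"
        using order_trans[OF abs_ge_self N[of "count_above u"]] False by (simp add: n0_def l_def)
      finally have "l powr q \<le> \<eta> powr q / u"
        using u(1) \<open>l > 0\<close> by (simp add: powr_minus field_simps)
      then have "(l powr q) powr (1 / q) \<le> (\<eta> powr q / u) powr (1 / q)"
        using q by (intro powr_mono2) auto
      also have "\<dots> = \<eta> * u powr (- 1 / q)"
        using q \<open>\<eta> > 0\<close> u(1) by (simp add: powr_divide powr_powr powr_minus field_simps)
      finally have "l \<le> \<eta> * u powr (- 1 / q)" using q \<open>l > 0\<close> by (simp add: powr_powr)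
      moreover have "0 \<le> ln (real n0)" by (simp add: n0_def)
      ultimately show ?thesis unfolding l_def by linarith
    qed
  qed
  moreover have "0 \<le> ln (real n0)" by (simp add: n0_def)
  ultimately show ?thesis by blast
qed

end

subsection \<open>Minimal errors of tensor power operators\<close>

lemma subspace_closure:
  fixes S :: "'a::real_normed_vector set"
  assumes "subspace S"
  shows "subspace (closure S)"
  unfolding subspace_def
proof (intro conjI ballI allI)
  show "0 \<in> closure S" using assms closure_subset subspace_0 by blast
next
  fix x y assume "x \<in> closure S" "y \<in> closure S"
  then obtain f g where "\<And>n. f n \<in> S" "f \<longlonglongrightarrow> x" "\<And>n. g n \<in> S" "g \<longlonglongrightarrow> y"
    unfolding closure_sequential by metis
  then show "x + y \<in> closure S" unfolding closure_sequential
    by (intro exI[of _ "\<lambda>n. f n + g n"]) (auto intro: tendsto_add subspace_add[OF assms])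
next
  fix c x assume "x \<in> closure S"
  then obtain f where "\<And>n. f n \<in> S" "f \<longlonglongrightarrow> x"
    unfolding closure_sequential by metis
  then show "c *\<^sub>R x \<in> closure S" unfolding closure_sequential
    by (intro exI[of _ "\<lambda>n. c *\<^sub>R f n"]) (auto intro: tendsto_scaleR subspace_scale[OF assms])
qed

text \<open>The distributive law with multi-indices as lists, which is the encoding of tensor
  indices.\<close>

lemma prod_sum_lists:
  fixes g :: "nat \<Rightarrow> 'a \<Rightarrow> 'b::comm_semiring_1"
  assumes "finite A"
  shows "(\<Prod>i<n. \<Sum>m\<in>A. g i m) = (\<Sum>I | set I \<subseteq> A \<and> length I = n. \<Prod>i<n. g i (I ! i))"
proof (induction n arbitrary: g)
  case 0
  have "{I. set I \<subseteq> A \<and> I = []} = {[]}" by auto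
  then show ?case by simp
next
  case (Suc n)
  let ?L = "{I. set I \<subseteq> A \<and> length I = n}"
  have "(\<Sum>I | set I \<subseteq> A \<and> length I = Suc n. \<Prod>i<Suc n. g i (I ! i))
      = (\<Sum>(I, m)\<in>?L \<times> A. \<Prod>i<Suc n. g i ((m # I) ! i))"
    unfolding lists_length_Suc_eq
    by (subst sum.reindex) (auto simp: inj_on_def case_prod_beta intro!: sum.cong)
  also have "\<dots> = (\<Sum>I\<in>?L. \<Sum>m\<in>A. g 0 m * (\<Prod>i<n. g (Suc i) (I ! i)))"
    by (subst sum.cartesian_product[symmetric]) (simp add: prod.lessThan_Suc_shift del: prod.lessThan_Suc)
  also have "\<dots> = (\<Sum>m\<in>A. g 0 m) * (\<Sum>I\<in>?L. \<Prod>i<n. g (Suc i) (I ! i))"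
    by (simp add: sum_distrib_left sum_distrib_right)
  also have "\<dots> = (\<Prod>i<Suc n. \<Sum>m\<in>A. g i m)"
    by (simp add: prod.lessThan_Suc_shift Suc.IH del: prod.lessThan_Suc)
  finally show ?case by simp
qed

text \<open>Elimination: the last equation is solved for an unknown l with nonzero coefficient,
  which is then removed from the others.\<close>

lemma underdetermined_system_solution:
  fixes a :: "nat \<Rightarrow> 'i \<Rightarrow> 'k::field"
  assumes "finite J" "n < card J"
  shows "\<exists>c. (\<exists>i\<in>J. c i \<noteq> 0) \<and> (\<forall>j<n. (\<Sum>i\<in>J. c i * a j i) = 0)"
  using assms
proof (induction n arbitrary: a J)
  case 0
  then have "J \<noteq> {}" by auto
  then show ?case by (intro exI[of _ "\<lambda>_. 1"]) auto
next
  case (Suc n)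
  show ?case
  proof (cases "\<forall>i\<in>J. a n i = 0")
    case True
    obtain c where "\<exists>i\<in>J. c i \<noteq> 0" "\<forall>j<n. (\<Sum>i\<in>J. c i * a j i) = 0"
      using Suc.IH[OF Suc.prems(1), of a] Suc.prems(2) by auto
    with True show ?thesis by (intro exI[of _ c]) (auto simp: less_Suc_eq)
  next
    case False
    then obtain l where l: "l \<in> J" "a n l \<noteq> 0" by blast
    let ?J = "J - {l}"
    have "n < card ?J" using Suc.prems l by simp
    from Suc.IH[OF _ this, of "\<lambda>j i. a j i - a j l * a n i / a n l"] Suc.prems(1)
    obtain c where c: "\<exists>i\<in>?J. c i \<noteq> 0"
      "\<And>j. j < n \<Longrightarrow> (\<Sum>i\<in>?J. c i * (a j i - a j l * a n i / a n l)) = 0" by auto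
    \<comment> \<open>The value at l is the one forced by equation n.\<close>
    define c' where "c' = c(l := - (\<Sum>i\<in>?J. c i * a n i) / a n l)"
    have split: "(\<Sum>i\<in>J. c' i * a j i)
        = (\<Sum>i\<in>?J. c i * a j i) - (\<Sum>i\<in>?J. c i * a n i) / a n l * a j l" for j
      using Suc.prems(1) l(1) by (simp add: sum.remove[of J l] c'_def)
    show ?thesis
    proof (intro exI[of _ c'] conjI allI impI)
      show "\<exists>i\<in>J. c' i \<noteq> 0" using c(1) by (auto simp: c'_def)
      fix j assume "j < Suc n"
      show "(\<Sum>i\<in>J. c' i * a j i) = 0"
      proof (cases "j = n")
        case True
        then show ?thesis using split l by simp
      next
        case False
        with \<open>j < Suc n\<close> have "j < n" by simp
        have "(\<Sum>i\<in>?J. c i * (a j i - a j l * a n i / a n l))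
            = (\<Sum>i\<in>?J. c i * a j i - c i * a n i / a n l * a j l)"
          by (intro sum.cong refl) (simp add: right_diff_distrib mult_ac)
        also have "\<dots> = (\<Sum>i\<in>J. c' i * a j i)"
          unfolding split by (simp add: sum_subtractf sum_distrib_right sum_divide_distrib)
        finally show ?thesis using c(2)[OF \<open>j < n\<close>] by simp
      qed
    qed
  qed
qed

lemma orthogonal_expansion_norm:
  fixes u :: "'i \<Rightarrow> 'a::real_inner"
  assumes "finite J" "\<And>i j. i \<in> J \<Longrightarrow> j \<in> J \<Longrightarrow> u i \<bullet> u j = (if i = j then q i else 0)"
  shows "(norm (\<Sum>i\<in>J. c i *\<^sub>R u i))\<^sup>2 = (\<Sum>i\<in>J. (c i)\<^sup>2 * q i)"
proof -
  have "(norm (\<Sum>i\<in>J. c i *\<^sub>R u i))\<^sup>2 = (\<Sum>i\<in>J. \<Sum>j\<in>J. c i * c j * (u i \<bullet> u j))"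
    by (simp add: power2_norm_eq_inner inner_sum_left inner_sum_right sum_distrib_left mult_ac
        inner_commute)
  also have "\<dots> = (\<Sum>i\<in>J. \<Sum>j\<in>J. if i = j then (c i)\<^sup>2 * q i else 0)"
    using assms(2) by (intro sum.cong refl) (auto simp: power2_eq_square)
  finally show ?thesis using assms(1) by simp
qed

lemma bessel_inequality:
  fixes u :: "'i \<Rightarrow> 'a::real_inner"
  assumes "finite J" "\<And>i j. i \<in> J \<Longrightarrow> j \<in> J \<Longrightarrow> u i \<bullet> u j = (if i = j then 1 else 0)"
  shows "(\<Sum>i\<in>J. (x \<bullet> u i)\<^sup>2) \<le> (norm x)\<^sup>2"
proof -
  let ?p = "\<Sum>i\<in>J. (x \<bullet> u i) *\<^sub>R u i"
  have "x \<bullet> ?p = (\<Sum>i\<in>J. (x \<bullet> u i)\<^sup>2)" by (simp add: inner_sum_right power2_eq_square)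
  moreover have "(norm ?p)\<^sup>2 = (\<Sum>i\<in>J. (x \<bullet> u i)\<^sup>2)"
    using orthogonal_expansion_norm[OF assms, of "\<lambda>i. x \<bullet> u i"] by simp
  moreover have "(norm (x - ?p))\<^sup>2 = (norm x)\<^sup>2 - 2 * (x \<bullet> ?p) + (norm ?p)\<^sup>2"
    unfolding power2_norm_eq_inner by (simp add: inner_diff_left inner_diff_right inner_commute)
  ultimately show ?thesis using zero_le_power2[of "norm (x - ?p)"] by linarith
qed

text \<open>Linearity is available on V only, so the partial sums must be kept inside V. For
  infinite A both sums are 0, and f maps 0 to 0.\<close>

lemma bounded_linear_on_sum:
  assumes "bounded_linear_on V N f" "subspace V" "\<And>i. i \<in> A \<Longrightarrow> u i \<in> V"
  shows "f (\<Sum>i\<in>A. c i *\<^sub>R u i) = (\<Sum>i\<in>A. c i *\<^sub>R f (u i))"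
  using assms(3)
proof (induction A rule: infinite_finite_induct)
  case (insert i A)
  have "(\<Sum>i\<in>A. c i *\<^sub>R u i) \<in> V" "c i *\<^sub>R u i \<in> V"
    using insert.prems assms(2) by (auto intro!: subspace_sum subspace_scale)
  then show ?case using insert assms(1) by (simp add: bounded_linear_on_def)
next
  case empty
  have "f (0 *\<^sub>R 0) = 0 *\<^sub>R f 0"
    using assms(1) subspace_0[OF assms(2)] unfolding bounded_linear_on_def by blast
  then show ?case by simp
next
  case (infinite A)
  have "f (0 *\<^sub>R 0) = 0 *\<^sub>R f 0"
    using assms(1) subspace_0[OF assms(2)] unfolding bounded_linear_on_def by blast
  then show ?case using infinite by simp
qed

section \<open>The singular system of a tensor power\<close>

locale tensor_svd =
  fixes S1 :: "'h::{real_inner, complete_space} \<Rightarrow> 'g::{real_inner, complete_space}"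
    and lam :: "nat \<Rightarrow> real" and e :: "nat \<Rightarrow> 'h"
    and \<tau>H :: "'h list \<Rightarrow> 'a::{real_inner, complete_space}"
    and \<tau>G :: "'g list \<Rightarrow> 'b::{real_inner, complete_space}"
    and T :: "'a \<Rightarrow> 'b" and d :: nat and s :: real and M :: "nat set"
  assumes mem_M: "\<And>m. m \<in> M \<longleftrightarrow> 1 \<le> m \<and> 0 < lam m"
    and S1: "bounded_linear S1"
    and lam_nonneg: "\<And>m. 1 \<le> m \<Longrightarrow> 0 \<le> lam m"
    and lam_mono: "\<And>m n. 1 \<le> m \<Longrightarrow> m \<le> n \<Longrightarrow> lam n \<le> lam m"
    and lam1: "0 < lam 1"
    and lam_lim: "lam \<longlonglongrightarrow> 0"
    and e: "\<And>m n. m \<in> M \<Longrightarrow> n \<in> M \<Longrightarrow> e m \<bullet> e n = (if m = n then 1 else 0)"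
    and inner_S1_e: "\<And>m x. m \<in> M \<Longrightarrow> S1 x \<bullet> S1 (e m) = lam m * (x \<bullet> e m)"
    and S1_bound: "\<And>k x. (\<And>m. m \<in> M \<Longrightarrow> m \<le> k \<Longrightarrow> x \<bullet> e m = 0) \<Longrightarrow>
                     (norm (S1 x))\<^sup>2 \<le> lam (Suc k) * (norm x)\<^sup>2"
    and \<tau>H: "elementary_tensors \<tau>H" and \<tau>G: "elementary_tensors \<tau>G"
    and T: "tensor_power_operator \<tau>H \<tau>G S1 d T"
    and d: "1 \<le> d" and s: "0 < s"
begin

lemma S1_e: "m \<in> M \<Longrightarrow> n \<in> M \<Longrightarrow> S1 (e m) \<bullet> S1 (e n) = (if m = n then lam m else 0)"
  by (simp add: inner_S1_e e)

sublocale S1: bounded_linear S1 by (rule S1)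

definition "V = tensor_power \<tau>H d"
definition "W = tensor_power \<tau>G d"
text \<open>For I in \<open>Idx\<close>, \<open>E I\<close> is a right singular vector of T and
  \<open>p I\<close> its squared singular value. The finite sets \<open>Idk k\<close> exhaust
  \<open>Idx\<close>, which turns expansions over \<open>Idx\<close> into limits of
  sequences.\<close>

definition "E I = \<tau>H (map e I)"
definition "p I = prod_list (map lam I)"
definition "Idx = {I. set I \<subseteq> M \<and> length I = d}"
definition "Mk k = {m \<in> M. m \<le> k}"
definition "Idk k = {I. set I \<subseteq> Mk k \<and> length I = d}"

lemma finite_Mk [simp]: "finite (Mk k)" by (simp add: Mk_def)

lemma finite_Idk [simp]: "finite (Idk k)"
  unfolding Idk_def by (rule finite_lists_length_eq) simp

lemma Idk_subset: "Idk k \<subseteq> Idx" by (auto simp: Idk_def Idx_def Mk_def)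

lemma finite_subset_Idk:
  assumes "finite J" "J \<subseteq> Idx"
  shows "\<exists>K. \<forall>k\<ge>K. J \<subseteq> Idk k"
proof -
  have "finite (\<Union>I\<in>J. set I)" using assms by simp
  then obtain K where "\<forall>m\<in>(\<Union>I\<in>J. set I). m \<le> K" using finite_nat_set_iff_bounded_le by blast
  then show ?thesis using assms(2) by (intro exI[of _ K]) (fastforce simp: Idk_def Idx_def Mk_def)
qed

lemma p_eq_prod: "length I = d \<Longrightarrow> p I = (\<Prod>i<d. lam (I ! i))"
  unfolding p_def by (simp add: prod.list_conv_set_nth atLeast0LessThan)

lemma inner_\<tau>H: "length xs = d \<Longrightarrow> length ys = d \<Longrightarrow> \<tau>H xs \<bullet> \<tau>H ys = (\<Prod>i<d. (xs ! i) \<bullet> (ys ! i))"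
  using \<tau>H d unfolding elementary_tensors_def by (metis list.size(3) not_one_le_zero)

lemma inner_\<tau>G: "length xs = d \<Longrightarrow> length ys = d \<Longrightarrow> \<tau>G xs \<bullet> \<tau>G ys = (\<Prod>i<d. (xs ! i) \<bullet> (ys ! i))"
  using \<tau>G d unfolding elementary_tensors_def by (metis list.size(3) not_one_le_zero)

lemma T_\<tau>H: "length xs = d \<Longrightarrow> T (\<tau>H xs) = \<tau>G (map S1 xs)"
  using T unfolding tensor_power_operator_def by blast

lemma prod_delta:
  assumes "length I = d" "length J = d"
  shows "(\<Prod>i<d. if I ! i = J ! i then f i else 0) = (if I = J then (\<Prod>i<d. f i) else (0::real))"
proof (cases "I = J")
  case False
  then obtain i where "i < d" "I ! i \<noteq> J ! i" using assms nth_equalityI[of I J] by auto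
  then have "(\<Prod>i<d. if I ! i = J ! i then f i else 0) = 0" by (intro prod_zero) auto
  with False show ?thesis by simp
qed simp

lemma Idx_nth: "I \<in> Idx \<Longrightarrow> i < d \<Longrightarrow> I ! i \<in> M"
  using nth_mem by (fastforce simp: Idx_def)

lemma Idx_length: "I \<in> Idx \<Longrightarrow> length I = d" by (simp add: Idx_def)

lemma inner_E:
  assumes "I \<in> Idx" "J \<in> Idx"
  shows "E I \<bullet> E J = (if I = J then 1 else 0)"
proof -
  have "E I \<bullet> E J = (\<Prod>i<d. if I ! i = J ! i then 1 else 0)"
    unfolding E_def using assms
    by (subst inner_\<tau>H) (auto simp: Idx_length e Idx_nth intro!: prod.cong)
  then show ?thesis using assms by (simp add: prod_delta Idx_length)
qed

lemma inner_TE: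
  assumes "I \<in> Idx" "J \<in> Idx"
  shows "T (E I) \<bullet> T (E J) = (if I = J then p I else 0)"
proof -
  have "T (E I) \<bullet> T (E J) = (\<Prod>i<d. if I ! i = J ! i then lam (I ! i) else 0)"
    unfolding E_def using assms
    by (subst (1 2) T_\<tau>H) (auto simp: inner_\<tau>G Idx_length S1_e Idx_nth intro!: prod.cong)
  then show ?thesis using assms by (simp add: prod_delta Idx_length p_eq_prod)
qed


lemma subspace_V: "subspace V" and subspace_W: "subspace W"
  unfolding V_def W_def tensor_power_def by (intro subspace_closure subspace_span)+

lemma \<tau>H_in_V: "length xs = d \<Longrightarrow> \<tau>H xs \<in> V"
  unfolding V_def tensor_power_def
  by (rule subsetD[OF closure_subset], rule span_base, rule imageI) simp

lemma E_in_V: "I \<in> Idx \<Longrightarrow> E I \<in> V"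
  unfolding E_def by (intro \<tau>H_in_V) (simp add: Idx_length)

lemma T_in_W: "f \<in> V \<Longrightarrow> T f \<in> W"
  using T unfolding tensor_power_operator_def V_def W_def by blast

lemma bounded_linear_on_T: "bounded_linear_on V norm T"
  using T unfolding tensor_power_operator_def V_def by blast

lemma T_add: "f \<in> V \<Longrightarrow> g \<in> V \<Longrightarrow> T (f + g) = T f + T g"
  and T_scaleR: "f \<in> V \<Longrightarrow> T (c *\<^sub>R f) = c *\<^sub>R T f"
  using bounded_linear_on_T unfolding bounded_linear_on_def by blast+

lemma T_diff: "f \<in> V \<Longrightarrow> g \<in> V \<Longrightarrow> T (f - g) = T f - T g"
  using T_add[of f "(-1) *\<^sub>R g"] T_scaleR[of g "-1"] subspace_scale[OF subspace_V, of g "-1"] by simp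

lemma T_zero: "T 0 = 0"
  using T_scaleR[of 0 0] subspace_0[OF subspace_V] by simp

text \<open>T is controlled on V only, so its continuity is limited to sequences in V with limit in
  V.\<close>

lemma T_tendsto:
  assumes "\<And>n. f n \<in> V" "f \<longlonglongrightarrow> g" "g \<in> V"
  shows "(\<lambda>n. T (f n)) \<longlonglongrightarrow> T g"
proof -
  obtain K where K: "\<And>x. x \<in> V \<Longrightarrow> norm (T x) \<le> K * norm x"
    using bounded_linear_on_T unfolding bounded_linear_on_def by blast
  have "(\<lambda>n. K * norm (f n - g)) \<longlonglongrightarrow> K * norm (g - g)"
    by (intro tendsto_intros assms)
  then have "(\<lambda>n. K * norm (f n - g)) \<longlonglongrightarrow> 0" by simp
  then have "(\<lambda>n. T (f n) - T g) \<longlonglongrightarrow> 0"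
    by (rule Lim_null_comparison[rotated])
      (use K subspace_diff[OF subspace_V] assms in \<open>simp add: T_diff[symmetric]\<close>)
  then show ?thesis using Lim_null by blast
qed

text \<open>Partial sums of the singular value expansion of \<open>T f\<close>.\<close>

definition "TP k f = (\<Sum>I\<in>Idk k. (f \<bullet> E I) *\<^sub>R T (E I))"

text \<open>The remainder \<open>x - P k\<close> is orthogonal to the first k eigenvectors, so its
  image has squared norm at most \<open>lam (Suc k) * (norm x)\<^sup>2\<close>, which tends to
  0.\<close>

lemma S1_Parseval: "(\<lambda>k. \<Sum>m\<in>Mk k. lam m * (x \<bullet> e m)\<^sup>2) \<longlonglongrightarrow> (norm (S1 x))\<^sup>2"
proof -
  define P where "P k = (\<Sum>m\<in>Mk k. (x \<bullet> e m) *\<^sub>R e m)" for k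
  define Q where "Q k = (\<Sum>m\<in>Mk k. lam m * (x \<bullet> e m)\<^sup>2)" for k
  have S1P: "(norm (S1 (P k)))\<^sup>2 = Q k" for k
    unfolding P_def Q_def S1.sum S1.scaleR
    by (subst orthogonal_expansion_norm[where q = lam]) (auto simp: S1_e Mk_def mult_ac)
  have "S1 x \<bullet> S1 (P k) = Q k" for k
    unfolding P_def Q_def S1.sum S1.scaleR inner_sum_right
    by (intro sum.cong refl) (auto simp: Mk_def inner_S1_e power2_eq_square)
  then have diff: "(norm (S1 (x - P k)))\<^sup>2 = (norm (S1 x))\<^sup>2 - Q k" for k
    using S1P[of k] unfolding S1.diff power2_norm_eq_inner
    by (simp add: inner_diff_left inner_diff_right inner_commute)
  have PP: "(norm (P k))\<^sup>2 = (\<Sum>m\<in>Mk k. (x \<bullet> e m)\<^sup>2)" for k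
    unfolding P_def by (subst orthogonal_expansion_norm[where q = "\<lambda>_. 1"]) (auto simp: e Mk_def)
  have "x \<bullet> P k = (\<Sum>m\<in>Mk k. (x \<bullet> e m)\<^sup>2)" for k
    unfolding P_def inner_sum_right by (simp add: power2_eq_square)
  then have "(norm (x - P k))\<^sup>2 = (norm x)\<^sup>2 - (\<Sum>m\<in>Mk k. (x \<bullet> e m)\<^sup>2)" for k
    using PP[of k] unfolding power2_norm_eq_inner
    by (simp add: inner_diff_left inner_diff_right inner_commute)
  then have le: "(norm (x - P k))\<^sup>2 \<le> (norm x)\<^sup>2" for k
    by (simp add: sum_nonneg)
  have perp: "(x - P k) \<bullet> e m = 0" if "m \<in> M" "m \<le> k" for k m
  proof -
    have "P k \<bullet> e m = (\<Sum>n\<in>Mk k. if n = m then x \<bullet> e m else 0)"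
      unfolding P_def inner_sum_left using that by (intro sum.cong refl) (auto simp: e Mk_def)
    then show ?thesis using that by (simp add: inner_diff_left Mk_def)
  qed
  have bound: "(norm (S1 x))\<^sup>2 - Q k \<le> lam (Suc k) * (norm x)\<^sup>2" for k
  proof -
    have "(norm (S1 x))\<^sup>2 - Q k \<le> lam (Suc k) * (norm (x - P k))\<^sup>2"
      unfolding diff[symmetric] by (rule S1_bound[OF perp])
    also have "\<dots> \<le> lam (Suc k) * (norm x)\<^sup>2"
      by (intro mult_left_mono le lam_nonneg) simp
    finally show ?thesis .
  qed
  have lim: "(\<lambda>k. lam (Suc k) * (norm x)\<^sup>2) \<longlonglongrightarrow> 0"
    by (rule tendsto_mult_left_zero[OF LIMSEQ_Suc[OF lam_lim]])
  have nn: "0 \<le> (norm (S1 x))\<^sup>2 - Q k" for k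
    unfolding diff[symmetric] by simp
  have "(\<lambda>k. (norm (S1 x))\<^sup>2 - Q k) \<longlonglongrightarrow> 0"
    by (rule tendsto_sandwich[OF _ _ tendsto_const lim]) (intro always_eventually allI bound nn)+
  from tendsto_diff[OF tendsto_const this, of "(norm (S1 x))\<^sup>2"]
  show ?thesis by (simp add: Q_def)
qed

text \<open>
  For an elementary tensor the squared error is a difference of two products over the coordinates,
  so that convergence reduces to Parseval's identity for \<open>S1\<close> in each coordinate and \<open>\<tau>H\<close> need not
  be expanded by multilinearity.
\<close>

lemma TP_elementary:
  assumes xs: "length xs = d"
  shows "(\<lambda>k. TP k (\<tau>H xs)) \<longlonglongrightarrow> T (\<tau>H xs)"
proof -
  let ?f = "\<tau>H xs"
  have Tf: "T ?f \<bullet> T (E I) = p I * (?f \<bullet> E I)" if "I \<in> Idx" for I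
  proof -
    have "T ?f \<bullet> T (E I) = (\<Prod>i<d. lam (I ! i) * (xs ! i \<bullet> e (I ! i)))"
      unfolding E_def using that xs
      by (subst (1 2) T_\<tau>H) (auto simp: inner_\<tau>G Idx_length inner_S1_e Idx_nth intro!: prod.cong)
    also have "\<dots> = p I * (?f \<bullet> E I)"
      unfolding E_def using that xs
      by (subst inner_\<tau>H) (auto simp: Idx_length p_eq_prod prod.distrib intro!: prod.cong)
    finally show ?thesis .
  qed
  have nTP: "(norm (TP k ?f))\<^sup>2 = (\<Sum>I\<in>Idk k. p I * (?f \<bullet> E I)\<^sup>2)" for k
    unfolding TP_def
    by (subst orthogonal_expansion_norm[where q = p])
      (auto simp: inner_TE Idk_subset[THEN subsetD, of _ k] mult_ac)
  have "T ?f \<bullet> TP k ?f = (\<Sum>I\<in>Idk k. p I * (?f \<bullet> E I)\<^sup>2)" for k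
    unfolding TP_def inner_sum_right
    by (intro sum.cong refl) (auto simp: Tf Idk_subset[THEN subsetD, of _ k] power2_eq_square)
  then have diff: "(norm (T ?f - TP k ?f))\<^sup>2 = (norm (T ?f))\<^sup>2 - (\<Sum>I\<in>Idk k. p I * (?f \<bullet> E I)\<^sup>2)" for k
    using nTP[of k] unfolding power2_norm_eq_inner
    by (simp add: inner_diff_left inner_diff_right inner_commute)
  have sum: "(\<Sum>I\<in>Idk k. p I * (?f \<bullet> E I)\<^sup>2)
      = (\<Prod>i<d. \<Sum>m\<in>Mk k. lam m * (xs ! i \<bullet> e m)\<^sup>2)" for k
  proof -
    have "p I * (?f \<bullet> E I)\<^sup>2 = (\<Prod>i<d. lam (I ! i) * (xs ! i \<bullet> e (I ! i))\<^sup>2)" if "I \<in> Idk k" for I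
      unfolding E_def using that[THEN Idk_subset[THEN subsetD]] xs
      by (subst inner_\<tau>H) (auto simp: Idx_length p_eq_prod prod.distrib prod_power_distrib[symmetric]
          intro!: prod.cong)
    then show ?thesis
      by (subst prod_sum_lists) (auto simp: Idk_def)
  qed
  have nT: "(norm (T ?f))\<^sup>2 = (\<Prod>i<d. (norm (S1 (xs ! i)))\<^sup>2)"
    unfolding power2_norm_eq_inner using xs by (simp add: T_\<tau>H inner_\<tau>G)
  have eq: "(\<lambda>k. (norm (T ?f - TP k ?f))\<^sup>2) = (\<lambda>k. (\<Prod>i<d. (norm (S1 (xs ! i)))\<^sup>2)
      - (\<Prod>i<d. \<Sum>m\<in>Mk k. lam m * (xs ! i \<bullet> e m)\<^sup>2))" by (simp only: diff sum nT)
  have "(\<lambda>k. (norm (T ?f - TP k ?f))\<^sup>2) \<longlonglongrightarrow>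
      (\<Prod>i<d. (norm (S1 (xs ! i)))\<^sup>2) - (\<Prod>i<d. (norm (S1 (xs ! i)))\<^sup>2)"
    unfolding eq by (intro tendsto_diff tendsto_const tendsto_prod S1_Parseval)
  from tendsto_real_sqrt[OF this] have "(\<lambda>k. norm (T ?f - TP k ?f)) \<longlonglongrightarrow> 0" by simp
  then have "(\<lambda>k. T ?f - TP k ?f) \<longlonglongrightarrow> 0" by (rule tendsto_norm_zero_cancel)
  from tendsto_diff[OF tendsto_const this, of "T ?f"] show ?thesis by simp
qed

text \<open>Both sides are linear in f, which carries the convergence from elementary tensors to
  their span. The closure is left to \<open>truncation_error\<close>, where a bound uniform in k is
  at hand.\<close>

lemma TP_span:
  assumes "f \<in> span (\<tau>H ` {xs. length xs = d})"
  shows "f \<in> V \<and> (\<lambda>k. TP k f) \<longlonglongrightarrow> T f"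
proof -
  let ?Q = "{f \<in> V. (\<lambda>k. TP k f) \<longlonglongrightarrow> T f}"
  have add: "TP k (f + g) = TP k f + TP k g" for k f g
    unfolding TP_def by (simp add: inner_add_left scaleR_add_left sum.distrib)
  have scale: "TP k (c *\<^sub>R f) = c *\<^sub>R TP k f" for k f c
    unfolding TP_def by (simp add: scaleR_sum_right)
  have "subspace ?Q" unfolding subspace_def
  proof (intro conjI ballI allI)
    show "0 \<in> ?Q" by (simp add: subspace_0[OF subspace_V] TP_def T_zero)
    show "f + g \<in> ?Q" if "f \<in> ?Q" "g \<in> ?Q" for f g
      using that by (auto simp: add T_add intro!: tendsto_add subspace_add[OF subspace_V])
    show "c *\<^sub>R f \<in> ?Q" if "f \<in> ?Q" for c f
      using that by (auto simp: scale T_scaleR intro!: tendsto_scaleR tendsto_const subspace_scale[OF subspace_V])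
  qed
  then have "span (\<tau>H ` {xs. length xs = d}) \<subseteq> ?Q"
    by (intro span_minimal image_subsetI) (simp_all add: \<tau>H_in_V TP_elementary)
  with assms show ?thesis by blast
qed

text \<open>The components outside J have orthogonal images and squared singular values at most
  \<delta>, so Bessel's inequality bounds all partial sums uniformly in k. Then k tends to infinity
  on the span, and finally f is approximated from the span.\<close>

lemma truncation_error:
  assumes J: "finite J" "J \<subseteq> Idx" and small: "\<And>I. I \<in> Idx \<Longrightarrow> I \<notin> J \<Longrightarrow> p I \<le> \<delta>"
    and "\<delta> \<ge> 0" and f: "f \<in> V"
  shows "(norm (T f - (\<Sum>I\<in>J. (f \<bullet> E I) *\<^sub>R T (E I))))\<^sup>2 \<le> \<delta> * (norm f)\<^sup>2"
proof -
  define A where "A f = (\<Sum>I\<in>J. (f \<bullet> E I) *\<^sub>R T (E I))" for f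
  obtain K where K: "\<And>k. k \<ge> K \<Longrightarrow> J \<subseteq> Idk k" using finite_subset_Idk[OF J] by blast
  have TPA: "(norm (TP k g - A g))\<^sup>2 \<le> \<delta> * (norm g)\<^sup>2" if "k \<ge> K" for k g
  proof -
    have "TP k g - A g = (\<Sum>I\<in>Idk k - J. (g \<bullet> E I) *\<^sub>R T (E I))"
      unfolding TP_def A_def by (simp add: sum_diff K[OF that])
    then have "(norm (TP k g - A g))\<^sup>2 = (\<Sum>I\<in>Idk k - J. (g \<bullet> E I)\<^sup>2 * p I)"
      by (simp only:) (subst orthogonal_expansion_norm[where q = p],
          auto simp: inner_TE Idk_subset[THEN subsetD, of _ k])
    also have "\<dots> \<le> (\<Sum>I\<in>Idk k - J. (g \<bullet> E I)\<^sup>2 * \<delta>)"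
      using Idk_subset[of k] by (intro sum_mono mult_left_mono small) auto
    also have "\<dots> = \<delta> * (\<Sum>I\<in>Idk k - J. (g \<bullet> E I)\<^sup>2)"
      by (simp add: sum_distrib_left mult_ac)
    also have "\<dots> \<le> \<delta> * (norm g)\<^sup>2"
      using \<open>\<delta> \<ge> 0\<close>
      by (intro mult_left_mono bessel_inequality)
        (auto simp: inner_E Idk_subset[THEN subsetD, of _ k])
    finally show ?thesis .
  qed
  have span: "(norm (T g - A g))\<^sup>2 \<le> \<delta> * (norm g)\<^sup>2"
    if "g \<in> span (\<tau>H ` {xs. length xs = d})" for g
  proof (rule LIMSEQ_le_const2)
    show "(\<lambda>k. (norm (TP k g - A g))\<^sup>2) \<longlonglongrightarrow> (norm (T g - A g))\<^sup>2"
      using TP_span[OF that] by (intro tendsto_intros) auto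
    show "\<exists>N. \<forall>n\<ge>N. (norm (TP n g - A g))\<^sup>2 \<le> \<delta> * (norm g)\<^sup>2" using TPA by blast
  qed
  obtain g where g: "\<And>n. g n \<in> span (\<tau>H ` {xs. length xs = d})" "g \<longlonglongrightarrow> f"
    using f unfolding V_def tensor_power_def closure_sequential by blast
  have "(norm (T f - A f))\<^sup>2 \<le> \<delta> * (norm f)\<^sup>2"
  proof (rule LIMSEQ_le)
    show "(\<lambda>n. (norm (T (g n) - A (g n)))\<^sup>2) \<longlonglongrightarrow> (norm (T f - A f))\<^sup>2"
      unfolding A_def using TP_span[OF g(1)] by (intro tendsto_intros T_tendsto g f) auto
    show "(\<lambda>n. \<delta> * (norm (g n))\<^sup>2) \<longlonglongrightarrow> \<delta> * (norm f)\<^sup>2" by (intro tendsto_intros g)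
    show "\<exists>N. \<forall>n\<ge>N. (norm (T (g n) - A (g n)))\<^sup>2 \<le> \<delta> * (norm (g n))\<^sup>2" using span g by blast
  qed
  then show ?thesis by (simp add: A_def)
qed

section \<open>Minimal errors and the number of large products\<close>

lemma scaled_norm_eq: "scaled_norm s f = norm f / sqrt s"
  using s by (simp add: scaled_norm_def scaled_inner_def norm_eq_sqrt_inner real_sqrt_divide)

abbreviation "algs n \<equiv> linear_algorithms V (scaled_norm s) W n"
abbreviation "err A \<equiv> worst_case_error V (scaled_norm s) T A"

lemma zero_algorithm: "(\<lambda>f. 0) \<in> algs n"
  unfolding linear_algorithms_def
proof (intro CollectI exI conjI ballI)
  show "bounded_linear_on V (scaled_norm s) (\<lambda>_. 0 :: real)"
    unfolding bounded_linear_on_def by (auto intro: exI[of _ 0])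
qed (use subspace_0[OF subspace_W] in auto)

text \<open>A real supremum is informative only for a bounded set; here T and all functionals of the
  algorithm are bounded on the unit ball.\<close>

lemma error_bdd_above:
  assumes "A \<in> algs n"
  shows "bdd_above ((\<lambda>f. norm (T f - A f)) ` {f \<in> V. scaled_norm s f \<le> 1})"
proof -
  obtain L g where L: "\<And>j. j \<in> {1..n} \<Longrightarrow> bounded_linear_on V (scaled_norm s) (L j)"
    and A: "A = (\<lambda>f. \<Sum>j=1..n. L j f *\<^sub>R g j)"
    using assms unfolding linear_algorithms_def by blast
  have "\<exists>K. \<forall>f\<in>V. norm (L j f) \<le> K * scaled_norm s f" if "j \<in> {1..n}" for j
    using L[OF that] unfolding bounded_linear_on_def by blast
  then obtain K where K: "\<And>j f. j \<in> {1..n} \<Longrightarrow> f \<in> V \<Longrightarrow> norm (L j f) \<le> K j * scaled_norm s f"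
    by metis
  obtain K0 where K0: "\<And>f. f \<in> V \<Longrightarrow> norm (T f) \<le> K0 * norm f"
    using bounded_linear_on_T unfolding bounded_linear_on_def by blast
  show ?thesis
  proof (rule bdd_aboveI2)
    fix f assume f: "f \<in> {f \<in> V. scaled_norm s f \<le> 1}"
    then have nf: "norm f \<le> sqrt s" "0 \<le> scaled_norm s f" "scaled_norm s f \<le> 1" "f \<in> V"
      using s by (auto simp: scaled_norm_eq)
    have "norm (T f) \<le> \<bar>K0\<bar> * sqrt s"
      by (rule order_trans[OF K0[OF nf(4)]]) (intro mult_mono nf, auto)
    moreover have "norm (A f) \<le> (\<Sum>j=1..n. \<bar>K j\<bar> * norm (g j))"
      unfolding A
    proof (rule sum_norm_le)
      fix j assume "j \<in> {1..n}"
      have "norm (L j f) \<le> \<bar>K j\<bar> * 1"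
        by (rule order_trans[OF K[OF \<open>j \<in> {1..n}\<close> nf(4)]]) (intro mult_mono nf, auto)
      then show "norm (L j f *\<^sub>R g j) \<le> \<bar>K j\<bar> * norm (g j)" by (simp add: mult_right_mono)
    qed
    ultimately show "norm (T f - A f) \<le> \<bar>K0\<bar> * sqrt s + (\<Sum>j=1..n. \<bar>K j\<bar> * norm (g j))"
      using norm_triangle_ineq4[of "T f" "A f"] by linarith
  qed
qed

lemma error_lower:
  assumes "A \<in> algs n" "f \<in> V" "scaled_norm s f \<le> 1"
  shows "norm (T f - A f) \<le> err A"
  unfolding worst_case_error_def using assms by (intro cSUP_upper error_bdd_above) auto

lemma error_upper:
  assumes "\<And>f. f \<in> V \<Longrightarrow> scaled_norm s f \<le> 1 \<Longrightarrow> norm (T f - A f) \<le> b"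
  shows "err A \<le> b"
  unfolding worst_case_error_def
proof (rule cSUP_least)
  have "0 \<in> {f \<in> V. scaled_norm s f \<le> 1}"
    using subspace_0[OF subspace_V] by (simp add: scaled_norm_eq)
  then show "{f \<in> V. scaled_norm s f \<le> 1} \<noteq> {}" by blast
qed (use assms in auto)

lemma bdd_below_errors: "bdd_below (err ` algs n)"
proof (rule bdd_belowI2)
  fix A assume "A \<in> algs n"
  then have "norm (T 0 - A 0) \<le> err A"
    by (rule error_lower) (use subspace_0[OF subspace_V] in \<open>simp_all add: scaled_norm_eq\<close>)
  then show "0 \<le> err A" using norm_ge_zero order_trans by blast
qed

abbreviation "err_min n \<equiv> minimal_error V (scaled_norm s) W T n"

lemma large_products_subset:
  assumes "0 \<le> \<delta>"
  shows "large_products lam d \<delta> \<subseteq> Idx"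
proof
  fix I assume "I \<in> large_products lam d \<delta>"
  then have I: "length I = d" "\<And>m. m \<in> set I \<Longrightarrow> 1 \<le> m" "\<delta> < prod_list (map lam I)"
    by (auto simp: large_products_def)
  then have "prod_list (map lam I) \<noteq> 0" using assms by auto
  then have "\<And>m. m \<in> set I \<Longrightarrow> lam m \<noteq> 0" by (auto simp: prod_list_zero_iff)
  with I(2) lam_nonneg have "0 < lam m" if "m \<in> set I" for m using that by (metis order_le_less)
  then show "I \<in> Idx" using I(1,2) by (simp add: Idx_def subset_eq mem_M)
qed

lemma mem_large_products_iff:
  assumes "0 \<le> \<delta>" "I \<in> Idx"
  shows "I \<in> large_products lam d \<delta> \<longleftrightarrow> \<delta> < p I"
  using assms by (simp add: large_products_def p_def Idx_def subset_eq mem_M)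

lemma finite_large_products:
  assumes "0 < \<delta>"
  shows "finite (large_products lam d \<delta>)"
proof -
  interpret w: weights "\<lambda>m. lam m / lam 1"
  proof
    show "lam 1 / lam 1 = 1" using lam1 by simp
    show "0 \<le> lam m / lam 1" if "1 \<le> m" for m using lam_nonneg[OF that] lam1 by simp
    show "lam n / lam 1 \<le> lam m / lam 1" if "1 \<le> m" "m \<le> n" for m n
      using lam_mono[OF that] lam1 by (intro divide_right_mono) simp_all
    show "(\<lambda>m. lam m / lam 1) \<longlonglongrightarrow> 0"
      using tendsto_divide[OF lam_lim tendsto_const, of "lam 1"] lam1 by simp
  qed
  have "finite (large_products (\<lambda>m. lam m / lam 1) d (\<delta> / lam 1 ^ d))"
    using assms lam1 by (intro w.finite_large_products) simp
  then show ?thesis using large_products_normalize[of lam d "\<delta> / lam 1 ^ d"] lam1 by simp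
qed

text \<open>The expansion truncated to the large products is an algorithm with error at most
  \<epsilon>: the scaled unit ball has radius \<open>sqrt s\<close> in the original norm, and the
  omitted squared singular values are at most \<open>\<epsilon>\<^sup>2 / s\<close>.\<close>

lemma min_error_le:
  assumes "0 < \<epsilon>" and n: "card (large_products lam d (\<epsilon>\<^sup>2 / s)) \<le> n"
  shows "err_min n \<le> \<epsilon>"
proof -
  define \<delta> where "\<delta> = \<epsilon>\<^sup>2 / s"
  define J where "J = large_products lam d \<delta>"
  have "0 < \<delta>" using assms s by (simp add: \<delta>_def)
  have J: "finite J" "J \<subseteq> Idx"
    using \<open>0 < \<delta>\<close> by (simp_all add: J_def finite_large_products large_products_subset)
  obtain h where h: "bij_betw h {1..card J} J" using ex_bij_betw_nat_finite_1[OF J(1)] by blast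
  have cJ: "card J \<le> n" using n by (simp add: J_def \<delta>_def)
  have hJ: "h j \<in> Idx" if "j \<in> {1..card J}" for j using bij_betwE[OF h] that J(2) by blast
  \<comment> \<open>Terms beyond \<open>card J\<close> are zero, which pads the algorithm to exactly
    n terms.\<close>
  define L where "L j f = (if j \<in> {1..card J} then f \<bullet> E (h j) else 0)" for j f
  define g where "g j = (if j \<in> {1..card J} then T (E (h j)) else 0)" for j
  define A where "A f = (\<Sum>j=1..n. L j f *\<^sub>R g j)" for f
  have A_eq: "A f = (\<Sum>I\<in>J. (f \<bullet> E I) *\<^sub>R T (E I))" for f
  proof -
    have "A f = (\<Sum>j=1..card J. L j f *\<^sub>R g j)"
      unfolding A_def using cJ by (intro sum.mono_neutral_right) (auto simp: L_def)
    also have "\<dots> = (\<Sum>j=1..card J. (f \<bullet> E (h j)) *\<^sub>R T (E (h j)))"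
      by (intro sum.cong refl) (simp add: L_def g_def)
    also have "\<dots> = (\<Sum>I\<in>J. (f \<bullet> E I) *\<^sub>R T (E I))"
      by (rule sum.reindex_bij_betw[OF h])
    finally show ?thesis .
  qed
  have "A \<in> algs n"
    unfolding linear_algorithms_def
  proof (intro CollectI exI conjI ballI)
    show "A = (\<lambda>f. \<Sum>j=1..n. L j f *\<^sub>R g j)" by (simp add: A_def fun_eq_iff)
    fix j
    show "g j \<in> W" by (simp add: g_def T_in_W E_in_V hJ subspace_0[OF subspace_W])
    show "bounded_linear_on V (scaled_norm s) (L j)" unfolding bounded_linear_on_def
    proof (intro conjI exI[of _ "sqrt s"] ballI allI)
      fix f
      have "\<bar>f \<bullet> E (h j)\<bar> \<le> norm f" if "j \<in> {1..card J}"
        using Cauchy_Schwarz_ineq2[of f "E (h j)"] inner_E[OF hJ[OF that] hJ[OF that]]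
        by (simp add: norm_eq_sqrt_inner[of "E (h j)"])
      then show "norm (L j f) \<le> sqrt s * scaled_norm s f"
        using s by (auto simp: L_def scaled_norm_eq)
    qed (auto simp: L_def inner_add_left)
  qed
  have "norm (T f - A f) \<le> \<epsilon>" if f: "f \<in> V" "scaled_norm s f \<le> 1" for f
  proof -
    have "(norm f)\<^sup>2 \<le> s"
      using f(2) s by (simp add: scaled_norm_eq real_le_rsqrt sqrt_ge_absD)
    have "(norm (T f - A f))\<^sup>2 \<le> \<delta> * (norm f)\<^sup>2"
      unfolding A_eq
    proof (rule truncation_error[OF J _ _ f(1)])
      show "p I \<le> \<delta>" if "I \<in> Idx" "I \<notin> J" for I
        using mem_large_products_iff[of \<delta> I] that \<open>0 < \<delta>\<close> by (simp add: J_def)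
    qed (use \<open>0 < \<delta>\<close> in simp)
    also have "\<dots> \<le> \<delta> * s" using \<open>0 < \<delta>\<close> \<open>(norm f)\<^sup>2 \<le> s\<close> by (intro mult_left_mono) auto
    also have "\<dots> = \<epsilon>\<^sup>2" using s by (simp add: \<delta>_def)
    finally show ?thesis by (rule power2_le_imp_le) (use assms(1) in simp)
  qed
  then have "err A \<le> \<epsilon>" by (intro error_upper)
  moreover have "err_min n \<le> err A"
    unfolding minimal_error_def by (rule cINF_lower[OF bdd_below_errors \<open>A \<in> algs n\<close>])
  ultimately show ?thesis by linarith
qed

text \<open>With n below \<open>card J\<close>, the n functionals have a common nonzero zero f in
  the span of the vectors \<open>E I\<close>. The algorithm returns 0 there, while T multiplies the
  squared norm by at least q.\<close>

lemma min_error_gt: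
  assumes "0 < \<epsilon>" and n: "n < card (large_products lam d (\<epsilon>\<^sup>2 / s))"
  shows "\<epsilon> < err_min n"
proof -
  define \<delta> where "\<delta> = \<epsilon>\<^sup>2 / s"
  define J where "J = large_products lam d \<delta>"
  have "0 < \<delta>" using assms s by (simp add: \<delta>_def)
  have J: "finite J" "J \<subseteq> Idx"
    using \<open>0 < \<delta>\<close> by (simp_all add: J_def finite_large_products large_products_subset)
  have nJ: "n < card J" using n by (simp add: J_def \<delta>_def)
  then have "J \<noteq> {}" by auto
  \<comment> \<open>The minimum over the finite set J still exceeds \<delta>; this fixed gap keeps
    the inequality strict after the infimum over all algorithms.\<close>
  define q where "q = Min (p ` J)"
  have q: "\<delta> < q" unfolding q_def
    using J \<open>J \<noteq> {}\<close> mem_large_products_iff \<open>0 < \<delta>\<close> by (subst Min_gr_iff) (auto simp: J_def)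
  have q_le: "q \<le> p I" if "I \<in> J" for I using that J(1) by (simp add: q_def)
  have "sqrt (q * s) \<le> err A" if A: "A \<in> algs n" for A
  proof -
    obtain L g where L: "\<And>j. j \<in> {1..n} \<Longrightarrow> bounded_linear_on V (scaled_norm s) (L j)"
      and A_eq: "A = (\<lambda>f. \<Sum>j=1..n. L j f *\<^sub>R g j)"
      using A unfolding linear_algorithms_def by blast
    \<comment> \<open>The linear system counts its equations from 0, the algorithm its functionals
      from 1.\<close>
    from underdetermined_system_solution[OF J(1) nJ, of "\<lambda>j I. L (Suc j) (E I)"]
    obtain c where c: "\<exists>I\<in>J. c I \<noteq> 0" "\<And>j. j < n \<Longrightarrow> (\<Sum>I\<in>J. c I * L (Suc j) (E I)) = 0"
      by blast
    define f where "f = (\<Sum>I\<in>J. c I *\<^sub>R E I)"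
    have EV: "\<And>I. I \<in> J \<Longrightarrow> E I \<in> V" using J(2) E_in_V by blast
    have fV: "f \<in> V" unfolding f_def by (intro subspace_sum[OF subspace_V] subspace_scale[OF subspace_V] EV)
    have Lf: "L j f = 0" if "j \<in> {1..n}" for j
    proof -
      have "L j f = (\<Sum>I\<in>J. c I *\<^sub>R L j (E I))"
        unfolding f_def by (rule bounded_linear_on_sum[OF L[OF that] subspace_V EV])
      moreover have "j - 1 < n" "Suc (j - 1) = j" using that by auto
      ultimately show ?thesis using c(2)[of "j - 1"] by simp
    qed
    have nf: "(norm f)\<^sup>2 = (\<Sum>I\<in>J. (c I)\<^sup>2)"
      unfolding f_def using J
      by (subst orthogonal_expansion_norm[where q = "\<lambda>_. 1"]) (auto simp: inner_E subset_iff)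
    have "T f = (\<Sum>I\<in>J. c I *\<^sub>R T (E I))"
      unfolding f_def by (rule bounded_linear_on_sum[OF bounded_linear_on_T subspace_V EV])
    then have "(norm (T f))\<^sup>2 = (\<Sum>I\<in>J. (c I)\<^sup>2 * p I)"
      using J by (simp only:) (subst orthogonal_expansion_norm[where q = p], auto simp: inner_TE subset_iff)
    also have "\<dots> \<ge> (\<Sum>I\<in>J. (c I)\<^sup>2 * q)" by (intro sum_mono mult_left_mono q_le) auto
    also have "(\<Sum>I\<in>J. (c I)\<^sup>2 * q) = q * (norm f)\<^sup>2" by (simp add: nf sum_distrib_left mult_ac)
    finally have nTf: "q * (norm f)\<^sup>2 \<le> (norm (T f))\<^sup>2" .
    have "(norm f)\<^sup>2 > 0" unfolding nf using c(1) J(1) by (auto intro!: sum_pos2)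
    then have "norm f > 0" by simp
    define u where "u = (sqrt s / norm f) *\<^sub>R f"
    have uV: "u \<in> V" unfolding u_def by (rule subspace_scale[OF subspace_V fV])
    have nu: "scaled_norm s u \<le> 1"
      using \<open>norm f > 0\<close> s by (simp add: u_def scaled_norm_eq)
    have "L j u = 0" if "j \<in> {1..n}" for j
      using L[OF that] fV Lf[OF that] by (simp add: u_def bounded_linear_on_def)
    then have "A u = 0" by (simp add: A_eq)
    have "q * s \<le> s * ((norm (T f))\<^sup>2 / (norm f)\<^sup>2)"
      using nTf \<open>norm f > 0\<close> s by (simp add: field_simps)
    also have "\<dots> = (norm (T u))\<^sup>2"
      using s by (simp add: u_def T_scaleR[OF fV] power_mult_distrib power_divide)
    finally have "sqrt (q * s) \<le> norm (T u)" by (simp add: real_le_lsqrt)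
    also have "\<dots> = norm (T u - A u)" using \<open>A u = 0\<close> by simp
    also have "\<dots> \<le> err A" by (rule error_lower[OF A uV nu])
    finally show ?thesis .
  qed
  then have "sqrt (q * s) \<le> err_min n"
    unfolding minimal_error_def using zero_algorithm by (intro cINF_greatest) auto
  moreover have "\<epsilon>\<^sup>2 < q * s" using q s by (simp add: \<delta>_def pos_divide_less_eq)
  then have "\<epsilon> < sqrt (q * s)" by (rule real_less_rsqrt)
  ultimately show ?thesis by linarith
qed

theorem least_error_index:
  assumes "0 < \<epsilon>"
  shows "(LEAST n. minimal_error (tensor_power \<tau>H d) (scaled_norm s) (tensor_power \<tau>G d) T n \<le> \<epsilon>)
    = card (large_products lam d (\<epsilon>\<^sup>2 / s))"
  unfolding V_def[symmetric] W_def[symmetric]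
proof (rule Least_equality)
  show "err_min (card (large_products lam d (\<epsilon>\<^sup>2 / s))) \<le> \<epsilon>" by (rule min_error_le[OF assms order_refl])
  show "card (large_products lam d (\<epsilon>\<^sup>2 / s)) \<le> n" if "err_min n \<le> \<epsilon>" for n
    using min_error_gt[OF assms, of n] that by (meson leD leI)
qed

text \<open>No product exceeds \<open>lam 1 ^ d\<close>, which gives the upper bound; every smaller
  threshold is exceeded by the product with all indices 1, which gives the lower one.\<close>

theorem initial_error:
  "minimal_error (tensor_power \<tau>H d) (scaled_norm s) (tensor_power \<tau>G d) T 0 = sqrt (s * lam 1 ^ d)"
  unfolding V_def[symmetric] W_def[symmetric]
proof -
  let ?r = "sqrt (s * lam 1 ^ d)"
  have "?r > 0" using s lam1 by simp
  have le: "prod_list (map lam I) \<le> lam 1 ^ d" if "length I = d" "\<forall>m\<in>set I. 1 \<le> m" for I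
    using prod_list_le_power[of I lam "lam 1"] that lam_nonneg lam_mono by auto
  have "large_products lam d (?r\<^sup>2 / s) = {}"
    using le s lam1 by (force simp: large_products_def)
  then have "err_min 0 \<le> ?r" using min_error_le[OF \<open>?r > 0\<close>, of 0] by simp
  moreover have "\<not> err_min 0 < ?r"
  proof
    assume "err_min 0 < ?r"
    then obtain \<epsilon> where \<epsilon>: "max 0 (err_min 0) < \<epsilon>" "\<epsilon> < ?r"
      using dense[of "max 0 (err_min 0)" ?r] \<open>?r > 0\<close> by auto
    have "\<epsilon>\<^sup>2 < s * lam 1 ^ d"
      using \<epsilon> by (metis max.strict_boundedE less_imp_le not_less real_le_lsqrt)
    then have "\<epsilon>\<^sup>2 / s < lam 1 ^ d" using s by (simp add: pos_divide_less_eq mult.commute)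
    then have "replicate d 1 \<in> large_products lam d (\<epsilon>\<^sup>2 / s)"
      by (simp add: large_products_def)
    then have "0 < card (large_products lam d (\<epsilon>\<^sup>2 / s))"
      using finite_large_products[of "\<epsilon>\<^sup>2 / s"] \<epsilon> s by (auto simp: card_gt_0_iff)
    from min_error_gt[OF _ this] \<epsilon> show False by simp
  qed
  ultimately show "err_min 0 = ?r" by linarith
qed

end

subsection \<open>Tractability in terms of product counts\<close>

text \<open>If the uniform statement fails for every R, the choices R = k form a sequence that
  violates the limit. Conversely, a positive complexity has nonnegative logarithm, so upper bounds
  suffice for the limit.\<close>

lemma weakly_tractable_iff:
  fixes e :: "nat \<Rightarrow> nat \<Rightarrow> real"
  assumes pos: "\<And>\<epsilon> d. 0 < \<epsilon> \<Longrightarrow> 1 \<le> d \<Longrightarrow> \<epsilon> < e 0 d \<Longrightarrow> 1 \<le> info_complexity e \<epsilon> d"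
  shows "weakly_tractable e \<longleftrightarrow> (\<forall>\<eta>>0. \<exists>R. \<forall>\<epsilon> d. 0 < \<epsilon> \<and> \<epsilon> \<le> 1 \<and> 1 \<le> d \<and> \<epsilon> < e 0 d \<and>
    R \<le> 1 / \<epsilon> + real d \<longrightarrow> ln (real (info_complexity e \<epsilon> d)) \<le> \<eta> * (1 / \<epsilon> + real d))"
    (is "_ \<longleftrightarrow> ?R")
proof
  assume wt: "weakly_tractable e"
  show ?R
  proof (rule ccontr)
    assume "\<not> ?R"
    then obtain \<eta> where "\<eta> > 0" and "\<forall>R. \<exists>\<epsilon> d. 0 < \<epsilon> \<and> \<epsilon> \<le> 1 \<and> 1 \<le> d \<and> \<epsilon> < e 0 d \<and>
      R \<le> 1 / \<epsilon> + real d \<and> \<not> ln (real (info_complexity e \<epsilon> d)) \<le> \<eta> * (1 / \<epsilon> + real d)"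
      by blast
    then have "\<forall>k::nat. \<exists>\<epsilon> d. 0 < \<epsilon> \<and> \<epsilon> \<le> 1 \<and> 1 \<le> d \<and> \<epsilon> < e 0 d \<and>
      real k \<le> 1 / \<epsilon> + real d \<and> \<not> ln (real (info_complexity e \<epsilon> d)) \<le> \<eta> * (1 / \<epsilon> + real d)"
      by blast
    then obtain \<epsilon> d where 1: "\<And>k. 0 < \<epsilon> k \<and> \<epsilon> k \<le> 1 \<and> 1 \<le> d k \<and> \<epsilon> k < e 0 (d k)"
      and 2: "\<And>k. real k \<le> 1 / \<epsilon> k + real (d k)"
      and 3: "\<And>k. \<not> ln (real (info_complexity e (\<epsilon> k) (d k))) \<le> \<eta> * (1 / \<epsilon> k + real (d k))"
      by metis
    have "filterlim (\<lambda>k. 1 / \<epsilon> k + real (d k)) at_top sequentially"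
      by (rule filterlim_at_top_mono[OF filterlim_real_sequentially]) (simp add: 2)
    with wt 1 have "(\<lambda>k. ln (real (info_complexity e (\<epsilon> k) (d k))) / (1 / \<epsilon> k + real (d k)))
        \<longlonglongrightarrow> 0"
      unfolding weakly_tractable_def by blast
    from order_tendstoD(2)[OF this \<open>\<eta> > 0\<close>]
    obtain k where k: "ln (real (info_complexity e (\<epsilon> k) (d k))) / (1 / \<epsilon> k + real (d k)) < \<eta>"
      by (auto simp: eventually_sequentially)
    have "0 < 1 / \<epsilon> k + real (d k)" using 1[of k] by (intro add_pos_nonneg) auto
    with k 3[of k] show False by (simp add: pos_divide_less_eq)
  qed
next
  assume R: ?R
  show "weakly_tractable e"
    unfolding weakly_tractable_def
  proof (intro allI impI)
    fix \<epsilon> :: "nat \<Rightarrow> real" and d :: "nat \<Rightarrow> nat"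
    assume "(\<forall>k. 0 < \<epsilon> k \<and> \<epsilon> k \<le> 1 \<and> 1 \<le> d k \<and> \<epsilon> k < e 0 (d k)) \<and>
      filterlim (\<lambda>k. 1 / \<epsilon> k + real (d k)) at_top sequentially"
    then have 1: "\<And>k. 0 < \<epsilon> k \<and> \<epsilon> k \<le> 1 \<and> 1 \<le> d k \<and> \<epsilon> k < e 0 (d k)"
      and 2: "filterlim (\<lambda>k. 1 / \<epsilon> k + real (d k)) at_top sequentially" by auto
    let ?q = "\<lambda>k. ln (real (info_complexity e (\<epsilon> k) (d k))) / (1 / \<epsilon> k + real (d k))"
    show "?q \<longlonglongrightarrow> 0"
    proof (rule LIMSEQ_I)
      fix \<rho> :: real assume "\<rho> > 0"
      then obtain R where R: "\<And>\<epsilon> d. 0 < \<epsilon> \<Longrightarrow> \<epsilon> \<le> 1 \<Longrightarrow> 1 \<le> d \<Longrightarrow> \<epsilon> < e 0 d \<Longrightarrow>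
          R \<le> 1 / \<epsilon> + real d \<Longrightarrow> ln (real (info_complexity e \<epsilon> d)) \<le> \<rho> / 2 * (1 / \<epsilon> + real d)"
        using R[rule_format, of "\<rho> / 2"] by auto
      obtain N where N: "\<And>k. k \<ge> N \<Longrightarrow> R \<le> 1 / \<epsilon> k + real (d k)"
        using 2 unfolding filterlim_at_top eventually_sequentially by blast
      have "norm (?q k - 0) < \<rho>" if "k \<ge> N" for k
      proof -
        have Y: "0 < 1 / \<epsilon> k + real (d k)" using 1[of k] by (intro add_pos_nonneg) auto
        have "0 \<le> ln (real (info_complexity e (\<epsilon> k) (d k)))"
          using pos[of "\<epsilon> k" "d k"] 1[of k] by (intro ln_ge_zero) auto
        moreover have "ln (real (info_complexity e (\<epsilon> k) (d k))) \<le> \<rho> / 2 * (1 / \<epsilon> k + real (d k))"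
          using R[of "\<epsilon> k" "d k"] N[OF that] 1[of k] by simp
        ultimately have "0 \<le> ?q k" "?q k \<le> \<rho> / 2" using Y by (simp_all add: pos_divide_le_eq)
        then show ?thesis using \<open>\<rho> > 0\<close> by (simp only: diff_zero real_norm_def abs_of_nonneg)
      qed
      then show "\<exists>no. \<forall>n\<ge>no. norm (?q n - 0) < \<rho>" by blast
    qed
  qed
qed

section \<open>The curse of dimensionality in terms of weights\<close>

text \<open>The Hilbert spaces disappear here: the complexity enters through the counting formula
  \<open>info\<close> alone.\<close>

locale product_problem = weights w for w :: "nat \<Rightarrow> real" +
  fixes e :: "nat \<Rightarrow> nat \<Rightarrow> real" and \<iota> :: "nat \<Rightarrow> real"
  assumes w2: "0 < w 2"
    and init: "\<And>d. e 0 d = \<iota> d"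
    and init_pos: "\<And>d. 1 \<le> d \<Longrightarrow> 0 < \<iota> d"
    and info: "\<And>\<epsilon> d. 0 < \<epsilon> \<Longrightarrow> 1 \<le> d \<Longrightarrow>
      info_complexity e \<epsilon> d = card (large_products w d ((\<epsilon> / \<iota> d)\<^sup>2))"
begin

lemma ratio:
  assumes "0 < \<epsilon>" "1 \<le> d"
  shows "0 < (\<epsilon> / \<iota> d)\<^sup>2" "\<epsilon> < \<iota> d \<Longrightarrow> (\<epsilon> / \<iota> d)\<^sup>2 < 1"
  using assms init_pos[of d] by (simp_all add: power_less_one_iff)

lemma weakly_tractable_iff':
  "weakly_tractable e \<longleftrightarrow> (\<forall>\<eta>>0. \<exists>R. \<forall>\<epsilon> d. 0 < \<epsilon> \<and> \<epsilon> \<le> 1 \<and> 1 \<le> d \<and> \<epsilon> < \<iota> d \<and>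
    R \<le> 1 / \<epsilon> + real d \<longrightarrow>
      ln (real (card (large_products w d ((\<epsilon> / \<iota> d)\<^sup>2)))) \<le> \<eta> * (1 / \<epsilon> + real d))"
proof -
  have "1 \<le> info_complexity e \<epsilon> d" if "0 < \<epsilon>" "1 \<le> d" "\<epsilon> < e 0 d" for \<epsilon> d
    using that card_large_products_pos[OF ratio[of \<epsilon> d]] by (simp add: info init)
  from weakly_tractable_iff[of e, OF this] show ?thesis
    by (simp add: init info cong: conj_cong imp_cong)
qed

text \<open>At \<epsilon> = 1 the threshold is below \<open>exp (- (2 * \<rho> * d))\<close>, which
  leaves room for k entries equal to 2, with k about \<open>\<kappa> * d\<close>, and hence for
  \<open>2 ^ k\<close> lists.\<close>

lemma curse_of_exponential_init:
  assumes "\<rho> > 0" "infinite {d. 1 \<le> d \<and> exp (\<rho> * real d) < \<iota> d}"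
  shows "curse_of_dimensionality e"
proof -
  define l where "l = - ln (w 2)"
  have "0 \<le> l" using w2 w_le_1[of 2] by (simp add: l_def)
  \<comment> \<open>An entry 2 costs \<open>l\<close> on the logarithmic scale, so the rate has to
    satisfy \<open>\<kappa> * l \<le> \<rho>\<close>. The summand 1 covers \<open>l = 0\<close>, and
    the minimum keeps k at most d.\<close>
  define \<kappa> where "\<kappa> = min 1 (\<rho> / (l + 1))"
  have \<kappa>: "0 < \<kappa>" "\<kappa> \<le> 1" "\<kappa> \<le> \<rho> / (l + 1)"
    using \<open>0 \<le> l\<close> \<open>\<rho> > 0\<close> by (auto simp: \<kappa>_def)
  then have "\<kappa> * (l + 1) \<le> \<rho>" using \<open>0 \<le> l\<close> by (simp add: pos_le_divide_eq)
  then have "\<kappa> * l \<le> \<rho>" using \<kappa>(1) by (simp add: algebra_simps)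
  \<comment> \<open>The factor \<open>1 / 2\<close> compensates for rounding
    \<open>\<kappa> * d\<close> down to k.\<close>
  have main: "1 / 2 * (1 + (2 powr \<kappa> - 1)) ^ d \<le> real (info_complexity e 1 d)"
    if d: "1 \<le> d" "exp (\<rho> * real d) < \<iota> d" for d
  proof -
    define k where "k = nat \<lfloor>\<kappa> * real d\<rfloor>"
    have k: "real k \<le> \<kappa> * real d" "\<kappa> * real d - 1 \<le> real k" using \<kappa> by (simp_all add: k_def)
    have "\<kappa> * real d \<le> real d" using \<kappa> by (simp add: mult_left_le_one_le)
    then have "k \<le> d" using k(1) by linarith
    have "(1 / \<iota> d)\<^sup>2 < (1 / exp (\<rho> * real d))\<^sup>2"
      using d(2) init_pos[OF d(1)] by (intro power_strict_mono divide_strict_left_mono) auto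
    also have "\<dots> = exp (- (2 * \<rho> * real d))"
      by (simp add: power_divide exp_minus inverse_eq_divide flip: exp_of_nat_mult)
    also have "\<dots> \<le> exp (- (real k * l))"
    proof -
      have "real k * l \<le> (\<kappa> * real d) * l" by (intro mult_right_mono k \<open>0 \<le> l\<close>)
      also have "\<dots> = (\<kappa> * l) * real d" by simp
      also have "\<dots> \<le> \<rho> * real d" by (intro mult_right_mono \<open>\<kappa> * l \<le> \<rho>\<close>) simp
      also have "\<dots> \<le> 2 * \<rho> * real d" using \<open>\<rho> > 0\<close> by simp
      finally show ?thesis by simp
    qed
    also have "\<dots> = w 2 ^ k" using w2 by (simp add: l_def exp_of_nat_mult)
    finally have "(1 / \<iota> d)\<^sup>2 < w 2 ^ k" .
    from card_large_products_ge_power[OF \<open>k \<le> d\<close> ratio(1)[OF _ d(1)] this]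
    have "2 ^ k \<le> info_complexity e 1 d" using d by (simp add: info)
    then have "2 ^ k \<le> real (info_complexity e 1 d)" by (metis of_nat_le_iff of_nat_numeral of_nat_power)
    moreover have "1 / 2 * (1 + (2 powr \<kappa> - 1)) ^ d \<le> (2::real) ^ k"
    proof -
      have "1 / 2 * (1 + (2 powr \<kappa> - 1)) ^ d = 2 powr (\<kappa> * real d - 1)"
        by (simp add: powr_diff powr_powr flip: powr_realpow)
      also have "\<dots> \<le> 2 powr real k" using k by (intro powr_mono) auto
      finally show ?thesis by (simp add: powr_realpow)
    qed
    ultimately show ?thesis by linarith
  qed
  have "{d. 1 \<le> d \<and> exp (\<rho> * real d) < \<iota> d} \<subseteq>
      {d. 1 \<le> d \<and> 1 / 2 * (1 + (2 powr \<kappa> - 1)) ^ d \<le> real (info_complexity e 1 d)}"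
    using main by blast
  then have "infinite {d. 1 \<le> d \<and> 1 / 2 * (1 + (2 powr \<kappa> - 1)) ^ d \<le> real (info_complexity e 1 d)}"
    using assms(2) finite_subset by blast
  moreover have "0 < 2 powr \<kappa> - (1::real)" using \<kappa> by simp
  ultimately show ?thesis unfolding curse_of_dimensionality_def
    by (intro exI[of _ 1] conjI exI[of _ "1 / 2"] exI[of _ "2 powr \<kappa> - 1"]) auto
qed

text \<open>A positive limsup, possibly infinite, leaves room for a finite rate \<rho> > 0 that is
  exceeded for infinitely many d.\<close>

lemma curse_of_limsup:
  assumes "limsup (\<lambda>d. ereal (1 / real d * ln (\<iota> d))) > 0"
  shows "curse_of_dimensionality e"
proof -
  obtain \<rho> where \<rho>: "0 < ereal \<rho>" "ereal \<rho> < limsup (\<lambda>d. ereal (1 / real d * ln (\<iota> d)))"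
    using ereal_dense2[OF assms] by blast
  have "infinite {d. ereal \<rho> < ereal (1 / real d * ln (\<iota> d))}"
  proof
    assume "finite {d. ereal \<rho> < ereal (1 / real d * ln (\<iota> d))}"
    then obtain N where N: "\<And>d. ereal \<rho> < ereal (1 / real d * ln (\<iota> d)) \<Longrightarrow> d < N"
      unfolding finite_nat_set_iff_bounded by blast
    then have "eventually (\<lambda>d. ereal (1 / real d * ln (\<iota> d)) \<le> ereal \<rho>) sequentially"
      unfolding eventually_sequentially by (meson not_le)
    then have "limsup (\<lambda>d. ereal (1 / real d * ln (\<iota> d))) \<le> ereal \<rho>" by (rule Limsup_bounded)
    with \<rho>(2) show False by simp
  qed
  then have inf: "infinite ({d. ereal \<rho> < ereal (1 / real d * ln (\<iota> d))} - {0})" by simp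
  have "{d. ereal \<rho> < ereal (1 / real d * ln (\<iota> d))} - {0} \<subseteq> {d. 1 \<le> d \<and> exp (\<rho> * real d) < \<iota> d}"
  proof
    fix d assume "d \<in> {d. ereal \<rho> < ereal (1 / real d * ln (\<iota> d))} - {0}"
    then have d: "1 \<le> d" "\<rho> < 1 / real d * ln (\<iota> d)" by auto
    then have "\<rho> * real d < ln (\<iota> d)" by (simp add: field_simps)
    then have "exp (\<rho> * real d) < exp (ln (\<iota> d))" by (simp only: exp_less_mono)
    then show "d \<in> {d. 1 \<le> d \<and> exp (\<rho> * real d) < \<iota> d}" using d(1) init_pos by simp
  qed
  then have "infinite {d. 1 \<le> d \<and> exp (\<rho> * real d) < \<iota> d}" using inf finite_subset by blast
  with \<rho>(1) show ?thesis by (intro curse_of_exponential_init) auto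
qed

lemma two_power_le_card:
  assumes "w 2 = 1" "0 < \<epsilon>" "1 \<le> d" "\<epsilon> < \<iota> d"
  shows "2 ^ d \<le> card (large_products w d ((\<epsilon> / \<iota> d)\<^sup>2))"
  using card_large_products_ge_power[of d d "(\<epsilon> / \<iota> d)\<^sup>2"] ratio[of \<epsilon> d] assms by simp

text \<open>At \<epsilon> = c / 2, which is below every initial error, all \<open>2 ^ d\<close>
  lists over 1 and 2 have product 1 and count.\<close>

lemma curse_of_multiple_top:
  assumes "w 2 = 1" "c > 0" "\<And>d. 1 \<le> d \<Longrightarrow> c \<le> \<iota> d"
  shows "curse_of_dimensionality e"
proof -
  have "1 * (1 + 1) ^ d \<le> real (info_complexity e (c / 2) d)" if "1 \<le> d" for d
  proof -
    have "2 ^ d \<le> info_complexity e (c / 2) d"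
      using two_power_le_card[of "c / 2" d] assms(1,2) assms(3)[OF that] that by (simp add: info)
    then have "real (2 ^ d) \<le> real (info_complexity e (c / 2) d)" by (simp only: of_nat_le_iff)
    then show ?thesis by simp
  qed
  then have "{d. 1 \<le> d \<and> 1 * (1 + 1) ^ d \<le> real (info_complexity e (c / 2) d)} = {1..}"
    by auto
  then have "infinite {d. 1 \<le> d \<and> 1 * (1 + 1) ^ d \<le> real (info_complexity e (c / 2) d)}"
    by (simp add: infinite_Ici)
  then show ?thesis unfolding curse_of_dimensionality_def using \<open>c > 0\<close>
    by (intro exI[of _ "c / 2"] conjI exI[of _ 1]) auto
qed

text \<open>For fixed \<epsilon> the initial error is below \<epsilon> for all large d, and then the
  complexity is 0.\<close>

lemma no_curse_of_vanishing_init: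
  assumes "\<iota> \<longlonglongrightarrow> 0"
  shows "\<not> curse_of_dimensionality e"
proof
  assume "curse_of_dimensionality e"
  then obtain \<epsilon> C \<gamma> where pos: "\<epsilon> > 0" "C > 0" "\<gamma> > 0"
    and inf: "infinite {d. 1 \<le> d \<and> real (info_complexity e \<epsilon> d) \<ge> C * (1 + \<gamma>) ^ d}"
    unfolding curse_of_dimensionality_def by blast
  obtain N where N: "\<And>d. d \<ge> N \<Longrightarrow> \<iota> d < \<epsilon>"
    using order_tendstoD(2)[OF assms \<open>\<epsilon> > 0\<close>] by (auto simp: eventually_sequentially)
  have "{d. 1 \<le> d \<and> real (info_complexity e \<epsilon> d) \<ge> C * (1 + \<gamma>) ^ d} \<subseteq> {..N}"
  proof
    fix d assume "d \<in> {d. 1 \<le> d \<and> real (info_complexity e \<epsilon> d) \<ge> C * (1 + \<gamma>) ^ d}"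
    then have d: "1 \<le> d" "C * (1 + \<gamma>) ^ d \<le> real (info_complexity e \<epsilon> d)" by auto
    show "d \<in> {..N}"
    proof (rule ccontr)
      assume "d \<notin> {..N}"
      then have "1 \<le> \<epsilon> / \<iota> d" using N[of d] init_pos[OF d(1)] by simp
      then have "1 \<le> (\<epsilon> / \<iota> d)\<^sup>2" by simp
      then have "info_complexity e \<epsilon> d = 0" using pos(1) d(1) by (simp add: info large_products_empty)
      moreover have "0 < C * (1 + \<gamma>) ^ d" using pos by simp
      ultimately show False using d(2) by simp
    qed
  qed
  with inf show False using finite_subset by blast
qed

section \<open>Necessary conditions for weak tractability\<close>

lemma weakly_tractable_imp_init_small:
  assumes wt: "weakly_tractable e" and "w 2 = 1" and lim: "\<iota> \<longlonglongrightarrow> 0"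
  shows "\<iota> \<in> o(\<lambda>d. 1 / real d)"
proof (rule landau_o.smallI)
  fix c :: real assume "c > 0"
  \<comment> \<open>At \<open>\<epsilon> = \<iota> d / 2\<close> tractability gives
    \<open>d * ln 2 \<le> \<eta> * (2 / \<iota> d + d)\<close>. The first bound on \<eta> lets half
    of the left side absorb \<open>\<eta> * d\<close>; the second then leaves
    \<open>\<iota> d * d \<le> c\<close>.\<close>
  define \<eta> where "\<eta> = min (ln 2 / 2) (c * ln 2 / 4)"
  have \<eta>: "\<eta> > 0" "\<eta> \<le> ln 2 / 2" "\<eta> \<le> c * ln 2 / 4" using \<open>c > 0\<close> by (auto simp: \<eta>_def)
  obtain R where R: "\<And>\<epsilon> d. 0 < \<epsilon> \<Longrightarrow> \<epsilon> \<le> 1 \<Longrightarrow> 1 \<le> d \<Longrightarrow> \<epsilon> < \<iota> d \<Longrightarrow> R \<le> 1 / \<epsilon> + real d \<Longrightarrow>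
      ln (real (card (large_products w d ((\<epsilon> / \<iota> d)\<^sup>2)))) \<le> \<eta> * (1 / \<epsilon> + real d)"
    using wt \<eta>(1) unfolding weakly_tractable_iff' by blast
  have "eventually (\<lambda>d. \<iota> d < 1) sequentially" using order_tendstoD(2)[OF lim, of 1] by simp
  moreover have "eventually (\<lambda>d. R \<le> real d) sequentially"
    using filterlim_real_sequentially unfolding filterlim_at_top by blast
  ultimately show "eventually (\<lambda>d. norm (\<iota> d) \<le> c * norm (1 / real d)) sequentially"
    using eventually_ge_at_top[of 1]
  proof eventually_elim
    case (elim d)
    define \<epsilon> where "\<epsilon> = \<iota> d / 2"
    have i: "0 < \<iota> d" by (rule init_pos[OF elim(3)])
    then have \<epsilon>: "0 < \<epsilon>" "\<epsilon> \<le> 1" "\<epsilon> < \<iota> d" using elim(1) by (auto simp: \<epsilon>_def)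
    have "real d * ln 2 = ln (real (2 ^ d))" by (simp add: ln_realpow)
    also have "\<dots> \<le> ln (real (card (large_products w d ((\<epsilon> / \<iota> d)\<^sup>2))))"
      using two_power_le_card[OF \<open>w 2 = 1\<close> \<epsilon>(1) elim(3) \<epsilon>(3)]
      by (intro ln_mono) (simp_all only: of_nat_le_iff, simp)
    also have "\<dots> \<le> \<eta> * (1 / \<epsilon> + real d)"
    proof (rule R[OF \<epsilon>(1,2) elim(3) \<epsilon>(3)])
      show "R \<le> 1 / \<epsilon> + real d" using elim(2) \<epsilon>(1) by (simp add: add_increasing)
    qed
    also have "\<dots> = \<eta> * (1 / \<epsilon>) + \<eta> * real d" by (simp add: distrib_left)
    also have "\<dots> \<le> (c * ln 2 / 4) * (1 / \<epsilon>) + (ln 2 / 2) * real d"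
      using \<eta> \<epsilon>(1) by (intro add_mono mult_right_mono) auto
    finally have "real d * ln 2 / 2 \<le> c * ln 2 / 2 / \<iota> d" using i by (simp add: \<epsilon>_def field_simps)
    then have "real d * ln 2 * \<iota> d \<le> c * ln 2" using i by (simp add: field_simps)
    then have "\<iota> d * real d \<le> c" by (simp add: mult_ac)
    then show ?case using i elim(3) by (simp add: field_simps)
  qed
qed

text \<open>For \<open>\<epsilon> = \<iota> d * sqrt (w n / 2)\<close> the threshold is
  \<open>w n / 2 < w n\<close>, so n is at most the complexity whatever d is. The hypothesis
  \<open>ex\<close> asks for a d that keeps \<open>1 / \<epsilon> + d\<close> within the order of
  \<open>w n powr (- 1 / q)\<close>.\<close>

lemma weakly_tractable_imp_decay:
  assumes wt: "weakly_tractable e" and "0 < q" and "0 < D"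
    and ex: "\<And>R. eventually (\<lambda>n. 0 < w n \<longrightarrow> (\<exists>d\<ge>1. \<iota> d * sqrt (w n / 2) \<le> 1 \<and>
      R \<le> 1 / (\<iota> d * sqrt (w n / 2)) + real d \<and>
      1 / (\<iota> d * sqrt (w n / 2)) + real d \<le> D * w n powr (- 1 / q))) sequentially"
  shows "w \<in> o(\<lambda>n. ln (real n) powr (- q))"
proof (rule landau_o.smallI)
  fix c :: real assume "c > 0"
  \<comment> \<open>With this value, \<open>ln n \<le> \<eta> * (D * w n powr (- 1 / q))\<close>
    solves to \<open>w n \<le> c * ln n powr (- q)\<close>.\<close>
  define \<eta> where "\<eta> = c powr (1 / q) / D"
  have "\<eta> > 0" using \<open>c > 0\<close> \<open>D > 0\<close> by (simp add: \<eta>_def)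
  obtain R where R: "\<And>\<epsilon> d. 0 < \<epsilon> \<Longrightarrow> \<epsilon> \<le> 1 \<Longrightarrow> 1 \<le> d \<Longrightarrow> \<epsilon> < \<iota> d \<Longrightarrow> R \<le> 1 / \<epsilon> + real d \<Longrightarrow>
      ln (real (card (large_products w d ((\<epsilon> / \<iota> d)\<^sup>2)))) \<le> \<eta> * (1 / \<epsilon> + real d)"
    using wt \<open>\<eta> > 0\<close> unfolding weakly_tractable_iff' by blast
  from ex[of R] eventually_ge_at_top[of 3]
  show "eventually (\<lambda>n. norm (w n) \<le> c * norm (ln (real n) powr (- q))) sequentially"
  proof eventually_elim
    case (elim n)
    then have n: "1 \<le> n" "0 \<le> w n" using w_nonneg[of n] by auto
    define l where "l = ln (real n)"
    have "l > 0" using elim by (simp add: l_def)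
    show ?case
    proof (cases "w n = 0")
      case True
      then show ?thesis using \<open>c > 0\<close> by simp
    next
      case False
      then have wn: "0 < w n" using n by simp
      then obtain d where d: "1 \<le> d" "\<iota> d * sqrt (w n / 2) \<le> 1"
        "R \<le> 1 / (\<iota> d * sqrt (w n / 2)) + real d"
        "1 / (\<iota> d * sqrt (w n / 2)) + real d \<le> D * w n powr (- 1 / q)"
        using elim by blast
      define \<epsilon> where "\<epsilon> = \<iota> d * sqrt (w n / 2)"
      have i: "0 < \<iota> d" by (rule init_pos[OF d(1)])
      have "0 < \<epsilon>" using i wn by (simp add: \<epsilon>_def)
      have "sqrt (w n / 2) < 1" using w_le_1[OF n(1)] by simp
      then have "\<epsilon> < \<iota> d" using i by (simp add: \<epsilon>_def)
      have t: "(\<epsilon> / \<iota> d)\<^sup>2 = w n / 2" using i wn by (simp add: \<epsilon>_def)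
      have "l \<le> ln (real (card (large_products w d ((\<epsilon> / \<iota> d)\<^sup>2))))"
        using card_large_products_ge_index[OF n(1) d(1), of "w n / 2"] wn n(1)
        unfolding t l_def by (intro ln_mono) auto
      also have "\<dots> \<le> \<eta> * (1 / \<epsilon> + real d)"
        by (rule R[OF \<open>0 < \<epsilon>\<close> _ d(1) \<open>\<epsilon> < \<iota> d\<close>]) (use d in \<open>simp_all add: \<epsilon>_def\<close>)
      also have "\<dots> \<le> \<eta> * (D * w n powr (- 1 / q))"
        using d(4) \<open>\<eta> > 0\<close> by (intro mult_left_mono) (simp_all add: \<epsilon>_def)
      also have "\<dots> = c powr (1 / q) * w n powr (- 1 / q)" using \<open>D > 0\<close> by (simp add: \<eta>_def)
      finally have "l \<le> c powr (1 / q) * w n powr (- 1 / q)" .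
      then have "l powr q \<le> (c powr (1 / q) * w n powr (- 1 / q)) powr q"
        using \<open>l > 0\<close> \<open>0 < q\<close> by (intro powr_mono2) auto
      also have "\<dots> = c / w n"
        using \<open>0 < q\<close> \<open>c > 0\<close> wn by (simp add: powr_mult powr_powr powr_minus_divide powr_divide)
      finally have "w n \<le> c * l powr (- q)"
        using wn \<open>l > 0\<close> by (simp add: powr_minus field_simps)
      then show ?thesis using n by (simp add: l_def)
    qed
  qed
qed

text \<open>The weights tend to 0, so their negative powers become large; the guard is there because
  0 raised to any power is 0 by convention.\<close>

lemma eventually_powr_ge:
  assumes "0 < q"
  shows "eventually (\<lambda>n. 0 < w n \<longrightarrow> B \<le> w n powr (- 1 / q)) sequentially"
proof -
  define B' where "B' = max B 1"
  have "eventually (\<lambda>n. w n < B' powr (- q)) sequentially"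
    using order_tendstoD(2)[OF w_lim, of "B' powr (- q)"] by (simp add: B'_def)
  then show ?thesis
  proof eventually_elim
    case (elim n)
    show ?case
    proof
      assume "0 < w n"
      have "B' = (B' powr (- q)) powr (- 1 / q)" using assms by (simp add: powr_powr B'_def)
      also have "\<dots> \<le> w n powr (- 1 / q)"
        using elim \<open>0 < w n\<close> assms by (intro powr_mono2') auto
      finally show "B \<le> w n powr (- 1 / q)" by (simp add: B'_def)
    qed
  qed
qed

lemma weakly_tractable_imp_decay_polynomial:
  assumes wt: "weakly_tractable e" and "0 \<le> \<alpha>" and c: "0 < c" "\<And>d. 1 \<le> d \<Longrightarrow> c * real d powr \<alpha> \<le> \<iota> d"
    and C: "0 < C" "\<And>d. 1 \<le> d \<Longrightarrow> \<iota> d \<le> C * real d powr \<alpha>"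
  shows "w \<in> o(\<lambda>n. ln (real n) powr (- (2 * (1 + \<alpha>))))"
proof (rule weakly_tractable_imp_decay[OF wt, where D = "2 / c + 2"])
  let ?q = "2 * (1 + \<alpha>)"
  show q: "0 < ?q" using \<open>0 \<le> \<alpha>\<close> by simp
  show "0 < 2 / c + 2" using c(1) by (simp add: add_pos_pos)
  fix R :: real
  from eventually_powr_ge[OF q, of "max R (max 1 (C * 2 powr \<alpha>))"] eventually_ge_at_top[of 1]
  show "eventually (\<lambda>n. 0 < w n \<longrightarrow> (\<exists>d\<ge>1. \<iota> d * sqrt (w n / 2) \<le> 1 \<and>
      R \<le> 1 / (\<iota> d * sqrt (w n / 2)) + real d \<and>
      1 / (\<iota> d * sqrt (w n / 2)) + real d \<le> (2 / c + 2) * w n powr (- 1 / ?q))) sequentially"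
  proof eventually_elim
    case (elim n)
    show ?case
    proof
      assume wn: "0 < w n"
      define X where "X = w n powr (- 1 / ?q)"
      have X: "R \<le> X" "1 \<le> X" "C * 2 powr \<alpha> \<le> X" using elim wn by (auto simp: X_def)
      \<comment> \<open>As \<open>sqrt (w n) = X powr (- (1 + \<alpha>))\<close>, this d makes
        \<epsilon> comparable to \<open>1 / X\<close>: at least \<open>c / (2 * X)\<close>, and at
        most 1 since \<open>C * 2 powr \<alpha> \<le> X\<close>. With \<open>d \<le> 2 * X\<close>
        this explains the constant \<open>2 / c + 2\<close>.\<close>
      define d where "d = nat \<lceil>X\<rceil>"
      have d: "X \<le> real d" "real d \<le> 2 * X" "1 \<le> d"
        using X(2) by (auto simp: d_def) linarith+
      have "(- 1 / ?q) * (- (1 + \<alpha>)) = 1 / 2" using \<open>0 \<le> \<alpha>\<close> by (simp add: field_simps)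
      then have sw: "sqrt (w n) = X powr (- (1 + \<alpha>))"
        using wn by (simp only: X_def powr_powr powr_half_sqrt less_imp_le)
      have sle: "sqrt (w n / 2) \<le> sqrt (w n)" using wn by simp
      have sge: "sqrt (w n) / 2 \<le> sqrt (w n / 2)"
        using wn by (intro real_le_rsqrt) (simp add: power_divide)
      let ?\<epsilon> = "\<iota> d * sqrt (w n / 2)"
      have i: "0 < \<iota> d" by (rule init_pos[OF d(3)])
      then have \<epsilon>0: "0 < ?\<epsilon>" using wn by simp
      have "?\<epsilon> \<le> (C * real d powr \<alpha>) * sqrt (w n)"
        using C i wn d(3) sle by (intro mult_mono) auto
      also have "\<dots> \<le> (C * (2 * X) powr \<alpha>) * sqrt (w n)"
        using C(1) d X \<open>0 \<le> \<alpha>\<close> wn by (intro mult_right_mono mult_left_mono powr_mono2) auto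
      also have "\<dots> = C * 2 powr \<alpha> * (X powr \<alpha> * X powr (- (1 + \<alpha>)))"
        using X(2) by (simp add: powr_mult sw)
      also have "X powr \<alpha> * X powr (- (1 + \<alpha>)) = 1 / X"
        using X(2) by (simp add: powr_add[symmetric] powr_minus_divide)
      also have "C * 2 powr \<alpha> * (1 / X) \<le> 1" using X by simp
      finally have 1: "?\<epsilon> \<le> 1" .
      have "c * (1 / X) / 2 = c * (X powr \<alpha> * X powr (- (1 + \<alpha>))) / 2"
        using X(2) by (simp add: powr_add[symmetric] powr_minus_divide)
      also have "\<dots> = (c * X powr \<alpha>) * (sqrt (w n) / 2)" by (simp add: sw)
      also have "\<dots> \<le> (c * real d powr \<alpha>) * (sqrt (w n) / 2)"
        using c(1) d X \<open>0 \<le> \<alpha>\<close> wn by (intro mult_right_mono mult_left_mono powr_mono2) auto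
      also have "\<dots> \<le> ?\<epsilon>" using c d(3) i wn sge by (intro mult_mono) auto
      finally have "c / (2 * X) \<le> ?\<epsilon>" by simp
      then have "1 / ?\<epsilon> \<le> 1 / (c / (2 * X))" using c(1) X(2) i wn by (intro divide_left_mono) auto
      then have "1 / ?\<epsilon> \<le> 2 / c * X" by simp
      then have 2: "1 / ?\<epsilon> + real d \<le> (2 / c + 2) * X" using d(2) by (simp add: distrib_right)
      have "0 < 1 / ?\<epsilon>" using \<epsilon>0 by simp
      then have 3: "R \<le> 1 / ?\<epsilon> + real d" using X(1) d(1) by linarith
      show "\<exists>d\<ge>1. \<iota> d * sqrt (w n / 2) \<le> 1 \<and>
        R \<le> 1 / (\<iota> d * sqrt (w n / 2)) + real d \<and>
        1 / (\<iota> d * sqrt (w n / 2)) + real d \<le> (2 / c + 2) * w n powr (- 1 / ?q)"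
        using 1 2 3 d(3) unfolding X_def by blast
    qed
  qed
qed

text \<open>Already d = 1 forces this decay: there \<open>1 / \<epsilon>\<close> is of the order
  \<open>w n powr (- 1 / 2)\<close>, and \<epsilon> drops below 1 for large n because w tends to
  0.\<close>

lemma weakly_tractable_imp_decay_univariate:
  assumes wt: "weakly_tractable e"
  shows "w \<in> o(\<lambda>n. ln (real n) powr (- 2))"
proof (rule weakly_tractable_imp_decay[OF wt, where D = "2 / \<iota> 1 + 1"])
  have i: "0 < \<iota> 1" by (rule init_pos) simp
  show "0 < 2 / \<iota> 1 + 1" using i by (simp add: add_pos_pos)
  fix R :: real
  have "eventually (\<lambda>n. 0 < w n \<longrightarrow> max 1 (max (\<iota> 1) (R * \<iota> 1)) \<le> w n powr (- 1 / 2)) sequentially"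
    by (rule eventually_powr_ge) simp
  then show "eventually (\<lambda>n. 0 < w n \<longrightarrow> (\<exists>d\<ge>1. \<iota> d * sqrt (w n / 2) \<le> 1 \<and>
      R \<le> 1 / (\<iota> d * sqrt (w n / 2)) + real d \<and>
      1 / (\<iota> d * sqrt (w n / 2)) + real d \<le> (2 / \<iota> 1 + 1) * w n powr (- 1 / 2))) sequentially"
  proof eventually_elim
    case (elim n)
    show ?case
    proof
      assume wn: "0 < w n"
      define X where "X = w n powr (- 1 / 2)"
      have X: "1 \<le> X" "\<iota> 1 \<le> X" "R * \<iota> 1 \<le> X" using elim wn by (auto simp: X_def)
      have sw: "sqrt (w n) = 1 / X"
        using wn by (simp add: X_def powr_minus_divide powr_half_sqrt)
      have sle: "sqrt (w n / 2) \<le> sqrt (w n)" using wn by simp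
      have sge: "sqrt (w n) / 2 \<le> sqrt (w n / 2)"
        using wn by (intro real_le_rsqrt) (simp add: power_divide)
      let ?\<epsilon> = "\<iota> 1 * sqrt (w n / 2)"
      have \<epsilon>0: "0 < ?\<epsilon>" using wn i by simp
      have le: "?\<epsilon> \<le> \<iota> 1 / X" using mult_left_mono[OF sle, of "\<iota> 1"] i sw by simp
      then have 1: "?\<epsilon> \<le> 1" using X(1,2) i by (rule_tac order_trans[OF le]) simp
      have "\<iota> 1 / (2 * X) \<le> ?\<epsilon>" using mult_left_mono[OF sge, of "\<iota> 1"] i sw by simp
      then have "1 / ?\<epsilon> \<le> 1 / (\<iota> 1 / (2 * X))" using i X(1) wn by (intro divide_left_mono) auto
      then have "1 / ?\<epsilon> \<le> 2 / \<iota> 1 * X" by simp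
      then have 2: "1 / ?\<epsilon> + real 1 \<le> (2 / \<iota> 1 + 1) * X" using X(1) by (simp add: distrib_right)
      have "R \<le> X / \<iota> 1" using X(3) i by (simp add: pos_le_divide_eq)
      also have "\<dots> = 1 / (\<iota> 1 / X)" by simp
      also have "\<dots> \<le> 1 / ?\<epsilon>" using le \<epsilon>0 i X(1) by (intro divide_left_mono) auto
      finally have 3: "R \<le> 1 / ?\<epsilon> + real 1" by simp
      show "\<exists>d\<ge>1. \<iota> d * sqrt (w n / 2) \<le> 1 \<and>
        R \<le> 1 / (\<iota> d * sqrt (w n / 2)) + real d \<and>
        1 / (\<iota> d * sqrt (w n / 2)) + real d \<le> (2 / \<iota> 1 + 1) * w n powr (- 1 / 2)"
        using 1 2 3 unfolding X_def by blast
    qed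
  qed
qed simp

section \<open>Sufficient conditions for weak tractability\<close>

text \<open>With \<open>z = \<iota> d / \<epsilon>\<close> and \<open>x = z powr (1 / q)\<close>, up
  to constants the logarithm of \<open>count_above t\<close> is at most a small multiple of
  \<open>x\<^sup>2\<close>, and that of \<open>count_above (sqrt t)\<close> a small multiple of x,
  while \<open>x\<^sup>2\<close> is at most a constant times \<open>1 / \<epsilon> + d\<close>. The
  hypothesis \<open>mult\<close> controls the lists over the r weights equal to 1.\<close>

lemma weakly_tractable_of_decay:
  assumes "0 \<le> \<alpha>" and C: "1 \<le> C" "\<And>d. 1 \<le> d \<Longrightarrow> \<iota> d \<le> C * real d powr \<alpha>"
    and small: "w \<in> o(\<lambda>n. ln (real n) powr (- (2 * (1 + \<alpha>))))"
    and r: "1 \<le> r" "w r = 1" "w (Suc r) < 1"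
    and mult: "\<And>\<eta>. 0 < \<eta> \<Longrightarrow> \<exists>c. \<forall>d\<ge>1. real d * ln (real r) \<le> c + \<eta> / \<iota> d"
  shows "weakly_tractable e"
  unfolding weakly_tractable_iff'
proof (intro allI impI)
  fix \<eta> :: real assume "0 < \<eta>"
  \<comment> \<open>The maximum with \<open>1 / 2\<close> keeps \<beta> positive in case all further
    weights are 0.\<close>
  define \<beta> where "\<beta> = max (w (Suc r)) (1 / 2)"
  have \<beta>: "0 < \<beta>" "\<beta> < 1" using r(3) by (auto simp: \<beta>_def)
  have w\<beta>: "w m \<le> \<beta>" if "r < m" for m
    using w_mono[of "Suc r" m] that by (simp add: \<beta>_def)
  define b where "b = ln (1 / \<beta>)"
  have "0 < b" using \<beta> by (simp add: b_def)
  define q where "q = 2 * (1 + \<alpha>)"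
  have "0 < q" using \<open>0 \<le> \<alpha>\<close> by (simp add: q_def)
  define g where "g = 2 / b"
  have "0 < g" using \<open>0 < b\<close> by (simp add: g_def)
  define A where "A = g * q"
  have "0 < A" using \<open>0 < g\<close> \<open>0 < q\<close> by (simp add: A_def)
  define D where "D = C powr (2 / q)"
  have "0 < D" using C(1) by (simp add: D_def)
  \<comment> \<open>Makes the terms carrying \<eta>1 add up to at most
    \<open>\<eta>1 * (1 + A) * (D * Y) = \<eta> / 4 * Y\<close>.\<close>
  define \<eta>1 where "\<eta>1 = \<eta> / (4 * (1 + A) * D)"
  have "0 < \<eta>1" using \<open>0 < A\<close> \<open>0 < D\<close> \<open>0 < \<eta>\<close> by (simp add: \<eta>1_def)
  obtain c1 where c1: "0 \<le> c1"
      "\<And>u. 0 < u \<Longrightarrow> u < 1 \<Longrightarrow> ln (real (count_above u)) \<le> c1 + \<eta>1 * u powr (- 1 / q)"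
    using ln_count_above_bound[OF \<open>0 < q\<close> small[folded q_def] \<open>0 < \<eta>1\<close>] by blast
  obtain c2 where c2: "\<And>d. 1 \<le> d \<Longrightarrow> real d * ln (real r) \<le> c2 + \<eta> / 4 / \<iota> d"
    using mult[of "\<eta> / 4"] \<open>0 < \<eta>\<close> by auto
  \<comment> \<open>These are the coefficients of 1, \<open>ln Y\<close> and
    \<open>(ln Y)\<^sup>2\<close> that remain in the final expansion.\<close>
  define k0 where "k0 = c2 + c1 + g * ln C * c1"
  define k1 where "k1 = 1 + g * (ln C + (1 + \<alpha>) * c1)"
  define k2 where "k2 = g * (1 + \<alpha>)"
  obtain R where R: "\<And>Y. Y \<ge> R \<Longrightarrow> k0 + k1 * ln Y + k2 * (ln Y)\<^sup>2 \<le> \<eta> / 2 * Y"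
    using sublinear_bound[of "\<eta> / 2" k0 k1 k2] \<open>0 < \<eta>\<close> by (auto simp: eventually_at_top_linorder)
  show "\<exists>R. \<forall>\<epsilon> d. 0 < \<epsilon> \<and> \<epsilon> \<le> 1 \<and> 1 \<le> d \<and> \<epsilon> < \<iota> d \<and> R \<le> 1 / \<epsilon> + real d \<longrightarrow>
      ln (real (card (large_products w d ((\<epsilon> / \<iota> d)\<^sup>2)))) \<le> \<eta> * (1 / \<epsilon> + real d)"
  proof (intro exI[of _ R] allI impI)
    fix \<epsilon> d assume "0 < \<epsilon> \<and> \<epsilon> \<le> 1 \<and> 1 \<le> d \<and> \<epsilon> < \<iota> d \<and> R \<le> 1 / \<epsilon> + real d"
    then have \<epsilon>: "0 < \<epsilon>" "\<epsilon> \<le> 1" "1 \<le> d" "\<epsilon> < \<iota> d" "R \<le> 1 / \<epsilon> + real d" by auto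
    define Y where "Y = 1 / \<epsilon> + real d"
    have Y: "real d \<le> Y" "1 / \<epsilon> \<le> Y" "1 \<le> Y" using \<epsilon> by (simp_all add: Y_def add_increasing)
    define t where "t = (\<epsilon> / \<iota> d)\<^sup>2"
    have t: "0 < t" "t < 1" using ratio[OF \<epsilon>(1,3)] \<epsilon>(4) by (auto simp: t_def)
    define z where "z = \<iota> d / \<epsilon>"
    have "1 < z" using \<epsilon> by (simp add: z_def)
    have "t = (1 / z)\<^sup>2" by (simp add: t_def z_def)
    moreover have "z powr 2 = z\<^sup>2" using \<open>1 < z\<close> by simp
    ultimately have tz: "t = z powr (- 2)" "sqrt t = z powr (- 1)"
      using \<open>1 < z\<close> by (simp_all add: powr_minus_divide power_divide real_sqrt_divide)
    define x where "x = z powr (1 / q)"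
    have "0 < x" using \<open>1 < z\<close> by (simp add: x_def)
    have "x powr 2 = x\<^sup>2" using \<open>0 < x\<close> by simp
    then have xz: "x\<^sup>2 = z powr (2 / q)" by (simp add: x_def powr_powr)
    have tx: "t powr (- 1 / q) = x\<^sup>2" "sqrt t powr (- 1 / q) = x"
      by (simp only: tz xz powr_powr, simp, simp only: tz(2) x_def powr_powr, simp)
    have lnz: "ln z = q * ln x" using \<open>1 < z\<close> \<open>0 < q\<close> by (simp add: x_def ln_powr)
    define a where "a = ln (1 / t) / b"
    have a: "a = g * ln z" using \<open>1 < z\<close> by (simp add: a_def g_def tz ln_div ln_powr)
    have "0 \<le> a" using \<open>1 < z\<close> \<open>0 < g\<close> by (simp add: a)
    \<comment> \<open>The factor a is logarithmic in x, hence at most \<open>A * x\<close>. As it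
      multiplies only \<open>\<eta>1 * x\<close> from \<open>count_above (sqrt t)\<close>, the
      product stays of order \<open>x\<^sup>2\<close>.\<close>
    have "ln x \<le> x" using \<open>0 < x\<close> ln_le_minus_one[of x] by linarith
    then have "g * (q * ln x) \<le> g * (q * x)"
      using \<open>0 < q\<close> \<open>0 < g\<close> by (intro mult_left_mono) auto
    then have ax: "a \<le> A * x" by (simp add: a lnz A_def)
    have z_le: "z \<le> C * Y powr (1 + \<alpha>)"
    proof -
      have "z = \<iota> d * (1 / \<epsilon>)" by (simp add: z_def)
      also have "\<dots> \<le> (C * real d powr \<alpha>) * Y"
        using C(1) C(2)[OF \<epsilon>(3)] Y \<epsilon> by (intro mult_mono) auto
      also have "\<dots> \<le> (C * Y powr \<alpha>) * Y"
        using C(1) Y \<open>0 \<le> \<alpha>\<close> by (intro mult_right_mono mult_left_mono powr_mono2) auto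
      also have "\<dots> = C * Y powr (1 + \<alpha>)" using Y(3) by (simp add: powr_add)
      finally show ?thesis .
    qed
    have "ln z \<le> ln (C * Y powr (1 + \<alpha>))" using z_le \<open>1 < z\<close> by (intro ln_mono) auto
    also have "\<dots> = ln C + (1 + \<alpha>) * ln Y" using C(1) Y(3) by (simp add: ln_mult ln_powr)
    finally have aY: "a \<le> g * (ln C + (1 + \<alpha>) * ln Y)"
      unfolding a using \<open>0 < g\<close> by (intro mult_left_mono) auto
    \<comment> \<open>The value of q enters here: raising \<open>Y powr (1 + \<alpha>)\<close> to
      the power \<open>2 / q\<close> gives exactly Y.\<close>
    have xY: "x\<^sup>2 \<le> D * Y"
    proof -
      have "z powr (2 / q) \<le> (C * Y powr (1 + \<alpha>)) powr (2 / q)"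
        using z_le \<open>1 < z\<close> \<open>0 < q\<close> by (intro powr_mono2) auto
      also have "\<dots> = D * Y"
      proof -
        have "(1 + \<alpha>) * (2 / q) = 1" using \<open>0 \<le> \<alpha>\<close> by (simp add: q_def)
        then have "(Y powr (1 + \<alpha>)) powr (2 / q) = Y" using Y(3) by (simp only: powr_powr) simp
        then show ?thesis using C(1) by (simp add: powr_mult D_def)
      qed
      finally show ?thesis by (simp only: xz)
    qed
    have lnY: "ln (real d) \<le> ln Y" "0 \<le> ln Y" using \<epsilon>(3) Y by auto
    have n: "ln (real (count_above t)) \<le> c1 + \<eta>1 * x\<^sup>2" using c1(2)[OF t] by (simp only: tx)
    have n': "ln (real (count_above (sqrt t))) \<le> c1 + \<eta>1 * x"
      using c1(2)[of "sqrt t"] t by (simp only: tx) simp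
    have "ln (real (card (large_products w d t))) \<le> real d * ln (real r) + ln (real d)
        + ln (real (count_above t)) + a * (ln (real d) + ln (real (count_above (sqrt t))))"
      unfolding a_def b_def by (rule ln_card_large_products_le[OF t r(1,2) \<beta> w\<beta> \<epsilon>(3)])
    also have "\<dots> \<le> (c2 + \<eta> / 4 * Y) + ln Y + (c1 + \<eta>1 * x\<^sup>2) + a * (ln Y + (c1 + \<eta>1 * x))"
    proof (intro add_mono mult_left_mono lnY n n' \<open>0 \<le> a\<close>)
      have "1 / \<iota> d \<le> 1 / \<epsilon>" using \<epsilon> by (intro divide_left_mono) auto
      then have "1 / \<iota> d \<le> Y" using Y(2) by linarith
      then have "\<eta> / 4 * (1 / \<iota> d) \<le> \<eta> / 4 * Y" using \<open>0 < \<eta>\<close> by (intro mult_left_mono) auto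
      then show "real d * ln (real r) \<le> c2 + \<eta> / 4 * Y" using c2[OF \<epsilon>(3)] by simp
    qed
    also have "\<dots> = c2 + c1 + ln Y + \<eta> / 4 * Y + \<eta>1 * x\<^sup>2 + a * (ln Y + c1) + \<eta>1 * (a * x)"
      by (simp add: algebra_simps)
    \<comment> \<open>The factor a is estimated in two ways: by a logarithm of Y where it meets
      logarithmic terms, and by \<open>A * x\<close> where it meets x.\<close>
    also have "\<dots> \<le> c2 + c1 + ln Y + \<eta> / 4 * Y + \<eta>1 * x\<^sup>2
        + g * (ln C + (1 + \<alpha>) * ln Y) * (ln Y + c1) + \<eta>1 * (A * x * x)"
      using \<open>0 < \<eta>1\<close> \<open>0 < x\<close> c1(1) lnY(2) ax aY
      by (intro add_mono mult_left_mono mult_right_mono order_refl) auto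
    also have "\<dots> = k0 + k1 * ln Y + k2 * (ln Y)\<^sup>2 + \<eta> / 4 * Y + \<eta>1 * (1 + A) * x\<^sup>2"
      by (simp add: k0_def k1_def k2_def power2_eq_square algebra_simps)
    also have "\<dots> \<le> \<eta> / 2 * Y + \<eta> / 4 * Y + \<eta>1 * (1 + A) * (D * Y)"
      using R[of Y] \<epsilon>(5) \<open>0 < \<eta>1\<close> \<open>0 < A\<close> xY
      by (intro add_mono mult_left_mono order_refl) (auto simp: Y_def)
    also have "\<eta>1 * (1 + A) * (D * Y) = \<eta> / 4 * Y"
    proof -
      have "\<eta>1 * (4 * (1 + A) * D) = \<eta>" using \<open>0 < A\<close> \<open>0 < D\<close> by (simp add: \<eta>1_def)
      moreover have "\<eta>1 * (1 + A) * (D * Y) = \<eta>1 * (4 * (1 + A) * D) * Y / 4" by simp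
      ultimately show ?thesis by (simp only:)
    qed
    finally show "ln (real (card (large_products w d ((\<epsilon> / \<iota> d)\<^sup>2)))) \<le> \<eta> * (1 / \<epsilon> + real d)"
      by (simp add: t_def Y_def)
  qed
qed

text \<open>Here r = 1, and the single list of weights equal to 1 contributes
  \<open>d * ln 1 = 0\<close>.\<close>

lemma weakly_tractable_of_decay_simple_top:
  assumes "0 \<le> \<alpha>" "1 \<le> C" "\<And>d. 1 \<le> d \<Longrightarrow> \<iota> d \<le> C * real d powr \<alpha>"
    and "w \<in> o(\<lambda>n. ln (real n) powr (- (2 * (1 + \<alpha>))))" "w 2 < 1"
  shows "weakly_tractable e"
proof (rule weakly_tractable_of_decay[OF assms(1-4), of 1])
  show "\<exists>c. \<forall>d\<ge>1. real d * ln (real 1) \<le> c + \<eta> / \<iota> d" if "0 < \<eta>" for \<eta>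
    using that init_pos by (intro exI[of _ 0]) (auto simp: less_imp_le)
qed (use w1 assms(5) in \<open>simp_all add: numeral_2_eq_2\<close>)

text \<open>The multiplicity r of the weight 1 is finite because w tends to 0. The
  \<open>r ^ d\<close> lists of weight 1 contribute \<open>d * ln r\<close>, and the decay of
  \<iota> turns this into a small multiple of \<open>1 / \<iota> d\<close> plus a constant.\<close>

lemma weakly_tractable_of_decay_multiple_top:
  assumes C: "1 \<le> C" "\<And>d. 1 \<le> d \<Longrightarrow> \<iota> d \<le> C"
    and small: "w \<in> o(\<lambda>n. ln (real n) powr (- 2))" and init_small: "\<iota> \<in> o(\<lambda>d. 1 / real d)"
  shows "weakly_tractable e"
proof -
  obtain r where r: "1 \<le> r" "w r = 1" "w (Suc r) < 1"
  proof -
    obtain N where N: "\<And>n. n \<ge> N \<Longrightarrow> w n < 1"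
      using order_tendstoD(2)[OF w_lim, of 1] by (auto simp: eventually_sequentially)
    define n where "n = (LEAST n. 1 \<le> n \<and> w n < 1)"
    have n: "1 \<le> n" "w n < 1"
      unfolding n_def using LeastI[of "\<lambda>n. 1 \<le> n \<and> w n < 1" "Suc N"] N[of "Suc N"] by auto
    have "n \<noteq> 1" using n w1 by auto
    then have n2: "2 \<le> n" using n by simp
    then have "\<not> (1 \<le> n - 1 \<and> w (n - 1) < 1)"
      unfolding n_def by (intro not_less_Least) simp
    moreover have "1 \<le> n - 1" "Suc (n - 1) = n" using n2 by auto
    ultimately show ?thesis using that[of "n - 1"] n(2) w_le_1[of "n - 1"] by auto
  qed
  show ?thesis
  proof (rule weakly_tractable_of_decay[of 0 C r])
    fix \<eta> :: real assume "0 < \<eta>"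
    \<comment> \<open>The summand 1 covers r = 1, where the logarithm vanishes.\<close>
    define \<eta>' where "\<eta>' = \<eta> / (ln (real r) + 1)"
    have "0 \<le> ln (real r)" using r(1) by simp
    then have "0 < \<eta>'" using \<open>0 < \<eta>\<close> by (simp add: \<eta>'_def)
    then obtain N where N: "\<And>d. d \<ge> N \<Longrightarrow> norm (\<iota> d) \<le> \<eta>' * norm (1 / real d)"
      using landau_o.smallD[OF init_small] unfolding eventually_sequentially by blast
    have "real d * ln (real r) \<le> real N * ln (real r) + \<eta> / \<iota> d" if "1 \<le> d" for d
    proof (cases "d \<ge> N")
      case True
      have i: "0 < \<iota> d" by (rule init_pos[OF that])
      then have "\<iota> d \<le> \<eta>' / real d" using N[OF True] that by simp
      then have "real d \<le> \<eta>' / \<iota> d" using i that by (simp add: field_simps)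
      then have "real d * ln (real r) \<le> \<eta>' / \<iota> d * (ln (real r) + 1)"
        using \<open>0 \<le> ln (real r)\<close> by (intro mult_mono) auto
      also have "\<dots> = \<eta> / \<iota> d" using \<open>0 \<le> ln (real r)\<close> by (simp add: \<eta>'_def)
      finally show ?thesis using \<open>0 \<le> ln (real r)\<close> by (simp add: add_increasing)
    next
      case False
      then have "real d * ln (real r) \<le> real N * ln (real r)"
        using \<open>0 \<le> ln (real r)\<close> by (intro mult_right_mono) auto
      moreover have "0 \<le> \<eta> / \<iota> d" using init_pos[OF that] \<open>0 < \<eta>\<close> by simp
      ultimately show ?thesis by linarith
    qed
    then show "\<exists>c. \<forall>d\<ge>1. real d * ln (real r) \<le> c + \<eta> / \<iota> d" by blast
  qed (use r C small in auto)
qed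

end

section \<open>From the operators to the weights, and the three cases\<close>

theorem theorem2:
  fixes S1 :: "'h::{real_inner, complete_space} \<Rightarrow> 'g::{real_inner, complete_space}"
    and lam :: "nat \<Rightarrow> real"
    and \<tau>H :: "'h list \<Rightarrow> 'a::{real_inner, complete_space}"
    and \<tau>G :: "'g list \<Rightarrow> 'b::{real_inner, complete_space}"
    and S :: "nat \<Rightarrow> 'a \<Rightarrow> 'b"
    and s :: "nat \<Rightarrow> real"
  assumes compact: "compact_operator S1"
    and lam: "eigenvalue_sequence (adjoint S1 \<circ> S1) lam"
    and lam2: "lam 2 > 0"
    and \<tau>H: "elementary_tensors \<tau>H"
    and \<tau>G: "elementary_tensors \<tau>G"
    and S: "\<forall>d\<ge>1. tensor_power_operator \<tau>H \<tau>G S1 d (S d)"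
    and s: "\<forall>d\<ge>1. s d > 0"
  defines "e \<equiv> scaled_problem_error \<tau>H \<tau>G S s"
  defines "init \<equiv> (\<lambda>d. e 0 d)"
  shows "(\<forall>d\<ge>1. init d = sqrt (s d * lam 1 ^ d)) \<and>
    (limsup (\<lambda>d. ereal (1 / real d * ln (init d))) > 0 \<longrightarrow> curse_of_dimensionality e) \<and>
    (\<forall>\<alpha>\<ge>0. init \<in> \<Theta>(\<lambda>d. real d powr \<alpha>) \<longrightarrow>
       (lam 1 = lam 2 \<longrightarrow> curse_of_dimensionality e) \<and>
       (lam 1 > lam 2 \<longrightarrow>
          (weakly_tractable e \<longleftrightarrow> lam \<in> o(\<lambda>n. ln (real n) powr (- 2 * (1 + \<alpha>)))))) \<and>
    (init \<longlonglongrightarrow> 0 \<longrightarrow>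
       \<not> curse_of_dimensionality e \<and>
       (weakly_tractable e \<longleftrightarrow>
          (lam 1 = lam 2 \<and> lam \<in> o(\<lambda>n. ln (real n) powr (- 2)) \<and> init \<in> o(\<lambda>d. 1 / real d)) \<or>
          (lam 1 > lam 2 \<and> lam \<in> o(\<lambda>n. ln (real n) powr (- 2)))))"
proof -
  let ?M = "{m. 1 \<le> m \<and> 0 < lam m}"
  note svd = compact_op.singular_value_decomposition[OF compact_op.intro[OF compact] lam]
  note lim = svd(2)
  from svd(1) obtain u where
    u: "\<forall>m\<in>?M. \<forall>n\<in>?M. u m \<bullet> u n = (if m = n then 1 else 0)"
      "\<forall>m\<in>?M. \<forall>x. S1 x \<bullet> S1 (u m) = lam m * (x \<bullet> u m)"
      "\<forall>k x. (\<forall>m\<in>?M. m \<le> k \<longrightarrow> x \<bullet> u m = 0) \<longrightarrow>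
          (norm (S1 x))\<^sup>2 \<le> lam (Suc k) * (norm x)\<^sup>2"
    by (elim exE conjE)
  have nonneg: "0 \<le> lam m" if "1 \<le> m" for m
    using lam that unfolding eigenvalue_sequence_def by blast
  have mono: "lam n \<le> lam m" if "1 \<le> m" "m \<le> n" for m n
    using lam that unfolding eigenvalue_sequence_def by blast
  have lam1: "0 < lam 1" and lam21: "lam 2 \<le> lam 1" using mono[of 1 2] lam2 by auto
  have tensor: "tensor_svd S1 lam u \<tau>H \<tau>G (S d) d (s d) ?M" if "1 \<le> d" for d
  proof (rule tensor_svd.intro)
    show "bounded_linear S1" by (rule compact_operator_bounded_linear[OF compact])
    show "tensor_power_operator \<tau>H \<tau>G S1 d (S d)" "0 < s d" using S s that by auto
      show "u m \<bullet> u n = (if m = n then 1 else 0)" if "m \<in> ?M" "n \<in> ?M" for m n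
      by (rule u(1)[rule_format, OF that])
    show "S1 x \<bullet> S1 (u m) = lam m * (x \<bullet> u m)" if "m \<in> ?M" for m x
      by (rule u(2)[rule_format, OF that])
    show "(norm (S1 x))\<^sup>2 \<le> lam (Suc k) * (norm x)\<^sup>2"
      if "\<And>m. m \<in> ?M \<Longrightarrow> m \<le> k \<Longrightarrow> x \<bullet> u m = 0" for k x
      using u(3) that by blast
    show "m \<in> {m. 1 \<le> m \<and> 0 < lam m} \<longleftrightarrow> 1 \<le> m \<and> 0 < lam m" for m by simp
  qed (fact nonneg mono lam1 lim \<tau>H \<tau>G that)+
  have init_eq: "init d = sqrt (s d * lam 1 ^ d)" if "1 \<le> d" for d
    unfolding init_def e_def scaled_problem_error_def by (rule tensor_svd.initial_error[OF tensor[OF that]])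
  have init_gt_0: "0 < init d" if "1 \<le> d" for d using init_eq[OF that] s lam1 that by simp
  define w where "w = (\<lambda>m. lam m / lam 1)"
  have w_small: "w \<in> o(g) \<longleftrightarrow> lam \<in> o(g)" for g :: "nat \<Rightarrow> real"
    unfolding w_def using lam1 by simp
  have w_top: "w 2 = 1 \<longleftrightarrow> lam 1 = lam 2" "w 2 < 1 \<longleftrightarrow> lam 2 < lam 1"
    using lam1 by (auto simp: w_def)
  interpret product_problem w e init
  proof
    show "w 1 = 1" "0 < w 2" using lam1 lam2 by (simp_all add: w_def)
    show "0 \<le> w m" if "1 \<le> m" for m using nonneg[OF that] lam1 by (simp add: w_def)
    show "w n \<le> w m" if "1 \<le> m" "m \<le> n" for m n
      using mono[OF that] lam1 by (simp add: w_def divide_right_mono)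
    show "w \<longlonglongrightarrow> 0" unfolding w_def using tendsto_divide[OF lim tendsto_const, of "lam 1"] lam1 by simp
    show "e 0 d = init d" for d by (simp add: init_def)
    show "0 < init d" if "1 \<le> d" for d by (rule init_gt_0[OF that])
    show "info_complexity e \<epsilon> d = card (large_products w d ((\<epsilon> / init d)\<^sup>2))"
      if "0 < \<epsilon>" "1 \<le> d" for \<epsilon> d
    proof -
      have "info_complexity e \<epsilon> d = card (large_products lam d (\<epsilon>\<^sup>2 / s d))"
        unfolding info_complexity_def e_def scaled_problem_error_def
        by (rule tensor_svd.least_error_index[OF tensor[OF that(2)] that(1)])
      \<comment> \<open>The scaling by s and the normalization by \<open>lam 1\<close> combine into
        the initial error, so that s no longer appears.\<close>
      also have "\<epsilon>\<^sup>2 / s d = lam 1 ^ d * (\<epsilon> / init d)\<^sup>2"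
      proof -
        have "0 < s d" using s that(2) by simp
        then have "(init d)\<^sup>2 = s d * lam 1 ^ d" using init_eq[OF that(2)] lam1 by simp
        with \<open>0 < s d\<close> show ?thesis using lam1 by (simp add: power_divide)
      qed
      finally show ?thesis unfolding w_def large_products_normalize[where w = lam, OF lam1] .
    qed
  qed
  show ?thesis
  proof (intro conjI allI impI)
    show "init d = sqrt (s d * lam 1 ^ d)" if "1 \<le> d" for d by (rule init_eq[OF that])
  next
    assume "0 < limsup (\<lambda>d. ereal (1 / real d * ln (init d)))"
    then show "curse_of_dimensionality e" by (rule curse_of_limsup)
  next
    fix \<alpha> :: real
    assume "0 \<le> \<alpha>" and theta: "init \<in> \<Theta>(\<lambda>d. real d powr \<alpha>)" and "lam 1 = lam 2"
    \<comment> \<open>The \<Theta> relation is reversed to get a lower bound on \<open>init\<close>;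
      for \<alpha> \<ge> 0 it keeps \<open>init\<close> above \<open>1 / C\<close> for all d \<ge>
      1.\<close>
    obtain C where C: "1 \<le> C" "\<And>d. 1 \<le> d \<Longrightarrow> real d powr \<alpha> \<le> C * init d"
      using bigo_imp_uniform_bound[OF bigthetaD1[OF theta[unfolded bigtheta_sym[of init]]]] init_pos by blast
    show "curse_of_dimensionality e"
    proof (rule curse_of_multiple_top)
      show "w 2 = 1" using w_top(1) \<open>lam 1 = lam 2\<close> by simp
      show "0 < 1 / C" using C(1) by simp
      fix d :: nat assume "1 \<le> d"
      then have "1 \<le> real d powr \<alpha>" using \<open>0 \<le> \<alpha>\<close> by (simp add: ge_one_powr_ge_zero)
      then have "1 \<le> C * init d" using C(2)[OF \<open>1 \<le> d\<close>] by linarith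
      then show "1 / C \<le> init d" using C(1) by (simp add: pos_divide_le_eq mult.commute)
    qed
  next
    fix \<alpha> :: real
    assume "0 \<le> \<alpha>" and theta: "init \<in> \<Theta>(\<lambda>d. real d powr \<alpha>)" and "lam 2 < lam 1"
    obtain C where C: "1 \<le> C" "\<And>d. 1 \<le> d \<Longrightarrow> real d powr \<alpha> \<le> C * init d"
      using bigo_imp_uniform_bound[OF bigthetaD1[OF theta[unfolded bigtheta_sym[of init]]]] init_pos by blast
    then have C': "1 / C * real d powr \<alpha> \<le> init d" if "1 \<le> d" for d
      using C(2)[OF that] C(1) by (simp add: pos_divide_le_eq mult.commute)
    obtain C2 where C2: "1 \<le> C2" "\<And>d. 1 \<le> d \<Longrightarrow> init d \<le> C2 * real d powr \<alpha>"
      using bigo_imp_uniform_bound[OF bigthetaD1[OF theta]] by auto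
    have exponent: "- 2 * (1 + \<alpha>) = - (2 * (1 + \<alpha>))" by simp
    show "weakly_tractable e \<longleftrightarrow> lam \<in> o(\<lambda>n. ln (real n) powr (- 2 * (1 + \<alpha>)))"
      unfolding w_small[symmetric] exponent
    proof
      assume "weakly_tractable e"
      then show "w \<in> o(\<lambda>n. ln (real n) powr (- (2 * (1 + \<alpha>))))"
        by (rule weakly_tractable_imp_decay_polynomial[OF _ \<open>0 \<le> \<alpha>\<close> _ C' _ C2(2)]) (use C C2 in auto)
    next
      assume "w \<in> o(\<lambda>n. ln (real n) powr (- (2 * (1 + \<alpha>))))"
      then show "weakly_tractable e"
        using \<open>lam 2 < lam 1\<close> w_top(2) by (intro weakly_tractable_of_decay_simple_top[OF \<open>0 \<le> \<alpha>\<close> C2]) auto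
    qed
  next
    assume "init \<longlonglongrightarrow> 0"
    then show "\<not> curse_of_dimensionality e" by (rule no_curse_of_vanishing_init)
  next
    assume init_lim: "init \<longlonglongrightarrow> 0"
    \<comment> \<open>A vanishing initial error is bounded, which is the growth condition with
      \<alpha> = 0.\<close>
    have "init \<in> O(\<lambda>_. 1)" by (rule bigoI_tendsto[where c = 0]) (use init_lim in auto)
    then obtain C where C: "1 \<le> C" "\<And>d. 1 \<le> d \<Longrightarrow> init d \<le> C * 1"
      using bigo_imp_uniform_bound[of init "\<lambda>_. 1"] by auto
    show "weakly_tractable e \<longleftrightarrow>
      (lam 1 = lam 2 \<and> lam \<in> o(\<lambda>n. ln (real n) powr (- 2)) \<and> init \<in> o(\<lambda>d. 1 / real d)) \<or>
      (lam 1 > lam 2 \<and> lam \<in> o(\<lambda>n. ln (real n) powr (- 2)))"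
    proof (cases "lam 1 = lam 2")
      case True
      have "weakly_tractable e \<longleftrightarrow> w \<in> o(\<lambda>n. ln (real n) powr (- 2)) \<and> init \<in> o(\<lambda>d. 1 / real d)"
      proof
        assume wt: "weakly_tractable e"
        from w_top(1) True have "w 2 = 1" by simp
        then show "w \<in> o(\<lambda>n. ln (real n) powr (- 2)) \<and> init \<in> o(\<lambda>d. 1 / real d)"
          using weakly_tractable_imp_decay_univariate[OF wt]
            weakly_tractable_imp_init_small[OF wt _ init_lim] by blast
      next
        assume "w \<in> o(\<lambda>n. ln (real n) powr (- 2)) \<and> init \<in> o(\<lambda>d. 1 / real d)"
        then show "weakly_tractable e"
          using weakly_tractable_of_decay_multiple_top[OF C(1)] C(2) by simp
      qed
      with True w_small show ?thesis by simp
    next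
      case False
      then have "w 2 < 1" using w_top(2) lam21 by simp
      have "weakly_tractable e" if "w \<in> o(\<lambda>n. ln (real n) powr (- 2))"
        by (rule weakly_tractable_of_decay_simple_top[of 0 C]) (use C \<open>w 2 < 1\<close> that in auto)
      with weakly_tractable_imp_decay_univariate
      have "weakly_tractable e \<longleftrightarrow> w \<in> o(\<lambda>n. ln (real n) powr (- 2))" by blast
      with False lam21 w_small show ?thesis by auto
    qed
  qed
qed

end
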